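(* The Lie group $G=\mathrm{SU}(2)^2\times\mathrm{U}(1)$ admits left-invariant strong $\mathrm{G}_2T$-structures solving the twisted $\mathrm{G}_2$ equation $$d\varphi\wedge\varphi=0,\qquad d\star\varphi=\theta\wedge\star\varphi,\qquad dT=0,\qquad d\theta=0,$$ and left-invariant coclosed $\mathrm{G}_2$-structures with closed torsion $3$-form.
   Context: Write $e^{ij\cdots}=e^i\wedge e^j\wedge\cdots$. A $\mathrm{G}_2$-structure on a $7$-manifold $M$ is a definite $3$-form $\varphi$: at each point there is a coframe $(e^1,\dots,e^7)$ with $\varphi=e^{123}+e^1\wedge(e^{45}+e^{67})+e^2\wedge(e^{46}-e^{57})-e^3\wedge(e^{47}+e^{56})$. It induces the metric $g_\varphi$ for which this coframe is orthonormal, the orientation $e^{1234567}$, and a Hodge operator $\star$. It is a $\mathrm{G}_2T$-structure if $d\star\varphi=\theta\wedge\star\varphi$ for some $1$-form $\theta$ (the Lee form; necessarily $\theta=-\frac13\star(\star d\varphi\wedge\varphi)$). Its torsion $3$-form is $T=\frac16\star(d\varphi\wedge\varphi)\,\varphi-\star d\varphi+\star(\theta\wedge\varphi)$. A $\mathrm{G}_2T$-structure is strong if $dT=0$. A coclosed $\mathrm{G}_2$-structure is one with $d\star\varphi=0$; it is a $\mathrm{G}_2T$-structure with $\theta=0$. *)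

theory Defs
  imports "HOL-Analysis.Analysis"
begin

section \<open>Alternating forms\<close>

text \<open>
  A \<open>k\<close>-form on a vector space is a function on lists of vectors of length \<open>k\<close>
  (its values on other lists are irrelevant).  A \<open>0\<close>-form is a number, namely its value on \<open>[]\<close>.
\<close>

definition alternating_form :: "'v::real_vector set \<Rightarrow> nat \<Rightarrow> ('v list \<Rightarrow> real) \<Rightarrow> bool" where
  "alternating_form W k \<alpha> \<longleftrightarrow>
    (\<forall>vs i u w a b. length vs = k \<and> set vs \<subseteq> W \<and> i < k \<and> u \<in> W \<and> w \<in> W \<longrightarrow>
       \<alpha> (vs[i := a *\<^sub>R u + b *\<^sub>R w]) = a * \<alpha> (vs[i := u]) + b * \<alpha> (vs[i := w])) \<and>
    (\<forall>vs i j. length vs = k \<and> set vs \<subseteq> W \<and> i < j \<and> j < k \<and> vs ! i = vs ! j \<longrightarrow> \<alpha> vs = 0)"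

definition shuffle_sign :: "nat set \<Rightarrow> nat set \<Rightarrow> real" where
  "shuffle_sign I J = (- 1) ^ card {(i, j). i \<in> I \<and> j \<in> J \<and> j < i}"

text \<open>
  Wedge product of a \<open>p\<close>-form with a form of any degree, as a sum over shuffles; this is the
  normalisation in which \<open>e\<^sup>1 \<and> \<dots> \<and> e\<^sup>n\<close> takes the value \<open>1\<close> on the dual frame.
\<close>

definition wedge :: "nat \<Rightarrow> ('v list \<Rightarrow> real) \<Rightarrow> ('v list \<Rightarrow> real) \<Rightarrow> 'v list \<Rightarrow> real" where
  "wedge p \<alpha> \<beta> vs =
    (\<Sum>I | I \<subseteq> {..<length vs} \<and> card I = p.
       shuffle_sign I ({..<length vs} - I) * \<alpha> (nths vs I) * \<beta> (nths vs (- I)))"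

fun coframe_wedge :: "(nat \<Rightarrow> 'v \<Rightarrow> real) \<Rightarrow> nat list \<Rightarrow> 'v list \<Rightarrow> real" where
  "coframe_wedge e [] = (\<lambda>vs. 1)"
| "coframe_wedge e (i # is) = wedge 1 (\<lambda>vs. e i (hd vs)) (coframe_wedge e is)"

section \<open>Coframes of seven-dimensional spaces and the Hodge operator\<close>

definition coframe7 :: "'v::real_vector set \<Rightarrow> (nat \<Rightarrow> 'v \<Rightarrow> real) \<Rightarrow> bool" where
  "coframe7 W e \<longleftrightarrow>
    (\<forall>i\<in>{1..7}. \<forall>u\<in>W. \<forall>w\<in>W. \<forall>a b. e i (a *\<^sub>R u + b *\<^sub>R w) = a * e i u + b * e i w) \<and>
    (\<forall>x :: nat \<Rightarrow> real. \<exists>!v. v \<in> W \<and> (\<forall>i\<in>{1..7}. e i v = x i))"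

definition dual_frame :: "'v set \<Rightarrow> (nat \<Rightarrow> 'v \<Rightarrow> real) \<Rightarrow> nat \<Rightarrow> 'v" where
  "dual_frame W e j = (THE v. v \<in> W \<and> (\<forall>i\<in>{1..7}. e i v = of_bool (i = j)))"

text \<open>
  Hodge operator on \<open>k\<close>-forms for the metric in which the coframe \<open>e\<close> is orthonormal and the
  orientation \<open>e\<^sup>1 \<and> \<dots> \<and> e\<^sup>7\<close>: the linear map sending \<open>e\<^sup>I\<close> to the form \<open>\<plusminus>e\<^sup>J\<close>, with \<open>J\<close> the
  complement of \<open>I\<close>, for which \<open>e\<^sup>I \<and> (\<plusminus>e\<^sup>J)\<close> is \<open>e\<^sup>1 \<and> \<dots> \<and> e\<^sup>7\<close>.
\<close>

definition hodge :: "'v set \<Rightarrow> (nat \<Rightarrow> 'v \<Rightarrow> real) \<Rightarrow> nat \<Rightarrow> ('v list \<Rightarrow> real) \<Rightarrow> 'v list \<Rightarrow> real" where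
  "hodge W e k \<alpha> ws =
    (\<Sum>I | I \<subseteq> {1..7} \<and> card I = k.
       \<alpha> (map (dual_frame W e) (sorted_list_of_set I)) *
       (shuffle_sign I ({1..7} - I) * coframe_wedge e (sorted_list_of_set ({1..7} - I)) ws))"

definition standard_G2_form :: "(nat \<Rightarrow> 'v \<Rightarrow> real) \<Rightarrow> 'v list \<Rightarrow> real" where
  "standard_G2_form e vs =
     coframe_wedge e [1,2,3] vs + coframe_wedge e [1,4,5] vs + coframe_wedge e [1,6,7] vs
   + coframe_wedge e [2,4,6] vs - coframe_wedge e [2,5,7] vs
   - coframe_wedge e [3,4,7] vs - coframe_wedge e [3,5,6] vs"

section \<open>Differential forms on submanifolds of a Euclidean space\<close>

text \<open>
  Below, \<open>M\<close> is an embedded submanifold of a Euclidean space, and a \<open>k\<close>-form on \<open>M\<close> assigns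
  to a point of \<open>M\<close> a function on \<open>k\<close>-lists of tangent vectors.  The notions are meaningful only
  on points of \<open>M\<close> and tangent vectors, so equality of forms is \<open>form_eq\<close>.
\<close>

definition tangent_space :: "'v::euclidean_space set \<Rightarrow> 'v \<Rightarrow> 'v set" where
  "tangent_space M p =
    {v. \<exists>\<gamma> :: real \<Rightarrow> 'v. (\<forall>t. \<gamma> t \<in> M) \<and> \<gamma> 0 = p \<and> (\<gamma> has_vector_derivative v) (at 0)}"

definition tangent_lists :: "'v::euclidean_space set \<Rightarrow> nat \<Rightarrow> 'v \<Rightarrow> 'v list set" where
  "tangent_lists M k p = {vs. length vs = k \<and> set vs \<subseteq> tangent_space M p}"

type_synonym 'v dform = "'v \<Rightarrow> 'v list \<Rightarrow> real"

definition form_eq :: "'v::euclidean_space set \<Rightarrow> nat \<Rightarrow> 'v dform \<Rightarrow> 'v dform \<Rightarrow> bool" where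
  "form_eq M k \<alpha> \<beta> \<longleftrightarrow> (\<forall>p\<in>M. \<forall>vs\<in>tangent_lists M k p. \<alpha> p vs = \<beta> p vs)"

text \<open>For open \<open>U\<close> and finite-dimensional domain, \<open>Ck_on k f U\<close> says that \<open>f\<close> is \<open>C\<^sup>k\<close> on \<open>U\<close>.\<close>

primrec Ck_on :: "nat \<Rightarrow> ('v::real_normed_vector \<Rightarrow> real) \<Rightarrow> 'v set \<Rightarrow> bool" where
  "Ck_on 0 f U \<longleftrightarrow> continuous_on U f"
| "Ck_on (Suc k) f U \<longleftrightarrow>
    (\<exists>D. (\<forall>x\<in>U. (f has_derivative D x) (at x)) \<and> (\<forall>v. Ck_on k (\<lambda>x. D x v) U))"

definition smooth_on :: "('v::real_normed_vector \<Rightarrow> real) \<Rightarrow> 'v set \<Rightarrow> bool" where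
  "smooth_on f U \<longleftrightarrow> (\<forall>k. Ck_on k f U)"

text \<open>\<open>\<eta>\<close> is a smooth form on an ambient neighbourhood of \<open>p\<close> whose pullback to \<open>M\<close> is \<open>\<omega>\<close>.\<close>

definition smooth_extension ::
    "'v::euclidean_space set \<Rightarrow> nat \<Rightarrow> 'v dform \<Rightarrow> 'v \<Rightarrow> 'v dform \<Rightarrow> bool" where
  "smooth_extension M k \<omega> p \<eta> \<longleftrightarrow>
    (\<exists>U. open U \<and> p \<in> U \<and>
       (\<forall>q\<in>U. alternating_form UNIV k (\<eta> q)) \<and>
       (\<forall>us. length us = k \<longrightarrow> smooth_on (\<lambda>q. \<eta> q us) U) \<and>
       (\<forall>q\<in>U \<inter> M. \<forall>vs\<in>tangent_lists M k q. \<eta> q vs = \<omega> q vs))"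

definition smooth_form :: "'v::euclidean_space set \<Rightarrow> nat \<Rightarrow> 'v dform \<Rightarrow> bool" where
  "smooth_form M k \<omega> \<longleftrightarrow> (\<forall>p\<in>M. \<exists>\<eta>. smooth_extension M k \<omega> p \<eta>)"

text \<open>
  Exterior derivative of a smooth \<open>k\<close>-form on \<open>M\<close>: the pullback to \<open>M\<close> of the ambient (constant
  coefficient) exterior derivative of a local extension.  As \<open>d\<close> commutes with pullbacks, the
  choice of the extension is immaterial.
\<close>

definition ext_deriv :: "'v::euclidean_space set \<Rightarrow> nat \<Rightarrow> 'v dform \<Rightarrow> 'v dform" where
  "ext_deriv M k \<omega> p vs =
    (let \<eta> = (SOME \<eta>. smooth_extension M k \<omega> p \<eta>) in
       \<Sum>i\<le>k. (- 1) ^ i * frechet_derivative (\<lambda>q. \<eta> q (nths vs (- {i}))) (at p) (vs ! i))"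

definition wedge_form :: "nat \<Rightarrow> 'v dform \<Rightarrow> 'v dform \<Rightarrow> 'v dform" where
  "wedge_form p \<alpha> \<beta> q = wedge p (\<alpha> q) (\<beta> q)"

definition hodge_form ::
    "'v::euclidean_space set \<Rightarrow> ('v \<Rightarrow> nat \<Rightarrow> 'v \<Rightarrow> real) \<Rightarrow> nat \<Rightarrow> 'v dform \<Rightarrow> 'v dform" where
  "hodge_form M e k \<alpha> q = hodge (tangent_space M q) (e q) k (\<alpha> q)"

section \<open>\<open>G\<^sub>2\<close>-structures with torsion\<close>

text \<open>
  \<open>e\<close> chooses, at each point, a coframe in which \<open>\<phi>\<close> has the standard expression; it need not
  depend continuously on the point.  As the stabiliser of the standard form lies in \<open>SO(7)\<close>, the
  metric, the orientation and \<open>hodge_form M e\<close> depend only on \<open>\<phi>\<close>, so \<open>e\<close> carries no extra data.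
\<close>

definition G2_structure ::
    "'v::euclidean_space set \<Rightarrow> 'v dform \<Rightarrow> ('v \<Rightarrow> nat \<Rightarrow> 'v \<Rightarrow> real) \<Rightarrow> bool" where
  "G2_structure M \<phi> e \<longleftrightarrow>
    smooth_form M 3 \<phi> \<and>
    (\<forall>p\<in>M. coframe7 (tangent_space M p) (e p)) \<and>
    form_eq M 3 \<phi> (\<lambda>p. standard_G2_form (e p))"

definition G2T_structure ::
    "'v::euclidean_space set \<Rightarrow> 'v dform \<Rightarrow> ('v \<Rightarrow> nat \<Rightarrow> 'v \<Rightarrow> real) \<Rightarrow> 'v dform \<Rightarrow> bool" where
  "G2T_structure M \<phi> e \<theta> \<longleftrightarrow>
    G2_structure M \<phi> e \<and> smooth_form M 1 \<theta> \<and>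
    form_eq M 5 (ext_deriv M 4 (hodge_form M e 3 \<phi>)) (wedge_form 1 \<theta> (hodge_form M e 3 \<phi>))"

definition torsion_form ::
    "'v::euclidean_space set \<Rightarrow> 'v dform \<Rightarrow> ('v \<Rightarrow> nat \<Rightarrow> 'v \<Rightarrow> real) \<Rightarrow> 'v dform \<Rightarrow> 'v dform" where
  "torsion_form M \<phi> e \<theta> p vs =
     1 / 6 * hodge_form M e 7 (wedge_form 4 (ext_deriv M 3 \<phi>) \<phi>) p [] * \<phi> p vs
   - hodge_form M e 4 (ext_deriv M 3 \<phi>) p vs
   + hodge_form M e 4 (wedge_form 1 \<theta> \<phi>) p vs"

definition closed_form :: "'v::euclidean_space set \<Rightarrow> nat \<Rightarrow> 'v dform \<Rightarrow> bool" where
  "closed_form M k \<omega> \<longleftrightarrow> smooth_form M k \<omega> \<and> form_eq M (k + 1) (ext_deriv M k \<omega>) (\<lambda>p vs. 0)"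

definition strong_G2T_structure ::
    "'v::euclidean_space set \<Rightarrow> 'v dform \<Rightarrow> ('v \<Rightarrow> nat \<Rightarrow> 'v \<Rightarrow> real) \<Rightarrow> 'v dform \<Rightarrow> bool" where
  "strong_G2T_structure M \<phi> e \<theta> \<longleftrightarrow>
    G2T_structure M \<phi> e \<theta> \<and> closed_form M 3 (torsion_form M \<phi> e \<theta>)"

definition coclosed_G2_structure ::
    "'v::euclidean_space set \<Rightarrow> 'v dform \<Rightarrow> ('v \<Rightarrow> nat \<Rightarrow> 'v \<Rightarrow> real) \<Rightarrow> bool" where
  "coclosed_G2_structure M \<phi> e \<longleftrightarrow>
    G2_structure M \<phi> e \<and> closed_form M 4 (hodge_form M e 3 \<phi>)"

section \<open>The Lie group \<open>SU(2)\<^sup>2 \<times> U(1)\<close>\<close>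

definition conj_transpose :: "complex^'n^'m \<Rightarrow> complex^'m^'n" where
  "conj_transpose A = (\<chi> i j. cnj (A $ j $ i))"

definition SU2 :: "(complex^2^2) set" where
  "SU2 = {A. A ** conj_transpose A = mat 1 \<and> det A = 1}"

definition U1 :: "complex set" where
  "U1 = {z. cmod z = 1}"

type_synonym ambient = "(complex^2^2) \<times> (complex^2^2) \<times> complex"

definition SU2_SU2_U1 :: "ambient set" where
  "SU2_SU2_U1 = SU2 \<times> SU2 \<times> U1"

definition group_mult :: "ambient \<Rightarrow> ambient \<Rightarrow> ambient" where
  "group_mult = (\<lambda>(A, B, z) (C, D, w). (A ** C, B ** D, z * w))"

text \<open>
  Invariance of a \<open>k\<close>-form on a Lie group \<open>G\<close> with multiplication \<open>m\<close> under pullback by the left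
  translations \<open>m g\<close>.
\<close>

definition left_invariant ::
    "'v::euclidean_space set \<Rightarrow> ('v \<Rightarrow> 'v \<Rightarrow> 'v) \<Rightarrow> nat \<Rightarrow> 'v dform \<Rightarrow> bool" where
  "left_invariant G m k \<omega> \<longleftrightarrow>
    (\<forall>g\<in>G. form_eq G k (\<lambda>p vs. \<omega> (m g p) (map (frechet_derivative (m g) (at p)) vs)) \<omega>)"

end

(*
  Let E_1, E_2, E_3 and F_1, F_2, F_3 be the left-invariant frames of the two SU(2) factors given by
  right multiplication with the quaternion units, so [E_1, E_2] = 2 E_3 etc., and H the one of U(1).
  A left-invariant G2-structure whose metric makes these seven fields orthonormal (this metric is
  bi-invariant) is parallel for the flat connection that annihilates left-invariant fields; its
  torsion 3-form is therefore the closed form -2 (E^123 + F^123), whatever the relative position of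
  phi and the Lie algebra.  Rotating the plane (E_1, F_1) by an angle with cosine c and sine s and
  taking (c E_1 + s F_1, E_2, E_3, F_2, F_3, c F_1 - s E_1, H) as the G2-frame gives
    d phi wedge phi = -12 (c + s) e^1234567,   theta = 2 (s - c) e^7.
  The choice s = -c solves the twisted equation and s = c is coclosed.

  The exterior derivative is computed from the Maurer-Cartan type formula for its values on the frame.
  To get it for an arbitrary ambient extension eta of a form with constant components, differentiate
  eta(q)(Y_j1(q), ..., Y_jk(q)) = const along curves in the group.
*)

theory Submission
  imports Defs
begin

section \<open>Alternating forms\<close>

text \<open>Both coefficients can be read off from the torsion form: its inner product with phi is
  -2 (c + s), a sixth of the coefficient of d phi wedge phi, and its contraction with the dual
  4-form is 2 (s - c) e^7. Without rotation (s = 0) neither vanishes, which is why an angle is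
  introduced. The obstacle is \<open>ext_deriv\<close>: it differentiates an extension picked by
  \<open>SOME\<close>, of which only the values on tangent vectors at points of the group are known.
  The derivative of one frame field along another leaves the tangent space, and only commutators
  return to it. The bracket formula must therefore be assembled for the unknown extension before the
  extension can be exchanged for the form. After that no analysis is left. Forms are represented by
  their constant components on index lists, d acts on components algebraically, and each equation
  becomes a polynomial identity in c and s, checked on the increasing lists.\<close>

text \<open>
  On subspaces this is equivalent to \<open>alternating_form\<close>; vanishing is only demanded for adjacent
  equal arguments, which is what inductions along the argument list can deliver.
\<close>

definition adj_alternating :: "'v::real_vector set \<Rightarrow> nat \<Rightarrow> ('v list \<Rightarrow> real) \<Rightarrow> bool" where
  "adj_alternating W k \<alpha> \<longleftrightarrow>
    (\<forall>xs u w ys a b. length xs + length ys + 1 = k \<and> set xs \<subseteq> W \<and> set ys \<subseteq> W \<and> u \<in> W \<and> w \<in> W \<longrightarrow>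
       \<alpha> (xs @ (a *\<^sub>R u + b *\<^sub>R w) # ys) = a * \<alpha> (xs @ u # ys) + b * \<alpha> (xs @ w # ys)) \<and>
    (\<forall>xs v ys. length xs + length ys + 2 = k \<and> set xs \<subseteq> W \<and> set ys \<subseteq> W \<and> v \<in> W \<longrightarrow>
       \<alpha> (xs @ v # v # ys) = 0)"

lemma adj_alternating_linear:
  assumes "adj_alternating W k \<alpha>" "length xs + length ys + 1 = k" "set xs \<subseteq> W" "set ys \<subseteq> W" "u \<in> W" "w \<in> W"
  shows "\<alpha> (xs @ (a *\<^sub>R u + b *\<^sub>R w) # ys) = a * \<alpha> (xs @ u # ys) + b * \<alpha> (xs @ w # ys)"
  using assms unfolding adj_alternating_def by blast

lemma adj_alternating_adjacent:
  assumes "adj_alternating W k \<alpha>" "length xs + length ys + 2 = k" "set xs \<subseteq> W" "set ys \<subseteq> W" "v \<in> W"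
  shows "\<alpha> (xs @ v # v # ys) = 0"
  using assms unfolding adj_alternating_def by blast

text \<open>Polarization: the value on two adjacent copies of \<open>u + w\<close> vanishes and
  expands into four terms, two of which vanish.\<close>

lemma adj_alternating_swap:
  assumes W: "subspace W" and alt: "adj_alternating W k \<alpha>"
    and *: "length xs + length ys + 2 = k" "set xs \<subseteq> W" "set ys \<subseteq> W" "u \<in> W" "w \<in> W"
  shows "\<alpha> (xs @ u # w # ys) = - \<alpha> (xs @ w # u # ys)"
proof -
  have uw: "u + w \<in> W" using W * by (simp add: subspace_add)
  have 1: "\<alpha> (xs @ (u + w) # z # ys) = \<alpha> (xs @ u # z # ys) + \<alpha> (xs @ w # z # ys)" if "z \<in> W" for z
    using adj_alternating_linear[OF alt, of xs "z # ys" u w 1 1] * that by simp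
  have 2: "\<alpha> (xs @ z # (u + w) # ys) = \<alpha> (xs @ z # u # ys) + \<alpha> (xs @ z # w # ys)" if "z \<in> W" for z
    using adj_alternating_linear[OF alt, of "xs @ [z]" ys u w 1 1] * that by simp
  have 3: "\<alpha> (xs @ z # z # ys) = 0" if "z \<in> W" for z
    using adj_alternating_adjacent[OF alt] * that by simp
  have "\<alpha> (xs @ (u + w) # (u + w) # ys) = 0" using 3 uw by blast
  then show ?thesis using 1[OF uw] 2[of u] 2[of w] 3[of u] 3[of w] * by simp
qed

lemma adj_alternating_move:
  assumes W: "subspace W" and alt: "adj_alternating W k \<alpha>"
    and "length xs + length ys + length zs + 1 = k" "set xs \<subseteq> W" "set ys \<subseteq> W" "set zs \<subseteq> W" "v \<in> W"
  shows "\<alpha> (xs @ v # ys @ zs) = (- 1) ^ length ys * \<alpha> (xs @ ys @ v # zs)"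
  using assms(3-)
proof (induction ys arbitrary: xs)
  case (Cons y ys)
  have "\<alpha> (xs @ v # (y # ys) @ zs) = - \<alpha> ((xs @ [y]) @ v # ys @ zs)"
    using adj_alternating_swap[OF W alt, of xs "ys @ zs" v y] Cons.prems by simp
  also have "\<dots> = - ((- 1) ^ length ys * \<alpha> ((xs @ [y]) @ ys @ v # zs))"
    by (subst Cons.IH) (use Cons.prems in auto)
  finally show ?case by simp
qed simp

text \<open>Moving the first of two equal arguments next to the second changes only the
  sign.\<close>

lemma adj_alternating_repeat:
  assumes W: "subspace W" and alt: "adj_alternating W k \<alpha>"
    and "length vs = k" "set vs \<subseteq> W" "\<not> distinct vs"
  shows "\<alpha> vs = 0"
proof -
  obtain xs ys zs v where vs: "vs = xs @ [v] @ ys @ [v] @ zs"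
    using assms not_distinct_decomp by blast
  have "\<alpha> (xs @ v # ys @ (v # zs)) = (- 1) ^ length ys * \<alpha> (xs @ ys @ v # v # zs)"
    by (rule adj_alternating_move[OF W alt]) (use vs assms in auto)
  moreover have "\<alpha> ((xs @ ys) @ v # v # zs) = 0"
    by (rule adj_alternating_adjacent[OF alt]) (use vs assms in auto)
  ultimately show ?thesis using vs by simp
qed

lemma alternating_form_iff_adj:
  assumes W: "subspace W"
  shows "alternating_form W k \<alpha> \<longleftrightarrow> adj_alternating W k \<alpha>"
proof
  assume alt: "alternating_form W k \<alpha>"
  show "adj_alternating W k \<alpha>"
    unfolding adj_alternating_def
  proof (intro conjI allI impI)
    fix xs ys :: "'a list" and u w a b
    assume *: "length xs + length ys + 1 = k \<and> set xs \<subseteq> W \<and> set ys \<subseteq> W \<and> u \<in> W \<and> w \<in> W"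
    \<comment> \<open>The entry \<open>0\<close> is a placeholder that the update overwrites; it
      must lie in \<open>W\<close>, as \<open>alternating_form\<close> inspects the list before the
      update.\<close>
    have "\<alpha> ((xs @ 0 # ys)[length xs := a *\<^sub>R u + b *\<^sub>R w]) =
        a * \<alpha> ((xs @ 0 # ys)[length xs := u]) + b * \<alpha> ((xs @ 0 # ys)[length xs := w])"
      using alt[unfolded alternating_form_def, THEN conjunct1, rule_format, of "xs @ 0 # ys" "length xs" u w a b]
        * subspace_0[OF W] by simp
    then show "\<alpha> (xs @ (a *\<^sub>R u + b *\<^sub>R w) # ys) = a * \<alpha> (xs @ u # ys) + b * \<alpha> (xs @ w # ys)"
      by simp
  next
    fix xs ys :: "'a list" and v
    assume *: "length xs + length ys + 2 = k \<and> set xs \<subseteq> W \<and> set ys \<subseteq> W \<and> v \<in> W"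
    show "\<alpha> (xs @ v # v # ys) = 0"
      using alt[unfolded alternating_form_def, THEN conjunct2, rule_format,
          of "xs @ v # v # ys" "length xs" "Suc (length xs)"] * by (simp add: nth_append)
  qed
next
  assume alt: "adj_alternating W k \<alpha>"
  show "alternating_form W k \<alpha>"
    unfolding alternating_form_def
  proof (intro conjI allI impI)
    fix vs i u w a b
    assume *: "length vs = k \<and> set vs \<subseteq> W \<and> i < k \<and> u \<in> W \<and> w \<in> W"
    have "set (take i vs) \<subseteq> W" "set (drop (Suc i) vs) \<subseteq> W"
      using * by (meson set_take_subset set_drop_subset order_trans)+
    then show "\<alpha> (vs[i := a *\<^sub>R u + b *\<^sub>R w]) = a * \<alpha> (vs[i := u]) + b * \<alpha> (vs[i := w])"
      using adj_alternating_linear[OF alt, of "take i vs" "drop (Suc i) vs"] *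
      by (simp add: upd_conv_take_nth_drop)
  next
    fix vs i j
    assume "length vs = k \<and> set vs \<subseteq> W \<and> i < j \<and> j < k \<and> vs ! i = vs ! j"
    then show "\<alpha> vs = 0"
      using adj_alternating_repeat[OF W alt] by (metis distinct_conv_nth nat_neq_iff order.strict_trans)
  qed
qed

lemma adj_alternating_interior:
  assumes "adj_alternating W (Suc k) \<alpha>" "v \<in> W"
  shows "adj_alternating W k (\<lambda>us. \<alpha> (v # us))"
  unfolding adj_alternating_def
proof (intro conjI allI impI)
  fix xs ys :: "'a list" and u w a b
  assume "length xs + length ys + 1 = k \<and> set xs \<subseteq> W \<and> set ys \<subseteq> W \<and> u \<in> W \<and> w \<in> W"
  then show "\<alpha> (v # xs @ (a *\<^sub>R u + b *\<^sub>R w) # ys) = a * \<alpha> (v # xs @ u # ys) + b * \<alpha> (v # xs @ w # ys)"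
    using adj_alternating_linear[OF assms(1), of "v # xs" ys u w a b] assms(2) by simp
next
  fix xs ys :: "'a list" and u
  assume "length xs + length ys + 2 = k \<and> set xs \<subseteq> W \<and> set ys \<subseteq> W \<and> u \<in> W"
  then show "\<alpha> (v # xs @ u # u # ys) = 0"
    using adj_alternating_adjacent[OF assms(1), of "v # xs" ys u] assms(2) by simp
qed

lemma adj_alternating_zero: "adj_alternating W k (\<lambda>_. 0)"
  by (simp add: adj_alternating_def)

lemma adj_alternating_scale: "adj_alternating W k \<alpha> \<Longrightarrow> adj_alternating W k (\<lambda>vs. c * \<alpha> vs)"
  by (simp add: adj_alternating_def algebra_simps)

lemma adj_alternating_add:
  "adj_alternating W k \<alpha> \<Longrightarrow> adj_alternating W k \<beta> \<Longrightarrow> adj_alternating W k (\<lambda>vs. \<alpha> vs + \<beta> vs)"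
  by (simp add: adj_alternating_def algebra_simps)

lemma adj_alternating_diff:
  "adj_alternating W k \<alpha> \<Longrightarrow> adj_alternating W k \<beta> \<Longrightarrow> adj_alternating W k (\<lambda>vs. \<alpha> vs - \<beta> vs)"
  by (simp add: adj_alternating_def algebra_simps)

lemma adj_alternating_sum:
  "(\<And>i. i \<in> S \<Longrightarrow> adj_alternating W k (\<alpha> i)) \<Longrightarrow> adj_alternating W k (\<lambda>vs. \<Sum>i\<in>S. \<alpha> i vs)"
  by (induction S rule: infinite_finite_induct) (auto intro: adj_alternating_zero adj_alternating_add)

text \<open>\<open>W\<close> has to be a subspace because the linear combination in a slot must
  again be an admissible argument for the comparison.\<close>

lemma adj_alternating_cong:
  assumes W: "subspace W" and "adj_alternating W k \<alpha>" "\<And>vs. length vs = k \<Longrightarrow> set vs \<subseteq> W \<Longrightarrow> \<alpha> vs = \<beta> vs"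
  shows "adj_alternating W k \<beta>"
  unfolding adj_alternating_def
proof (intro conjI allI impI)
  fix xs ys :: "'a list" and u w a b
  assume *: "length xs + length ys + 1 = k \<and> set xs \<subseteq> W \<and> set ys \<subseteq> W \<and> u \<in> W \<and> w \<in> W"
  have "a *\<^sub>R u + b *\<^sub>R w \<in> W" using W * by (simp add: subspace_add subspace_mul)
  then show "\<beta> (xs @ (a *\<^sub>R u + b *\<^sub>R w) # ys) = a * \<beta> (xs @ u # ys) + b * \<beta> (xs @ w # ys)"
    using adj_alternating_linear[OF assms(2), of xs ys u w a b] * by (simp add: assms(3)[symmetric])
next
  fix xs ys :: "'a list" and u
  assume *: "length xs + length ys + 2 = k \<and> set xs \<subseteq> W \<and> set ys \<subseteq> W \<and> u \<in> W"
  then show "\<beta> (xs @ u # u # ys) = 0"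
    using adj_alternating_adjacent[OF assms(2), of xs ys u] by (simp add: assms(3)[symmetric])
qed

section \<open>Wedge products and contraction\<close>

lemma wedge_Nil: "wedge p \<alpha> \<beta> [] = (if p = 0 then \<alpha> [] * \<beta> [] else 0)"
proof -
  have "{I. I \<subseteq> {..<length ([]::'a list)} \<and> card I = p} = (if p = 0 then {{}} else {})" by auto
  then show ?thesis by (simp add: wedge_def shuffle_sign_def)
qed

lemma shuffle_sign_image_Suc:
  "shuffle_sign (Suc ` I) (Suc ` J) = shuffle_sign I J"
proof -
  have "{(i, j). i \<in> Suc ` I \<and> j \<in> Suc ` J \<and> j < i} = map_prod Suc Suc ` {(i, j). i \<in> I \<and> j \<in> J \<and> j < i}"
    by auto
  moreover have "inj_on (map_prod Suc Suc) {(i, j). i \<in> I \<and> j \<in> J \<and> j < i}"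
    by (auto intro!: inj_onI)
  ultimately show ?thesis by (simp add: shuffle_sign_def card_image)
qed

lemma shuffle_sign_insert_0_left:
  assumes "0 \<notin> J"
  shows "shuffle_sign (insert 0 I) J = shuffle_sign I J"
proof -
  have "{(i, j). i \<in> insert 0 I \<and> j \<in> J \<and> j < i} = {(i, j). i \<in> I \<and> j \<in> J \<and> j < i}"
    by auto
  then show ?thesis by (simp only: shuffle_sign_def)
qed

lemma shuffle_sign_insert_0_right:
  assumes "0 \<notin> I" "0 \<notin> J" "finite I" "finite J"
  shows "shuffle_sign I (insert 0 J) = (- 1) ^ card I * shuffle_sign I J"
proof -
  have "{(i, j). i \<in> I \<and> j \<in> insert 0 J \<and> j < i} = (\<lambda>i. (i, 0)) ` I \<union> {(i, j). i \<in> I \<and> j \<in> J \<and> j < i}"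
    using assms by (auto intro: gr0I)
  moreover have "finite {(i, j). i \<in> I \<and> j \<in> J \<and> j < i}"
    by (rule finite_subset[of _ "I \<times> J"]) (use assms in auto)
  moreover have "(\<lambda>i. (i, 0)) ` I \<inter> {(i, j). i \<in> I \<and> j \<in> J \<and> j < i} = {}" using assms by auto
  ultimately have "card {(i, j). i \<in> I \<and> j \<in> insert 0 J \<and> j < i} = card I + card {(i, j). i \<in> I \<and> j \<in> J \<and> j < i}"
    using assms by (simp add: card_Un_disjoint card_image inj_on_def)
  then show ?thesis by (simp add: shuffle_sign_def power_add)
qed

text \<open>
  Contraction with \<open>v\<close> is an antiderivation for the wedge product.
\<close>

lemma wedge_Cons:
  "wedge p \<alpha> \<beta> (v # vs) =
     (if p = 0 then 0 else wedge (p - 1) (\<lambda>us. \<alpha> (v # us)) \<beta> vs) + (- 1) ^ p * wedge p \<alpha> (\<lambda>us. \<beta> (v # us)) vs"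
proof -
  define n where "n = length vs"
  let ?f = "\<lambda>I. shuffle_sign I ({..<Suc n} - I) * \<alpha> (nths (v # vs) I) * \<beta> (nths (v # vs) (- I))"
  let ?S = "\<lambda>q. {I. I \<subseteq> {..<n} \<and> card I = q}"
  \<comment> \<open>Shuffles split according to whether position 0, which holds \<open>v\<close>,
    belongs to \<open>\<alpha>\<close> or to \<open>\<beta>\<close>. Deleting it and shifting down
    is a bijection onto shuffles of \<open>vs\<close>; in the second case \<open>v\<close> passes
    the \<open>p\<close> arguments of \<open>\<alpha>\<close>, whence the sign.\<close>
  let ?A = "{I. I \<subseteq> {..<Suc n} \<and> card I = p \<and> 0 \<in> I}" and ?B = "{I. I \<subseteq> {..<Suc n} \<and> card I = p \<and> 0 \<notin> I}"
  have fin: "finite ?A" "finite ?B" by (auto intro: finite_subset[of _ "Pow {..<Suc n}"])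
  have "wedge p \<alpha> \<beta> (v # vs) = sum ?f (?A \<union> ?B)"
    unfolding wedge_def by (rule sum.cong) (auto simp: n_def)
  also have "\<dots> = sum ?f ?A + sum ?f ?B"
    using fin by (intro sum.union_disjoint) auto
  finally have split: "wedge p \<alpha> \<beta> (v # vs) = sum ?f ?A + sum ?f ?B" .
  have shift: "Suc ` {i. Suc i \<in> I} = I - {0}" for I
    by (auto simp: image_iff) (metis Suc_pred gr0I)
  have A: "sum ?f ?A = (if p = 0 then 0 else wedge (p - 1) (\<lambda>us. \<alpha> (v # us)) \<beta> vs)"
  proof (cases "p = 0")
    case True
    then have "?A = {}" by (auto dest: finite_subset)
    then have "sum ?f ?A = 0" by (simp only: sum.empty)
    then show ?thesis using True by simp
  next
    case False
    have "sum ?f ?A = (\<Sum>I\<in>?S (p - 1). shuffle_sign I ({..<n} - I) * \<alpha> (v # nths vs I) * \<beta> (nths vs (- I)))"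
    proof (rule sum.reindex_bij_witness[of _ "\<lambda>I. insert 0 (Suc ` I)" "\<lambda>I. {i. Suc i \<in> I}"])
      fix I assume I: "I \<in> ?A"
      then have fI: "finite I" by (auto dest: finite_subset)
      show eq: "insert 0 (Suc ` {i. Suc i \<in> I}) = I" using I by (auto simp: shift)
      have "card {i. Suc i \<in> I} = card (I - {0})"
        unfolding shift[symmetric] by (simp add: card_image)
      then show "{i. Suc i \<in> I} \<in> ?S (p - 1)" using I fI by auto
      let ?I = "{i. Suc i \<in> I}"
      have "{..<Suc n} - I = Suc ` ({..<n} - ?I)"
        using I by (auto simp: lessThan_Suc_eq_insert_0)
      then have "shuffle_sign I ({..<Suc n} - I) = shuffle_sign ?I ({..<n} - ?I)"
        by (subst eq[symmetric]) (simp add: shuffle_sign_insert_0_left shuffle_sign_image_Suc)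
      moreover have "- ?I = {j. Suc j \<in> - I}" by auto
      ultimately show "shuffle_sign ?I ({..<n} - ?I) * \<alpha> (v # nths vs ?I) * \<beta> (nths vs (- ?I)) = ?f I"
        using I by (simp add: nths_Cons)
    next
      fix I assume I: "I \<in> ?S (p - 1)"
      then have fI: "finite I" by (auto dest: finite_subset)
      show "{i. Suc i \<in> insert 0 (Suc ` I)} = I" by auto
      show "insert 0 (Suc ` I) \<in> ?A" using I fI False by (auto simp: card_image)
    qed
    then show ?thesis using False by (simp add: wedge_def n_def)
  qed
  have B: "sum ?f ?B = (- 1) ^ p * wedge p \<alpha> (\<lambda>us. \<beta> (v # us)) vs"
  proof -
    have "sum ?f ?B = (\<Sum>I\<in>?S p. (- 1) ^ p * (shuffle_sign I ({..<n} - I) * \<alpha> (nths vs I) * \<beta> (v # nths vs (- I))))"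
    proof (rule sum.reindex_bij_witness[of _ "\<lambda>I. Suc ` I" "\<lambda>I. {i. Suc i \<in> I}"])
      fix I assume I: "I \<in> ?B"
      then have fI: "finite I" by (auto dest: finite_subset)
      show eq: "Suc ` {i. Suc i \<in> I} = I" using I by (auto simp: shift)
      let ?I = "{i. Suc i \<in> I}"
      have cI: "card ?I = card I"
        by (subst (2) eq[symmetric]) (simp add: card_image)
      then show "?I \<in> ?S p" using I fI by auto
      have fi: "finite ?I" using fI by (metis eq finite_imageD inj_Suc)
      have "{..<Suc n} - I = insert 0 (Suc ` ({..<n} - ?I))"
        using I by (auto simp: lessThan_Suc_eq_insert_0)
      then have "shuffle_sign I ({..<Suc n} - I) = (- 1) ^ p * shuffle_sign ?I ({..<n} - ?I)"
        using I fi by (subst eq[symmetric])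
          (simp add: shuffle_sign_insert_0_right shuffle_sign_image_Suc card_image cI)
      moreover have "- ?I = {j. Suc j \<in> - I}" by auto
      ultimately show "(- 1) ^ p * (shuffle_sign ?I ({..<n} - ?I) * \<alpha> (nths vs ?I) * \<beta> (v # nths vs (- ?I))) = ?f I"
        using I by (simp add: nths_Cons)
    next
      fix I assume I: "I \<in> ?S p"
      show "{i. Suc i \<in> Suc ` I} = I" by auto
      show "Suc ` I \<in> ?B" using I by (auto simp: card_image)
    qed
    then show ?thesis by (simp add: wedge_def n_def sum_distrib_left)
  qed
  show ?thesis using split A B by simp
qed

text \<open>The values of forms on lists of the wrong length are arbitrary, so factors may only be
  compared on sublists of the length at which the wedge product evaluates them.\<close>

lemma wedge_cong:
  assumes "\<And>us. set us \<subseteq> set vs \<Longrightarrow> length us = p \<Longrightarrow> \<alpha> us = \<alpha>' us"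
    and "\<And>us. set us \<subseteq> set vs \<Longrightarrow> length us + p = length vs \<Longrightarrow> \<beta> us = \<beta>' us"
  shows "wedge p \<alpha> \<beta> vs = wedge p \<alpha>' \<beta>' vs"
  unfolding wedge_def
proof (rule sum.cong)
  fix I assume I: "I \<in> {I. I \<subseteq> {..<length vs} \<and> card I = p}"
  have "{i. i < length vs \<and> i \<in> I} = I" "{i. i < length vs \<and> i \<in> - I} = {..<length vs} - I"
    using I by auto
  moreover have "card ({..<length vs} - I) + p = length vs"
  proof -
    have "I \<subseteq> {..<length vs}" "card I = p" using I by auto
    moreover from this have "card I \<le> card {..<length vs}" by (intro card_mono) auto
    ultimately show ?thesis by (simp add: card_Diff_subset finite_subset[OF _ finite_lessThan])
  qed
  ultimately have "length (nths vs I) = p" "length (nths vs (- I)) + p = length vs"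
    using I by (auto simp: length_nths)
  then show "shuffle_sign I ({..<length vs} - I) * \<alpha> (nths vs I) * \<beta> (nths vs (- I)) =
      shuffle_sign I ({..<length vs} - I) * \<alpha>' (nths vs I) * \<beta>' (nths vs (- I))"
    using assms by (simp add: set_nths_subset)
qed simp

lemma wedge_short:
  assumes "length vs < p" shows "wedge p \<alpha> \<beta> vs = 0"
proof -
  have "card I < p" if "I \<subseteq> {..<length vs}" for I
    using that assms by (metis card_lessThan card_mono finite_lessThan le_less_trans)
  then have "{I. I \<subseteq> {..<length vs} \<and> card I = p} = {}" by auto
  then show ?thesis by (simp only: wedge_def sum.empty)
qed

lemma wedge_linear_left:
  "wedge p (\<lambda>us. a * \<alpha> us + b * \<alpha>' us) \<beta> vs = a * wedge p \<alpha> \<beta> vs + b * wedge p \<alpha>' \<beta> vs"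
  unfolding wedge_def sum_distrib_left sum.distrib[symmetric] by (rule sum.cong) (simp_all add: algebra_simps)

lemma wedge_linear_right:
  "wedge p \<alpha> (\<lambda>us. a * \<beta> us + b * \<beta>' us) vs = a * wedge p \<alpha> \<beta> vs + b * wedge p \<alpha> \<beta>' vs"
  unfolding wedge_def sum_distrib_left sum.distrib[symmetric] by (rule sum.cong) (simp_all add: algebra_simps)

lemma wedge_zero_left: "wedge p (\<lambda>_. 0) \<beta> vs = 0"
  by (simp add: wedge_def)

lemma wedge_zero_right: "wedge p \<alpha> (\<lambda>_. 0) vs = 0"
  by (simp add: wedge_def)

lemma wedge_map: "wedge p \<alpha> \<beta> (map f js) = wedge p (\<lambda>us. \<alpha> (map f us)) (\<lambda>us. \<beta> (map f us)) js"
  by (simp add: wedge_def nths_map)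

text \<open>Arguments in front of the slot are peeled off by contraction, which lowers the degree of
  one factor. When the slot is in front, linearity of the contraction in the contracted vector
  finishes.\<close>

lemma wedge_slot_linear:
  assumes "adj_alternating W p \<alpha>" "adj_alternating W q \<beta>"
    "length xs + length ys + 1 = p + q" "set xs \<subseteq> W" "set ys \<subseteq> W" "u \<in> W" "w \<in> W"
  shows "wedge p \<alpha> \<beta> (xs @ (a *\<^sub>R u + b *\<^sub>R w) # ys) = a * wedge p \<alpha> \<beta> (xs @ u # ys) + b * wedge p \<alpha> \<beta> (xs @ w # ys)"
  using assms
proof (induction xs arbitrary: p q \<alpha> \<beta>)
  case Nil
  have 1: "wedge (p - 1) (\<lambda>us. \<alpha> ((a *\<^sub>R u + b *\<^sub>R w) # us)) \<beta> ys =
      a * wedge (p - 1) (\<lambda>us. \<alpha> (u # us)) \<beta> ys + b * wedge (p - 1) (\<lambda>us. \<alpha> (w # us)) \<beta> ys" if "p \<noteq> 0"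
    unfolding wedge_linear_left[symmetric]
  proof (rule wedge_cong)
    fix us assume "set us \<subseteq> set ys" "length us = p - 1"
    then show "\<alpha> ((a *\<^sub>R u + b *\<^sub>R w) # us) = a * \<alpha> (u # us) + b * \<alpha> (w # us)"
      using adj_alternating_linear[OF Nil(1), of "[]" us u w a b] Nil that by simp
  qed simp
  have 2: "wedge p \<alpha> (\<lambda>us. \<beta> ((a *\<^sub>R u + b *\<^sub>R w) # us)) ys =
      a * wedge p \<alpha> (\<lambda>us. \<beta> (u # us)) ys + b * wedge p \<alpha> (\<lambda>us. \<beta> (w # us)) ys"
    unfolding wedge_linear_right[symmetric]
  proof (rule wedge_cong)
    fix us assume "set us \<subseteq> set ys" "length us + p = length ys"
    then show "\<beta> ((a *\<^sub>R u + b *\<^sub>R w) # us) = a * \<beta> (u # us) + b * \<beta> (w # us)"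
      using adj_alternating_linear[OF Nil(2), of "[]" us u w a b] Nil by simp
  qed simp
  show ?case using 1 2 by (simp add: wedge_Cons algebra_simps)
next
  case (Cons x xs)
  have 1: "wedge (p - 1) (\<lambda>us. \<alpha> (x # us)) \<beta> (xs @ (a *\<^sub>R u + b *\<^sub>R w) # ys) =
      a * wedge (p - 1) (\<lambda>us. \<alpha> (x # us)) \<beta> (xs @ u # ys) + b * wedge (p - 1) (\<lambda>us. \<alpha> (x # us)) \<beta> (xs @ w # ys)" if "p \<noteq> 0"
    by (rule Cons.IH[where q = q]) (use Cons.prems that in \<open>auto intro: adj_alternating_interior\<close>)
  have 2: "wedge p \<alpha> (\<lambda>us. \<beta> (x # us)) (xs @ (a *\<^sub>R u + b *\<^sub>R w) # ys) =
      a * wedge p \<alpha> (\<lambda>us. \<beta> (x # us)) (xs @ u # ys) + b * wedge p \<alpha> (\<lambda>us. \<beta> (x # us)) (xs @ w # ys)"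
  proof (cases q)
    case 0
    \<comment> \<open>A 0-form cannot be contracted; here only \<open>p - 1\<close> arguments
      remain, too few for \<open>\<alpha>\<close>, so all three terms are zero.\<close>
    then show ?thesis using Cons.prems by (simp add: wedge_short)
  next
    case (Suc q')
    show ?thesis
      by (rule Cons.IH[where q = q']) (use Cons.prems Suc in \<open>auto intro: adj_alternating_interior\<close>)
  qed
  show ?case using 1 2 by (simp add: wedge_Cons algebra_simps)
qed

text \<open>Contracting twice with \<open>v\<close> yields two terms with a doubly contracted
  factor, which vanish, and two mixed terms with signs (-1)^(p-1) and (-1)^p, which cancel.\<close>

lemma wedge_adjacent:
  assumes "adj_alternating W p \<alpha>" "adj_alternating W q \<beta>"
    "length xs + length ys + 2 = p + q" "set xs \<subseteq> W" "set ys \<subseteq> W" "v \<in> W"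
  shows "wedge p \<alpha> \<beta> (xs @ v # v # ys) = 0"
  using assms
proof (induction xs arbitrary: p q \<alpha> \<beta>)
  case Nil
  have 1: "wedge (p - 1 - 1) (\<lambda>us. \<alpha> (v # v # us)) \<beta> ys = 0" if "p \<ge> 2"
  proof -
    have "wedge (p - 1 - 1) (\<lambda>us. \<alpha> (v # v # us)) \<beta> ys = wedge (p - 1 - 1) (\<lambda>us. 0) \<beta> ys"
    proof (rule wedge_cong)
      fix us assume "set us \<subseteq> set ys" "length us = p - 1 - 1"
      then show "\<alpha> (v # v # us) = 0"
        using adj_alternating_adjacent[OF Nil(1), of "[]" us v] Nil that by simp
    qed simp
    then show ?thesis by (simp add: wedge_zero_left)
  qed
  have 2: "wedge p \<alpha> (\<lambda>us. \<beta> (v # v # us)) ys = 0"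
  proof -
    have "wedge p \<alpha> (\<lambda>us. \<beta> (v # v # us)) ys = wedge p \<alpha> (\<lambda>us. 0) ys"
    proof (rule wedge_cong)
      fix us assume "set us \<subseteq> set ys" "length us + p = length ys"
      then show "\<beta> (v # v # us) = 0"
        using adj_alternating_adjacent[OF Nil(2), of "[]" us v] Nil by simp
    qed simp
    then show ?thesis by (simp add: wedge_zero_right)
  qed
  consider "p = 0" | "p = 1" | p' where "p = Suc (Suc p')" by (metis One_nat_def not0_implies_Suc)
  then show ?case using 1 2 by cases (simp_all add: wedge_Cons)
next
  case (Cons x xs)
  have 1: "wedge (p - 1) (\<lambda>us. \<alpha> (x # us)) \<beta> (xs @ v # v # ys) = 0" if "p \<noteq> 0"
    by (rule Cons.IH[where q = q]) (use Cons.prems that in \<open>auto intro: adj_alternating_interior\<close>)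
  have 2: "wedge p \<alpha> (\<lambda>us. \<beta> (x # us)) (xs @ v # v # ys) = 0"
  proof (cases q)
    case 0
    then show ?thesis using Cons.prems by (simp add: wedge_short)
  next
    case (Suc q')
    show ?thesis
      by (rule Cons.IH[where q = q']) (use Cons.prems Suc in \<open>auto intro: adj_alternating_interior\<close>)
  qed
  show ?case using 1 2 by (simp add: wedge_Cons)
qed

lemma adj_alternating_wedge:
  assumes "adj_alternating W p \<alpha>" "adj_alternating W q \<beta>"
  shows "adj_alternating W (p + q) (wedge p \<alpha> \<beta>)"
  unfolding adj_alternating_def
  using wedge_slot_linear[OF assms] wedge_adjacent[OF assms] by blast

lemma adj_alternating_coframe_wedge:
  assumes "\<And>i u w a b. i \<in> set is \<Longrightarrow> u \<in> W \<Longrightarrow> w \<in> W \<Longrightarrow> e i (a *\<^sub>R u + b *\<^sub>R w) = a * e i u + b * e i w"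
  shows "adj_alternating W (length is) (coframe_wedge e is)"
  using assms
proof (induction "is")
  case (Cons i "is")
  have "adj_alternating W 1 (\<lambda>vs. e i (hd vs))"
    using Cons.prems by (simp add: adj_alternating_def)
  moreover have "adj_alternating W (length is) (coframe_wedge e is)"
    using Cons by simp
  ultimately show ?case using adj_alternating_wedge by fastforce
qed (simp add: adj_alternating_def)

section \<open>Alternating forms determined by a frame\<close>

lemma adj_alternating_sort:
  assumes W: "subspace W" and alt: "adj_alternating W k \<alpha>"
    and "length us + length js = k" "set us \<subseteq> W" "f ` set js \<subseteq> W"
  shows "\<bar>\<alpha> (us @ map f js)\<bar> = \<bar>\<alpha> (us @ map f (sort js))\<bar>"
  using assms(3-)
proof (induction js arbitrary: us)
  case (Cons j js)
  have "\<bar>\<alpha> ((us @ [f j]) @ map f js)\<bar> = \<bar>\<alpha> ((us @ [f j]) @ map f (sort js))\<bar>"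
    by (rule Cons.IH) (use Cons.prems in auto)
  moreover have "\<bar>\<alpha> (us @ map f (j # l))\<bar> = \<bar>\<alpha> (us @ map f (insort j l))\<bar>"
    \<comment> \<open>Insertion sort moves \<open>j\<close> past the entries smaller than it. The
      absolute value absorbs the sign of the permutation, since only vanishing matters
      later.\<close>
    if l: "set l \<subseteq> set js" "length l = length js" for l
    using l
  proof -
    define xs ys where "xs = takeWhile (\<lambda>x. x < j) l" and "ys = dropWhile (\<lambda>x. x < j) l"
    have l': "l = xs @ ys" by (simp add: xs_def ys_def)
    have ins: "insort j l = xs @ j # ys"
      unfolding xs_def ys_def by (induction l) auto
    have "\<alpha> (us @ f j # map f xs @ map f ys) = (- 1) ^ length (map f xs) * \<alpha> (us @ map f xs @ f j # map f ys)"
      by (rule adj_alternating_move[OF W alt]) (use l l' Cons.prems in \<open>auto simp: image_subset_iff\<close>)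
    then show ?thesis by (simp add: l' ins[unfolded l'] abs_mult power_abs)
  qed
  ultimately show ?case by simp
qed simp

text \<open>The bridge to finite checks: an identity between alternating forms needs testing on
  strictly increasing frame tuples only.\<close>

lemma adj_alternating_eq_0_frame:
  fixes f :: "'i::linorder \<Rightarrow> 'v::real_vector"
  assumes W: "subspace W" and alt: "adj_alternating W k \<alpha>" and fin: "finite S"
    and span: "\<And>v. v \<in> W \<Longrightarrow> \<exists>x. v = (\<Sum>i\<in>S. x i *\<^sub>R f i)" and fW: "f ` S \<subseteq> W"
    and zero: "\<And>js. set js \<subseteq> S \<Longrightarrow> length js = k \<Longrightarrow> sorted_wrt (<) js \<Longrightarrow> \<alpha> (map f js) = 0"
    and vs: "length vs = k" "set vs \<subseteq> W"
  shows "\<alpha> vs = 0"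
proof -
  have frame: "\<alpha> (map f js) = 0" if js: "set js \<subseteq> S" "length js = k" for js
  proof (cases "distinct js")
    case True
    then have "\<alpha> (map f (sort js)) = 0"
      using js by (intro zero) (auto simp: strict_sorted_iff)
    then show ?thesis
      using adj_alternating_sort[OF W alt, of "[]" js f] js fW by auto
  next
    case False
    then show ?thesis
      using js fW by (intro adj_alternating_repeat[OF W alt]) (auto simp: distinct_map)
  qed
  \<comment> \<open>Arguments are expanded in the frame from left to right; \<open>js\<close>
    records the frame vectors already substituted.\<close>
  have "\<alpha> (map f js @ vs) = 0" if "set js \<subseteq> S" "length js + length vs = k" "set vs \<subseteq> W" for js vs
    using that
  proof (induction vs arbitrary: js)
    case (Cons v vs)
    obtain x where x: "v = (\<Sum>i\<in>S. x i *\<^sub>R f i)" using span Cons.prems by auto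
    have "\<alpha> (map f js @ (\<Sum>i\<in>T. x i *\<^sub>R f i) # vs) = 0" if "T \<subseteq> S" for T
      using finite_subset[OF that fin] that
    proof (induction T)
      case empty
      show ?case
        using adj_alternating_linear[OF alt, of "map f js" vs 0 0 0 0] Cons.prems fW subspace_0[OF W] by auto
    next
      case (insert i T)
      have "(\<Sum>i\<in>T. x i *\<^sub>R f i) \<in> W"
        using insert fW by (intro subspace_sum[OF W] subspace_mul[OF W]) auto
      then have "\<alpha> (map f js @ (x i *\<^sub>R f i + 1 *\<^sub>R (\<Sum>i\<in>T. x i *\<^sub>R f i)) # vs) =
          x i * \<alpha> (map f js @ f i # vs) + 1 * \<alpha> (map f js @ (\<Sum>i\<in>T. x i *\<^sub>R f i) # vs)"
        by (intro adj_alternating_linear[OF alt]) (use insert Cons.prems fW in auto)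
      moreover have "\<alpha> (map f (js @ [i]) @ vs) = 0"
        by (rule Cons.IH) (use insert Cons.prems in auto)
      ultimately show ?case using insert by simp
    qed
    then show ?case using x by blast
  qed (use frame in auto)
  from this[of "[]" vs] vs show ?thesis by simp
qed

section \<open>Smooth forms and the exterior derivative\<close>

text \<open>Needed for products: the Leibniz rule leaves one factor undifferentiated, which then
  must be of the lower class as well.\<close>

lemma Ck_on_Suc_imp_Ck_on: "Ck_on (Suc k) f U \<Longrightarrow> Ck_on k f U"
proof (induction k arbitrary: f)
  case 0
  then show ?case
    by (metis Ck_on.simps continuous_at_imp_continuous_on has_derivative_continuous)
next
  case (Suc k)
  then obtain D where "\<forall>x\<in>U. (f has_derivative D x) (at x)" "\<And>v. Ck_on (Suc k) (\<lambda>x. D x v) U"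
    by (subst (asm) Ck_on.simps(2)) blast
  then show ?case using Suc.IH by (subst Ck_on.simps(2)) blast
qed

lemma Ck_on_const: "Ck_on k (\<lambda>x. c) U"
proof (induction k arbitrary: c)
  case (Suc k)
  then show ?case
    by (subst Ck_on.simps(2), intro exI[of _ "\<lambda>x v. 0"]) auto
qed (simp add: continuous_on_const)

lemma Ck_on_add: "Ck_on k f U \<Longrightarrow> Ck_on k g U \<Longrightarrow> Ck_on k (\<lambda>x. f x + g x) U"
proof (induction k arbitrary: f g)
  case (Suc k)
  from Suc.prems obtain D E where
    "\<forall>x\<in>U. (f has_derivative D x) (at x)" "\<And>v. Ck_on k (\<lambda>x. D x v) U"
    "\<forall>x\<in>U. (g has_derivative E x) (at x)" "\<And>v. Ck_on k (\<lambda>x. E x v) U"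
    by (auto simp only: Ck_on.simps(2))
  then show ?case
    using Suc.IH by (subst Ck_on.simps(2), intro exI[of _ "\<lambda>x v. D x v + E x v"])
      (auto intro: has_derivative_add)
qed (simp add: continuous_on_add)

lemma Ck_on_mult: "Ck_on k f U \<Longrightarrow> Ck_on k g U \<Longrightarrow> Ck_on k (\<lambda>x. f x * g x) U"
proof (induction k arbitrary: f g)
  case (Suc k)
  from Suc.prems obtain D E where
    "\<forall>x\<in>U. (f has_derivative D x) (at x)" "\<And>v. Ck_on k (\<lambda>x. D x v) U"
    "\<forall>x\<in>U. (g has_derivative E x) (at x)" "\<And>v. Ck_on k (\<lambda>x. E x v) U"
    by (auto simp only: Ck_on.simps(2))
  moreover have "Ck_on k f U" "Ck_on k g U"
    using Suc.prems[THEN Ck_on_Suc_imp_Ck_on] by simp_all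
  ultimately show ?case
    using Suc.IH by (subst Ck_on.simps(2), intro exI[of _ "\<lambda>x v. f x * E x v + D x v * g x"])
      (auto intro: has_derivative_mult Ck_on_add)
qed (simp add: continuous_on_mult)

lemma Ck_on_bounded_linear:
  assumes "bounded_linear f" shows "Ck_on k f U"
proof (cases k)
  case 0
  then show ?thesis using assms by (simp add: linear_continuous_on)
next
  case (Suc l)
  have "\<forall>x\<in>U. (f has_derivative f) (at x)"
    using assms by (simp add: bounded_linear_imp_has_derivative)
  then show ?thesis
    unfolding Suc by (subst Ck_on.simps(2), intro exI[of _ "\<lambda>x. f"]) (simp add: Ck_on_const)
qed

lemma smooth_on_const: "smooth_on (\<lambda>x. c) U"
  and smooth_on_add: "smooth_on f U \<Longrightarrow> smooth_on g U \<Longrightarrow> smooth_on (\<lambda>x. f x + g x) U"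
  and smooth_on_mult: "smooth_on f U \<Longrightarrow> smooth_on g U \<Longrightarrow> smooth_on (\<lambda>x. f x * g x) U"
  and smooth_on_bounded_linear: "bounded_linear f \<Longrightarrow> smooth_on f U"
  by (simp_all add: smooth_on_def Ck_on_const Ck_on_add Ck_on_mult Ck_on_bounded_linear)

lemma smooth_on_sum: "(\<And>i. i \<in> S \<Longrightarrow> smooth_on (f i) U) \<Longrightarrow> smooth_on (\<lambda>x. \<Sum>i\<in>S. f i x) U"
  by (induction S rule: infinite_finite_induct) (auto intro: smooth_on_const smooth_on_add)

lemma smooth_on_differentiable: "smooth_on f U \<Longrightarrow> x \<in> U \<Longrightarrow> f differentiable (at x)"
  unfolding smooth_on_def differentiable_def by (metis Ck_on.simps(2))

lemma smooth_on_coframe_wedge: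
  assumes "\<And>i v. i \<in> set is \<Longrightarrow> smooth_on (\<lambda>q. e q i v) U"
  shows "smooth_on (\<lambda>q. coframe_wedge (e q) is vs) U"
  using assms
proof (induction "is" arbitrary: vs)
  case (Cons i "is")
  then show ?case
    by (auto simp: wedge_def intro!: smooth_on_sum smooth_on_mult smooth_on_const)
qed (simp add: smooth_on_const)

lemma smooth_extension_cong:
  assumes "form_eq M k \<alpha> \<beta>"
  shows "smooth_extension M k \<alpha> p \<eta> = smooth_extension M k \<beta> p \<eta>"
proof -
  have "(\<forall>q\<in>U \<inter> M. \<forall>vs\<in>tangent_lists M k q. \<eta> q vs = \<alpha> q vs) \<longleftrightarrow>
      (\<forall>q\<in>U \<inter> M. \<forall>vs\<in>tangent_lists M k q. \<eta> q vs = \<beta> q vs)" for U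
    using assms unfolding form_eq_def by auto
  then show ?thesis by (simp only: smooth_extension_def)
qed

lemma smooth_form_cong:
  assumes "form_eq M k \<alpha> \<beta>"
  shows "smooth_form M k \<alpha> \<longleftrightarrow> smooth_form M k \<beta>"
  using smooth_extension_cong[OF assms] by (simp add: smooth_form_def)

section \<open>The alternating sum behind the exterior derivative\<close>

abbreviation omit :: "nat \<Rightarrow> 'a list \<Rightarrow> 'a list" where
  "omit i xs \<equiv> nths xs (- {i})"

lemma omit_conv: "i < length xs \<Longrightarrow> omit i xs = take i xs @ drop (Suc i) xs"
proof (induction xs arbitrary: i)
  case (Cons x xs)
  show ?case
  proof (cases i)
    case 0
    then show ?thesis by (simp add: nths_Cons nths_all)
  next
    case (Suc j)
    have "{i. Suc i \<in> - {Suc j}} = - {j}" by auto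
    then show ?thesis using Cons Suc by (simp add: nths_Cons)
  qed
qed simp

lemma omit_Cons: "omit i (x # xs) = (case i of 0 \<Rightarrow> xs | Suc j \<Rightarrow> x # omit j xs)"
proof (cases i)
  case (Suc j)
  have "{i. Suc i \<in> - {Suc j}} = - {j}" by auto
  then show ?thesis using Suc by (simp add: nths_Cons)
qed (simp add: nths_Cons nths_all)

lemma length_omit: "i < length xs \<Longrightarrow> length (omit i xs) = length xs - 1"
  by (simp add: omit_conv)

lemma set_omit: "set (omit i xs) \<subseteq> set xs"
  by (rule set_nths_subset)

text \<open>The algebraic shape of \<open>ext_deriv\<close>, with \<open>F us v\<close> in the role
  of the derivative of the coefficient at \<open>us\<close> in direction \<open>v\<close>. Keeping
  \<open>F\<close> abstract lets alternation be shown without calculus.\<close>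

definition alternation :: "nat \<Rightarrow> ('v list \<Rightarrow> 'v \<Rightarrow> real) \<Rightarrow> 'v list \<Rightarrow> real" where
  "alternation k F vs = (\<Sum>i\<le>k. (- 1) ^ i * F (omit i vs) (vs ! i))"

text \<open>In all summands but the first, \<open>v\<close> stays as leading argument and the index
  shifts by one, which flips the sign. The guard for \<open>k = 0\<close> removes the spurious
  summand that truncated subtraction would produce.\<close>

lemma alternation_Cons:
  "alternation k F (v # vs) = F vs v - (if k = 0 then 0 else alternation (k - 1) (\<lambda>us. F (v # us)) vs)"
proof (cases k)
  case (Suc l)
  show ?thesis
    by (simp add: alternation_def Suc sum.atMost_Suc_shift omit_Cons sum_negf del: sum.atMost_Suc)
qed (simp add: alternation_def omit_Cons)

lemma alternation_cong:
  assumes "\<And>us v. set us \<subseteq> set vs \<Longrightarrow> v \<in> set vs \<Longrightarrow> length us = k \<Longrightarrow> F us v = G us v" "length vs = Suc k"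
  shows "alternation k F vs = alternation k G vs"
  unfolding alternation_def
proof (rule sum.cong)
  fix i assume "i \<in> {..k}"
  then have "F (omit i vs) (vs ! i) = G (omit i vs) (vs ! i)"
    using assms(2) by (intro assms(1) set_omit) (auto simp: length_omit)
  then show "(- 1) ^ i * F (omit i vs) (vs ! i) = (- 1) ^ i * G (omit i vs) (vs ! i)" by simp
qed simp

lemma alternation_linear:
  "alternation k (\<lambda>us v. a * F us v + b * G us v) vs = a * alternation k F vs + b * alternation k G vs"
  unfolding alternation_def sum_distrib_left sum.distrib[symmetric]
  by (rule sum.cong) (simp_all add: algebra_simps)

lemma alternation_slot_linear:
  assumes "\<And>v. v \<in> W \<Longrightarrow> adj_alternating W k (\<lambda>us. F us v)"
    and "\<And>us u w. length us = k \<Longrightarrow> set us \<subseteq> W \<Longrightarrow> u \<in> W \<Longrightarrow> w \<in> W \<Longrightarrow>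
      F us (a *\<^sub>R u + b *\<^sub>R w) = a * F us u + b * F us w"
    and "length xs + length ys = k" "set xs \<subseteq> W" "set ys \<subseteq> W" "u \<in> W" "w \<in> W"
  shows "alternation k F (xs @ (a *\<^sub>R u + b *\<^sub>R w) # ys) = a * alternation k F (xs @ u # ys) + b * alternation k F (xs @ w # ys)"
  using assms
proof (induction xs arbitrary: k F)
  case Nil
  have "alternation (k - 1) (\<lambda>us. F ((a *\<^sub>R u + b *\<^sub>R w) # us)) ys =
      a * alternation (k - 1) (\<lambda>us. F (u # us)) ys + b * alternation (k - 1) (\<lambda>us. F (w # us)) ys" if "k \<noteq> 0"
    unfolding alternation_linear[symmetric]
  proof (rule alternation_cong)
    fix us v assume us: "set us \<subseteq> set ys" "v \<in> set ys" "length us = k - 1"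
    have "v \<in> W" using us Nil by auto
    then show "F ((a *\<^sub>R u + b *\<^sub>R w) # us) v = a * F (u # us) v + b * F (w # us) v"
      using adj_alternating_linear[OF Nil(1), of v "[]" us u w a b] us Nil that by simp
  qed (use Nil that in auto)
  then show ?case using Nil by (simp add: alternation_Cons algebra_simps)
next
  case (Cons x xs)
  have "k \<noteq> 0" using Cons.prems by auto
  have 1: "F (xs @ (a *\<^sub>R u + b *\<^sub>R w) # ys) x = a * F (xs @ u # ys) x + b * F (xs @ w # ys) x"
    using adj_alternating_linear[OF Cons.prems(1), of x xs ys u w a b] Cons.prems by simp
  have 2: "alternation (k - 1) (\<lambda>us. F (x # us)) (xs @ (a *\<^sub>R u + b *\<^sub>R w) # ys) =
      a * alternation (k - 1) (\<lambda>us. F (x # us)) (xs @ u # ys) + b * alternation (k - 1) (\<lambda>us. F (x # us)) (xs @ w # ys)"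
  proof (rule Cons.IH)
    fix v assume v: "v \<in> W"
    have "adj_alternating W (Suc (k - 1)) (\<lambda>us. F us v)" using Cons.prems(1)[OF v] \<open>k \<noteq> 0\<close> by simp
    then show "adj_alternating W (k - 1) (\<lambda>us. F (x # us) v)"
      by (rule adj_alternating_interior) (use Cons.prems in auto)
  next
    fix us u w assume "length us = k - 1" "set us \<subseteq> W" "u \<in> W" "w \<in> W"
    then show "F (x # us) (a *\<^sub>R u + b *\<^sub>R w) = a * F (x # us) u + b * F (x # us) w"
      using Cons.prems \<open>k \<noteq> 0\<close> by (intro Cons.prems(2)) auto
  qed (use Cons.prems in auto)
  show ?case using 1 2 \<open>k \<noteq> 0\<close> by (simp add: alternation_Cons algebra_simps)
qed

text \<open>With the equal pair in front, the two summands differentiating in direction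
  \<open>v\<close> cancel, and in the others \<open>F\<close> itself receives an adjacent
  pair.\<close>

lemma alternation_adjacent:
  assumes "\<And>v. v \<in> W \<Longrightarrow> adj_alternating W k (\<lambda>us. F us v)"
    and "length xs + length ys + 1 = k" "set xs \<subseteq> W" "set ys \<subseteq> W" "v \<in> W"
  shows "alternation k F (xs @ v # v # ys) = 0"
  using assms
proof (induction xs arbitrary: k F)
  case Nil
  have "alternation (k - 2) (\<lambda>us. F (v # v # us)) ys = 0" if "k \<ge> 2"
  proof -
    have "alternation (k - 2) (\<lambda>us. F (v # v # us)) ys = alternation (k - 2) (\<lambda>us w. 0) ys"
    proof (rule alternation_cong)
      fix us w assume us: "set us \<subseteq> set ys" "w \<in> set ys" "length us = k - 2"
      have "w \<in> W" using us Nil by auto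
      then show "F (v # v # us) w = 0"
        using adj_alternating_adjacent[OF Nil(1), of w "[]" us v] us Nil that by simp
    qed (use Nil that in auto)
    then show ?thesis by (simp add: alternation_def)
  qed
  then show ?case using Nil by (cases "k = 1") (simp_all add: alternation_Cons numeral_2_eq_2)
next
  case (Cons x xs)
  have "k \<noteq> 0" using Cons.prems by auto
  have 1: "F (xs @ v # v # ys) x = 0"
    using adj_alternating_adjacent[OF Cons.prems(1), of x xs ys v] Cons.prems by simp
  have 2: "alternation (k - 1) (\<lambda>us. F (x # us)) (xs @ v # v # ys) = 0"
  proof (rule Cons.IH)
    fix v assume v: "v \<in> W"
    have "adj_alternating W (Suc (k - 1)) (\<lambda>us. F us v)" using Cons.prems(1)[OF v] \<open>k \<noteq> 0\<close> by simp
    then show "adj_alternating W (k - 1) (\<lambda>us. F (x # us) v)"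
      by (rule adj_alternating_interior) (use Cons.prems in auto)
  qed (use Cons.prems in auto)
  show ?case using 1 2 \<open>k \<noteq> 0\<close> by (simp add: alternation_Cons)
qed

lemma adj_alternating_alternation:
  fixes W :: "'a::real_vector set"
  assumes "\<And>v. v \<in> W \<Longrightarrow> adj_alternating W k (\<lambda>us. F us v)"
    and "\<And>us u w a b. length us = k \<Longrightarrow> set us \<subseteq> W \<Longrightarrow> u \<in> W \<Longrightarrow> w \<in> W \<Longrightarrow>
      F us (a *\<^sub>R u + b *\<^sub>R w) = a * F us u + b * F us w"
  shows "adj_alternating W (Suc k) (alternation k F)"
  unfolding adj_alternating_def
proof (intro conjI allI impI)
  fix xs ys :: "'a list" and u w a b
  assume "length xs + length ys + 1 = Suc k \<and> set xs \<subseteq> W \<and> set ys \<subseteq> W \<and> u \<in> W \<and> w \<in> W"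
  then show "alternation k F (xs @ (a *\<^sub>R u + b *\<^sub>R w) # ys) = a * alternation k F (xs @ u # ys) + b * alternation k F (xs @ w # ys)"
    by (intro alternation_slot_linear[where W = W] assms) auto
next
  fix xs ys :: "'a list" and u
  assume "length xs + length ys + 2 = Suc k \<and> set xs \<subseteq> W \<and> set ys \<subseteq> W \<and> u \<in> W"
  then show "alternation k F (xs @ u # u # ys) = 0"
    by (intro alternation_adjacent[where W = W] assms) auto
qed

section \<open>Derivatives of an extension along curves\<close>

definition coeff_deriv :: "('v::euclidean_space) dform \<Rightarrow> 'v \<Rightarrow> 'v list \<Rightarrow> 'v \<Rightarrow> real" where
  "coeff_deriv \<eta> p us = frechet_derivative (\<lambda>q. \<eta> q us) (at p)"

text \<open>Isolates the choice made by \<open>SOME\<close>: whatever follows about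
  \<open>ext_deriv\<close> uses only these properties of the chosen extension.\<close>

lemma ext_deriv_extension:
  assumes "smooth_form M k \<omega>" "p \<in> M"
  obtains \<eta> U where "ext_deriv M k \<omega> p = alternation k (coeff_deriv \<eta> p)"
    "open U" "p \<in> U" "\<And>q. q \<in> U \<Longrightarrow> adj_alternating UNIV k (\<eta> q)"
    "\<And>us. length us = k \<Longrightarrow> ((\<lambda>q. \<eta> q us) has_derivative coeff_deriv \<eta> p us) (at p)"
    "\<And>q vs. q \<in> U \<Longrightarrow> q \<in> M \<Longrightarrow> vs \<in> tangent_lists M k q \<Longrightarrow> \<eta> q vs = \<omega> q vs"
proof -
  define \<eta> where "\<eta> = (SOME \<eta>. smooth_extension M k \<omega> p \<eta>)"
  have "smooth_extension M k \<omega> p \<eta>"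
    using assms unfolding \<eta>_def smooth_form_def by (metis someI_ex)
  then obtain U where U: "open U" "p \<in> U" "\<forall>q\<in>U. alternating_form UNIV k (\<eta> q)"
      "\<forall>us. length us = k \<longrightarrow> smooth_on (\<lambda>q. \<eta> q us) U"
      "\<forall>q\<in>U \<inter> M. \<forall>vs\<in>tangent_lists M k q. \<eta> q vs = \<omega> q vs"
    unfolding smooth_extension_def by blast
  show thesis
  proof (rule that[of \<eta> U])
    show "ext_deriv M k \<omega> p = alternation k (coeff_deriv \<eta> p)"
      by (simp add: fun_eq_iff ext_deriv_def alternation_def coeff_deriv_def Let_def \<eta>_def)
    show "((\<lambda>q. \<eta> q us) has_derivative coeff_deriv \<eta> p us) (at p)" if "length us = k" for us
      unfolding coeff_deriv_def frechet_derivative_works[symmetric]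
      using U that smooth_on_differentiable by blast
  qed (use U in \<open>auto simp: alternating_form_iff_adj\<close>)
qed

lemma adj_alternating_coeff_deriv:
  fixes p :: "'a::euclidean_space"
  assumes U: "open U" "p \<in> U" and alt: "\<And>q. q \<in> U \<Longrightarrow> adj_alternating UNIV k (\<eta> q)"
    and der: "\<And>us. length us = k \<Longrightarrow> ((\<lambda>q. \<eta> q us) has_derivative coeff_deriv \<eta> p us) (at p)"
  shows "adj_alternating UNIV k (\<lambda>us. coeff_deriv \<eta> p us z)"
proof -
  \<comment> \<open>An identity valid for all points of the open set \<open>U\<close> passes to
    derivatives at \<open>p\<close> by their uniqueness; applied below to the linearity and
    vanishing identities of \<open>\<eta> q\<close>.\<close>
  have cong: "coeff_deriv \<eta> p us = D"
    if "(f has_derivative D) (at p)" "length us = k" "\<And>q. q \<in> U \<Longrightarrow> \<eta> q us = f q" for us f D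
  proof -
    have "((\<lambda>q. \<eta> q us) has_derivative D) (at p)"
      by (rule has_derivative_transform_within_open[OF that(1) U]) (use that in auto)
    then show ?thesis using der[OF that(2)] has_derivative_unique by blast
  qed
  show ?thesis
    unfolding adj_alternating_def
  proof (intro conjI allI impI)
    fix xs ys :: "'a list" and u w :: 'a and a b
    assume *: "length xs + length ys + 1 = k \<and> set xs \<subseteq> UNIV \<and> set ys \<subseteq> UNIV \<and> u \<in> UNIV \<and> w \<in> UNIV"
    have "coeff_deriv \<eta> p (xs @ (a *\<^sub>R u + b *\<^sub>R w) # ys) =
        (\<lambda>z. a * coeff_deriv \<eta> p (xs @ u # ys) z + b * coeff_deriv \<eta> p (xs @ w # ys) z)"
    proof (rule cong)
      show "((\<lambda>q. a * \<eta> q (xs @ u # ys) + b * \<eta> q (xs @ w # ys)) has_derivative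
          (\<lambda>z. a * coeff_deriv \<eta> p (xs @ u # ys) z + b * coeff_deriv \<eta> p (xs @ w # ys) z)) (at p)"
        using * by (intro has_derivative_add has_derivative_mult_right der) auto
    qed (use * adj_alternating_linear[OF alt] in auto)
    then show "coeff_deriv \<eta> p (xs @ (a *\<^sub>R u + b *\<^sub>R w) # ys) z =
        a * coeff_deriv \<eta> p (xs @ u # ys) z + b * coeff_deriv \<eta> p (xs @ w # ys) z" by simp
  next
    fix xs ys :: "'a list" and v :: 'a
    assume *: "length xs + length ys + 2 = k \<and> set xs \<subseteq> UNIV \<and> set ys \<subseteq> UNIV \<and> v \<in> UNIV"
    have "coeff_deriv \<eta> p (xs @ v # v # ys) = (\<lambda>z. 0)"
      by (rule cong[of "\<lambda>q. 0"]) (use * adj_alternating_adjacent[OF alt] in auto)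
    then show "coeff_deriv \<eta> p (xs @ v # v # ys) z = 0" by simp
  qed
qed

lemma adj_alternating_ext_deriv:
  assumes "smooth_form M k \<omega>" "p \<in> M"
  shows "adj_alternating UNIV (Suc k) (ext_deriv M k \<omega> p)"
proof -
  obtain \<eta> U where *: "ext_deriv M k \<omega> p = alternation k (coeff_deriv \<eta> p)"
    "open U" "p \<in> U" "\<And>q. q \<in> U \<Longrightarrow> adj_alternating UNIV k (\<eta> q)"
    "\<And>us. length us = k \<Longrightarrow> ((\<lambda>q. \<eta> q us) has_derivative coeff_deriv \<eta> p us) (at p)"
    by (rule ext_deriv_extension[OF assms]) blast
  have "coeff_deriv \<eta> p us (a *\<^sub>R u + b *\<^sub>R w) = a * coeff_deriv \<eta> p us u + b * coeff_deriv \<eta> p us w"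
    if "length us = k" for us a b u w
    using has_derivative_linear[OF *(5)[OF that]] by (simp add: linear_add linear_scale)
  then show ?thesis
    unfolding *(1) using adj_alternating_coeff_deriv[OF *(2-5)]
    by (intro adj_alternating_alternation) auto
qed

lemma has_real_derivative_form_along:
  fixes A :: "real \<Rightarrow> 'v::euclidean_space list \<Rightarrow> real"
  assumes lin: "\<forall>\<^sub>F t in nhds 0. adj_alternating UNIV k (A t)"
    and der: "\<And>us. length us = k \<Longrightarrow> ((\<lambda>t. A t us) has_real_derivative A' us) (at 0)"
    and lin': "adj_alternating UNIV k A'"
    and w: "\<And>j. j \<in> set js \<Longrightarrow> (w j has_vector_derivative w' j) (at 0)"
    and len: "length us + length js = k"
  shows "((\<lambda>t. A t (us @ map (\<lambda>j. w j t) js)) has_real_derivative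
    A' (us @ map (\<lambda>j. w j 0) js) + (\<Sum>i<length js. A 0 (us @ (map (\<lambda>j. w j 0) js)[i := w' (js ! i)]))) (at 0)"
  using w len
proof (induction js arbitrary: us)
  case Nil
  then show ?case using der by simp
next
  case (Cons j js)
  have expand: "B (us @ v # ys) = (\<Sum>b\<in>Basis. (v \<bullet> b) * B (us @ b # ys))"
    if B: "adj_alternating UNIV k B" and ys: "length ys = length js" for B v ys
  proof -
    have "B (us @ (\<Sum>b\<in>T. (v \<bullet> b) *\<^sub>R b) # ys) = (\<Sum>b\<in>T. (v \<bullet> b) * B (us @ b # ys))" if "finite T" for T
      using that
    proof induction
      case empty
      show ?case using adj_alternating_linear[OF B, of us ys 0 0 0 0] ys Cons.prems by simp
    next
      case (insert b T)
      then show ?case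
        using adj_alternating_linear[OF B, of us ys b "\<Sum>b\<in>T. (v \<bullet> b) *\<^sub>R b" "v \<bullet> b" 1] ys Cons.prems by simp
    qed
    from this[of Basis] show ?thesis by (simp add: euclidean_representation)
  qed
  let ?m = "\<lambda>t. map (\<lambda>j. w j t) js"
  have "(w j has_vector_derivative w' j) (at 0)" using Cons.prems by simp
  then have "((\<lambda>t. w j t \<bullet> b) has_real_derivative w' j \<bullet> b) (at 0)" for b
    unfolding has_real_derivative_iff_has_vector_derivative
    by (rule bounded_linear.has_vector_derivative[OF bounded_linear_inner_left])
  moreover have "((\<lambda>t. A t ((us @ [b]) @ ?m t)) has_real_derivative
      A' ((us @ [b]) @ ?m 0) + (\<Sum>i<length js. A 0 ((us @ [b]) @ (?m 0)[i := w' (js ! i)]))) (at 0)" for b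
    by (rule Cons.IH) (use Cons.prems in auto)
  ultimately have "((\<lambda>t. \<Sum>b\<in>Basis. (w j t \<bullet> b) * A t ((us @ [b]) @ ?m t)) has_real_derivative
      (\<Sum>b\<in>Basis. (w' j \<bullet> b) * A 0 ((us @ [b]) @ ?m 0) +
        (A' ((us @ [b]) @ ?m 0) + (\<Sum>i<length js. A 0 ((us @ [b]) @ (?m 0)[i := w' (js ! i)]))) * (w j 0 \<bullet> b))) (at 0)"
    by (intro DERIV_sum DERIV_mult)
  moreover have "\<forall>\<^sub>F t in nhds 0. (\<Sum>b\<in>Basis. (w j t \<bullet> b) * A t ((us @ [b]) @ ?m t)) = A t (us @ w j t # ?m t)"
    using lin by eventually_elim (subst expand, auto)
  ultimately have der1: "((\<lambda>t. A t (us @ w j t # ?m t)) has_real_derivative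
      (\<Sum>b\<in>Basis. (w' j \<bullet> b) * A 0 ((us @ [b]) @ ?m 0) +
        (A' ((us @ [b]) @ ?m 0) + (\<Sum>i<length js. A 0 ((us @ [b]) @ (?m 0)[i := w' (js ! i)]))) * (w j 0 \<bullet> b))) (at 0)"
    by (rule DERIV_cong_ev[OF refl _ refl, THEN iffD1, rotated])
  \<comment> \<open>The filter \<open>nhds 0\<close>, unlike \<open>at 0\<close>, includes the point
    0 itself, so the form at 0 can be recombined from its basis expansion.\<close>
  have lin0: "adj_alternating UNIV k (A 0)" using lin by (rule eventually_nhds_x_imp_x)
  have "(\<Sum>b\<in>Basis. (w' j \<bullet> b) * A 0 ((us @ [b]) @ ?m 0) +
        (A' ((us @ [b]) @ ?m 0) + (\<Sum>i<length js. A 0 ((us @ [b]) @ (?m 0)[i := w' (js ! i)]))) * (w j 0 \<bullet> b))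
      = A 0 (us @ w' j # ?m 0) + A' (us @ w j 0 # ?m 0) + (\<Sum>i<length js. A 0 (us @ w j 0 # (?m 0)[i := w' (js ! i)]))"
    by (simp add: expand[OF lin0, of "?m 0" "w' j"] expand[OF lin', of "?m 0" "w j 0"] expand[OF lin0, of _ "w j 0"]
        sum.distrib algebra_simps sum_distrib_left sum.swap[of _ Basis])
  also have "\<dots> = A' (us @ map (\<lambda>j. w j 0) (j # js)) +
      (\<Sum>i<length (j # js). A 0 (us @ (map (\<lambda>j. w j 0) (j # js))[i := w' ((j # js) ! i)]))"
    by (simp add: sum.lessThan_Suc_shift del: sum.lessThan_Suc)
  finally show ?case using der1 by simp
qed

section \<open>The bracket formula for the exterior derivative\<close>

lemma nth_omit:
  assumes "i < length xs" "Suc j < length xs"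
  shows "omit i xs ! j = xs ! (if j < i then j else Suc j)"
  using assms by (auto simp: omit_conv nth_append min_def)

text \<open>The simplicial identity for two successive face maps.\<close>

lemma omit_omit:
  assumes "i \<le> j" "Suc j < length xs"
  shows "omit j (omit i xs) = omit i (omit (Suc j) xs)"
  using assms
proof (induction xs arbitrary: i j)
  case (Cons x xs)
  show ?case
  proof (cases i)
    case 0
    then show ?thesis by (simp add: omit_Cons)
  next
    case (Suc i')
    then obtain j' where "j = Suc j'" using Cons.prems by (cases j) auto
    then show ?thesis using Cons.IH[of i' j'] Cons.prems Suc by (simp add: omit_Cons)
  qed
qed simp

text \<open>Read \<open>N a b\<close> as the derivative of field \<open>b\<close> along field
  \<open>a\<close>. Moving it to the front turns the left side into a sum over ordered pairs of
  positions; the pairs (i, j) and (j, i) carry opposite signs and combine to a commutator.\<close>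

lemma sum_slots_bracket:
  fixes \<eta> :: "'v::real_vector list \<Rightarrow> real"
  assumes alt: "adj_alternating UNIV k \<eta>" and len: "length js = Suc k"
  shows "(\<Sum>i\<le>k. (- 1) ^ i * (\<Sum>j<k. \<eta> ((map f (omit i js))[j := N (js ! i) (omit i js ! j)]))) =
    - (\<Sum>j\<le>k. \<Sum>i<j. (- 1) ^ (i + j) *
        \<eta> ((N (js ! i) (js ! j) - N (js ! j) (js ! i)) # map f (omit i (omit j js))))"
proof -
  \<comment> \<open>Positions \<open>i\<close>, \<open>j\<close> fix the sign and the omitted
    entries and are always used with \<open>i < j\<close>; \<open>a\<close>, \<open>b\<close>
    separately record which field gives the direction and which is differentiated.\<close>
  define g where "g i j a b = (- 1) ^ (i + j) * \<eta> (N (js ! a) (js ! b) # map f (omit i (omit j js)))" for i j a b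
  have slot: "\<eta> ((map f is)[j := v]) = (- 1) ^ j * \<eta> (v # map f (omit j is))"
    if "length is = k" "j < k" for "is" j v
  proof -
    have "\<eta> ([] @ v # map f (take j is) @ map f (drop (Suc j) is)) =
        (- 1) ^ length (map f (take j is)) * \<eta> ([] @ map f (take j is) @ v # map f (drop (Suc j) is))"
      by (rule adj_alternating_move[OF _ alt]) (use that in \<open>auto simp: subspace_UNIV\<close>)
    moreover have "(- 1 :: real) ^ j * (- 1) ^ j = 1" by (simp flip: power_add mult_2)
    ultimately show ?thesis
      using that by (simp add: omit_conv upd_conv_take_nth_drop take_map drop_map min_def)
  qed
  \<comment> \<open>After omitting position \<open>i\<close>, a slot \<open>j < i\<close> is still
    position \<open>j\<close> of \<open>js\<close>, but a slot \<open>j \<ge> i\<close> is position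
    \<open>Suc j\<close>; this shift is the source of the relative minus sign.\<close>
  have inner: "(- 1) ^ i * (\<Sum>j<k. \<eta> ((map f (omit i js))[j := N (js ! i) (omit i js ! j)])) =
      (\<Sum>j<i. g j i i j) - (\<Sum>j\<in>{Suc i..k}. g i j i j)" if i: "i \<le> k" for i
  proof -
    have "(- 1) ^ i * (\<Sum>j<k. \<eta> ((map f (omit i js))[j := N (js ! i) (omit i js ! j)])) =
        (\<Sum>j<k. (- 1) ^ (i + j) * \<eta> (N (js ! i) (js ! (if j < i then j else Suc j)) # map f (omit j (omit i js))))"
      unfolding sum_distrib_left
      by (rule sum.cong) (use i len in \<open>auto simp: slot length_omit nth_omit power_add\<close>)
    also have "\<dots> = (\<Sum>j\<in>{..<i} \<union> {i..<k}. (- 1) ^ (i + j) * \<eta> (N (js ! i) (js ! (if j < i then j else Suc j)) # map f (omit j (omit i js))))"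
      using i by (intro sum.cong) auto
    also have "\<dots> = (\<Sum>j<i. g j i i j) + (\<Sum>j\<in>{i..<k}. - g i (Suc j) i (Suc j))"
      by (subst sum.union_disjoint)
        (use len in \<open>auto simp: g_def add.commute omit_omit intro!: arg_cong2[where f = "(+)"] sum.cong\<close>)
    also have "(\<Sum>j\<in>{i..<k}. - g i (Suc j) i (Suc j)) = - (\<Sum>j\<in>{Suc i..k}. g i j i j)"
      by (simp only: sum_negf atLeastLessThanSuc_atLeastAtMost[symmetric] sum.shift_bounds_Suc_ivl)
    finally show ?thesis by simp
  qed
  have diff: "g i j j i - g i j i j =
      - ((- 1) ^ (i + j) * \<eta> ((N (js ! i) (js ! j) - N (js ! j) (js ! i)) # map f (omit i (omit j js))))"
    if "i < j" "j \<le> k" for i j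
  proof -
    have "length (map f (omit i (omit j js))) + 1 = k" using that len by (simp add: length_omit)
    then have "\<eta> ([] @ (1 *\<^sub>R u + (- 1) *\<^sub>R w) # map f (omit i (omit j js))) =
        1 * \<eta> ([] @ u # map f (omit i (omit j js))) + (- 1) * \<eta> ([] @ w # map f (omit i (omit j js)))" for u w
      by (intro adj_alternating_linear[OF alt]) auto
    then have "\<eta> ((u - w) # map f (omit i (omit j js))) =
        \<eta> (u # map f (omit i (omit j js))) - \<eta> (w # map f (omit i (omit j js)))" for u w
      by simp
    then show ?thesis by (simp add: g_def right_diff_distrib add.commute)
  qed
  have "(\<Sum>i\<le>k. (- 1) ^ i * (\<Sum>j<k. \<eta> ((map f (omit i js))[j := N (js ! i) (omit i js ! j)]))) =
      (\<Sum>i\<le>k. \<Sum>j<i. g j i i j) - (\<Sum>i\<le>k. \<Sum>j\<in>{Suc i..k}. g i j i j)"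
    unfolding sum_subtractf[symmetric] by (rule sum.cong) (use inner in auto)
  also have "(\<Sum>i\<le>k. \<Sum>j\<in>{Suc i..k}. g i j i j) = (\<Sum>j\<le>k. \<Sum>i<j. g i j i j)"
  proof -
    have "(\<Sum>i\<le>k. \<Sum>j\<in>{Suc i..k}. g i j i j) = (\<Sum>(i, j)\<in>(SIGMA i:{..k}. {Suc i..k}). g i j i j)"
      by (simp add: sum.Sigma)
    also have "\<dots> = (\<Sum>(j, i)\<in>(SIGMA j:{..k}. {..<j}). g i j i j)"
      by (rule sum.reindex_bij_witness[of _ "\<lambda>(a, b). (b, a)" "\<lambda>(a, b). (b, a)"]) auto
    finally show ?thesis by (simp add: sum.Sigma)
  qed
  also have "(\<Sum>i\<le>k. \<Sum>j<i. g j i i j) - (\<Sum>j\<le>k. \<Sum>i<j. g i j i j) = (\<Sum>j\<le>k. \<Sum>i<j. g i j j i - g i j i j)"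
    by (simp add: sum_subtractf)
  also have "\<dots> = (\<Sum>j\<le>k. \<Sum>i<j. - ((- 1) ^ (i + j) *
      \<eta> ((N (js ! i) (js ! j) - N (js ! j) (js ! i)) # map f (omit i (omit j js)))))"
    using diff by (intro sum.cong) auto
  finally show ?thesis by (simp add: sum_negf)
qed

text \<open>Constancy on frame tuples is known only on \<open>M\<close>, so it can be differentiated
  only in tangent directions. The product rule then trades the unknown derivative of
  \<open>\<eta>\<close> for values of \<open>\<eta>\<close>, possibly on vectors that are not
  tangent.\<close>

lemma coeff_deriv_frame:
  fixes M :: "'v::euclidean_space set" and X :: "'i \<Rightarrow> 'v \<Rightarrow> 'v"
  assumes U: "open U" "p \<in> U" and alt: "\<And>q. q \<in> U \<Longrightarrow> adj_alternating UNIV k (\<eta> q)"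
    and der: "\<And>us. length us = k \<Longrightarrow> ((\<lambda>q. \<eta> q us) has_derivative coeff_deriv \<eta> p us) (at p)"
    and const: "\<And>q. q \<in> U \<Longrightarrow> q \<in> M \<Longrightarrow> \<eta> q (map (\<lambda>i. X i q) is) = a"
    and X: "\<And>i. i \<in> set is \<Longrightarrow> (X i has_derivative DX i) (at p)"
    and v: "v \<in> tangent_space M p" and len: "length is = k"
  shows "coeff_deriv \<eta> p (map (\<lambda>i. X i p) is) v =
    - (\<Sum>j<k. \<eta> p ((map (\<lambda>i. X i p) is)[j := DX (is ! j) v]))"
proof -
  obtain \<gamma> where \<gamma>: "\<And>t. \<gamma> t \<in> M" "\<gamma> 0 = p" "(\<gamma> has_vector_derivative v) (at 0)"
    using v unfolding tangent_space_def by blast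
  have "isCont \<gamma> 0" using \<gamma>(3) by (rule has_vector_derivative_continuous)
  then have "(\<gamma> \<longlongrightarrow> p) (nhds 0)" using \<gamma>(2) tendsto_at_iff_tendsto_nhds[of \<gamma> 0] by (simp add: isCont_def)
  then have ev: "\<forall>\<^sub>F t in nhds 0. \<gamma> t \<in> U" using U by (rule topological_tendstoD)
  have chain: "((\<lambda>t. g (\<gamma> t)) has_derivative (\<lambda>t. D (t *\<^sub>R v))) (at 0)"
    if "(g has_derivative D) (at p)" for g :: "'v \<Rightarrow> 'w::real_normed_vector" and D
    using has_derivative_compose[of \<gamma> "\<lambda>t. t *\<^sub>R v" 0 UNIV g D] \<gamma> that
    by (simp add: has_vector_derivative_def)
  have "((\<lambda>t. \<eta> (\<gamma> t) ([] @ map (\<lambda>j. X j (\<gamma> t)) is)) has_real_derivative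
      coeff_deriv \<eta> p ([] @ map (\<lambda>j. X j (\<gamma> 0)) is) v +
      (\<Sum>i<length is. \<eta> (\<gamma> 0) ([] @ (map (\<lambda>j. X j (\<gamma> 0)) is)[i := DX (is ! i) v]))) (at 0)"
  proof (rule has_real_derivative_form_along[where A = "\<lambda>t. \<eta> (\<gamma> t)" and A' = "\<lambda>us. coeff_deriv \<eta> p us v"])
    show "\<forall>\<^sub>F t in nhds 0. adj_alternating UNIV k (\<eta> (\<gamma> t))"
      using ev by eventually_elim (rule alt)
    show "adj_alternating UNIV k (\<lambda>us. coeff_deriv \<eta> p us v)"
      using adj_alternating_coeff_deriv[OF U alt der] .
    show "((\<lambda>t. \<eta> (\<gamma> t) us) has_real_derivative coeff_deriv \<eta> p us v) (at 0)" if "length us = k" for us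
      using chain[OF der[OF that]] linear_scale[OF has_derivative_linear[OF der[OF that]]]
      by (simp add: has_field_derivative_def mult_commute_abs)
    show "((\<lambda>t. X j (\<gamma> t)) has_vector_derivative DX j v) (at 0)" if "j \<in> set is" for j
      using chain[OF X[OF that]] linear_scale[OF has_derivative_linear[OF X[OF that]]]
      by (simp add: has_vector_derivative_def)
  qed (use len in auto)
  moreover have "\<forall>\<^sub>F t in nhds 0. \<eta> (\<gamma> t) ([] @ map (\<lambda>j. X j (\<gamma> t)) is) = a"
    using ev by eventually_elim (use const \<gamma> in auto)
  then have "((\<lambda>t. \<eta> (\<gamma> t) ([] @ map (\<lambda>j. X j (\<gamma> t)) is)) has_real_derivative 0) (at 0)"
    by (subst DERIV_cong_ev[OF refl _ refl]) auto
  ultimately have "coeff_deriv \<eta> p ([] @ map (\<lambda>j. X j (\<gamma> 0)) is) v +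
      (\<Sum>i<length is. \<eta> (\<gamma> 0) ([] @ (map (\<lambda>j. X j (\<gamma> 0)) is)[i := DX (is ! i) v])) = 0"
    by (rule DERIV_unique)
  then show ?thesis using \<gamma>(2) len by simp
qed

text \<open>The invariant formula for d without its first group of terms, since the functions
  obtained by inserting frame fields are constant. \<open>DX j (X i p) - DX i (X j p)\<close> is the
  Lie bracket of the fields \<open>i\<close> and \<open>j\<close>.\<close>

lemma ext_deriv_frame:
  fixes M :: "'v::euclidean_space set" and X :: "'i \<Rightarrow> 'v \<Rightarrow> 'v"
  assumes smooth: "smooth_form M k \<omega>" and p: "p \<in> M" and len: "length js = Suc k"
    and X: "\<And>i q. i \<in> set js \<Longrightarrow> q \<in> M \<Longrightarrow> X i q \<in> tangent_space M q"
    and DX: "\<And>i. i \<in> set js \<Longrightarrow> (X i has_derivative DX i) (at p)"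
    and const: "\<And>is q. q \<in> M \<Longrightarrow> length is = k \<Longrightarrow> set is \<subseteq> set js \<Longrightarrow> \<omega> q (map (\<lambda>i. X i q) is) = a is"
    and bracket: "\<And>i j. i \<in> set js \<Longrightarrow> j \<in> set js \<Longrightarrow> DX j (X i p) - DX i (X j p) \<in> tangent_space M p"
  shows "ext_deriv M k \<omega> p (map (\<lambda>i. X i p) js) =
    (\<Sum>j\<le>k. \<Sum>i<j. (- 1) ^ (i + j) *
      \<omega> p ((DX (js ! j) (X (js ! i) p) - DX (js ! i) (X (js ! j) p)) # map (\<lambda>i. X i p) (omit i (omit j js))))"
proof -
  obtain \<eta> U where *: "ext_deriv M k \<omega> p = alternation k (coeff_deriv \<eta> p)"
    "open U" "p \<in> U" "\<And>q. q \<in> U \<Longrightarrow> adj_alternating UNIV k (\<eta> q)"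
    "\<And>us. length us = k \<Longrightarrow> ((\<lambda>q. \<eta> q us) has_derivative coeff_deriv \<eta> p us) (at p)"
    "\<And>q vs. q \<in> U \<Longrightarrow> q \<in> M \<Longrightarrow> vs \<in> tangent_lists M k q \<Longrightarrow> \<eta> q vs = \<omega> q vs"
    by (rule ext_deriv_extension[OF smooth p]) blast
  have sub: "set (omit i js) \<subseteq> set js" for i by (rule set_omit)
  have "ext_deriv M k \<omega> p (map (\<lambda>i. X i p) js) =
      (\<Sum>i\<le>k. (- 1) ^ i * coeff_deriv \<eta> p (map (\<lambda>i. X i p) (omit i js)) (X (js ! i) p))"
    unfolding *(1) alternation_def by (rule sum.cong) (use len in \<open>auto simp: nths_map\<close>)
  also have "\<dots> = (\<Sum>i\<le>k. (- 1) ^ i * - (\<Sum>j<k. \<eta> p ((map (\<lambda>i. X i p) (omit i js))[j := DX (omit i js ! j) (X (js ! i) p)])))"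
  proof (rule sum.cong)
    fix i assume i: "i \<in> {..k}"
    have "coeff_deriv \<eta> p (map (\<lambda>i. X i p) (omit i js)) (X (js ! i) p) =
        - (\<Sum>j<k. \<eta> p ((map (\<lambda>i. X i p) (omit i js))[j := DX (omit i js ! j) (X (js ! i) p)]))"
    proof (rule coeff_deriv_frame[OF *(2-5)])
      fix q assume q: "q \<in> U" "q \<in> M"
      have "map (\<lambda>i. X i q) (omit i js) \<in> tangent_lists M k q"
        using X sub[of i] q i len by (auto simp: tangent_lists_def length_omit)
      then show "\<eta> q (map (\<lambda>i. X i q) (omit i js)) = a (omit i js)"
        using *(6) q const sub i len by (simp add: length_omit)
    qed (use i len sub[of i] X p DX in \<open>auto simp: length_omit\<close>)
    then show "(- 1) ^ i * coeff_deriv \<eta> p (map (\<lambda>i. X i p) (omit i js)) (X (js ! i) p) =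
        (- 1) ^ i * - (\<Sum>j<k. \<eta> p ((map (\<lambda>i. X i p) (omit i js))[j := DX (omit i js ! j) (X (js ! i) p)]))"
      by simp
  qed simp
  also have "\<dots> = (\<Sum>j\<le>k. \<Sum>i<j. (- 1) ^ (i + j) *
      \<eta> p ((DX (js ! j) (X (js ! i) p) - DX (js ! i) (X (js ! j) p)) # map (\<lambda>i. X i p) (omit i (omit j js))))"
    using sum_slots_bracket[OF *(4)[OF *(3)] len, of "\<lambda>i. X i p" "\<lambda>i j. DX j (X i p)"]
    by (simp add: sum_negf)
  \<comment> \<open>Only at this point, with a tangent bracket as first argument, are all arguments
    tangent, so that \<open>\<eta>\<close> may be replaced by \<open>\<omega>\<close>.\<close>
  also have "\<dots> = (\<Sum>j\<le>k. \<Sum>i<j. (- 1) ^ (i + j) *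
      \<omega> p ((DX (js ! j) (X (js ! i) p) - DX (js ! i) (X (js ! j) p)) # map (\<lambda>i. X i p) (omit i (omit j js))))"
  proof (intro sum.cong refl)
    fix j i assume ij: "j \<in> {..k}" "i \<in> {..<j}"
    have "set (omit i (omit j js)) \<subseteq> set js" using set_omit[of "omit j js"] sub[of j] by (meson order_trans)
    then have "(DX (js ! j) (X (js ! i) p) - DX (js ! i) (X (js ! j) p)) # map (\<lambda>i. X i p) (omit i (omit j js))
        \<in> tangent_lists M k p"
      using ij len bracket[of "js ! i" "js ! j"] X p by (auto simp: tangent_lists_def length_omit)
    then show "(- 1) ^ (i + j) *
      \<eta> p ((DX (js ! j) (X (js ! i) p) - DX (js ! i) (X (js ! j) p)) # map (\<lambda>i. X i p) (omit i (omit j js))) =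
      (- 1) ^ (i + j) *
      \<omega> p ((DX (js ! j) (X (js ! i) p) - DX (js ! i) (X (js ! j) p)) # map (\<lambda>i. X i p) (omit i (omit j js)))"
      using *(6) *(3) p by simp
  qed
  finally show ?thesis .
qed

section \<open>Forms with constant components in a global frame\<close>

lemma wedge_0: "wedge 0 \<alpha> \<beta> vs = \<alpha> [] * \<beta> vs"
  by (induction vs arbitrary: \<beta>) (simp_all add: wedge_Nil wedge_Cons)

text \<open>With indices in place of vectors, \<open>kron\<close> is a coframe evaluated on its own
  dual frame. The same \<open>coframe_wedge\<close> thereby computes components on index
  lists.\<close>

abbreviation kron :: "nat \<Rightarrow> nat \<Rightarrow> real" where
  "kron i j \<equiv> of_bool (i = j)"

lemma coframe_wedge_map: "coframe_wedge e is (map f js) = coframe_wedge (\<lambda>i j. e i (f j)) is js"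
proof (induction "is" arbitrary: js)
  case (Cons i "is")
  have "wedge 1 (\<lambda>us. e i (hd (map f us))) (\<lambda>us. coframe_wedge e is (map f us)) js =
      wedge 1 (\<lambda>us. e i (f (hd us))) (coframe_wedge (\<lambda>i j. e i (f j)) is) js"
    by (rule wedge_cong) (auto simp: Cons.IH length_Suc_conv)
  then show ?case by (simp add: wedge_map)
qed simp

lemma coframe_wedge_cong:
  assumes "\<And>i v. i \<in> set is \<Longrightarrow> v \<in> set vs \<Longrightarrow> e i v = e' i v" "length vs = length is"
  shows "coframe_wedge e is vs = coframe_wedge e' is vs"
  using assms
proof (induction "is" arbitrary: vs)
  case (Cons i "is")
  have "wedge 1 (\<lambda>us. e i (hd us)) (coframe_wedge e is) vs = wedge 1 (\<lambda>us. e' i (hd us)) (coframe_wedge e' is) vs"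
    by (rule wedge_cong) (use Cons in \<open>auto simp: length_Suc_conv intro!: Cons.IH\<close>)
  then show ?case by simp
qed simp

lemma wedge_kron_absent:
  assumes "i \<notin> set js"
  shows "wedge 1 (\<lambda>us. kron i (hd us)) \<beta> js = 0"
proof -
  have "wedge 1 (\<lambda>us. kron i (hd us)) \<beta> js = wedge 1 (\<lambda>us. 0) \<beta> js"
    by (rule wedge_cong) (use assms in \<open>auto simp: length_Suc_conv\<close>)
  then show ?thesis by (simp add: wedge_zero_left)
qed

lemma coframe_wedge_kron_absent:
  assumes "i \<in> set is" "i \<notin> set js"
  shows "coframe_wedge kron is js = 0"
  using assms
proof (induction "is" arbitrary: js)
  case (Cons j "is")
  show ?case
  proof (cases "i = j")
    case True
    then show ?thesis using Cons.prems wedge_kron_absent by simp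
  next
    case False
    have "wedge 1 (\<lambda>us. kron j (hd us)) (coframe_wedge kron is) js = wedge 1 (\<lambda>us. kron j (hd us)) (\<lambda>us. 0) js"
      by (rule wedge_cong) (use Cons False in auto)
    then show ?thesis by (simp add: wedge_zero_right)
  qed
qed simp

text \<open>Two different increasing lists of equal length have different sets, so some index of
  \<open>is\<close> is missing from \<open>js\<close> and its factor always evaluates to
  zero.\<close>

lemma coframe_wedge_kron:
  assumes "sorted_wrt (<) is" "sorted_wrt (<) js" "length is = length js"
  shows "coframe_wedge kron is js = of_bool (is = js)"
proof (cases "is = js")
  case True
  have "coframe_wedge kron is is = 1" using assms(1)
  proof (induction "is")
    case (Cons i "is")
    then have "wedge 1 (\<lambda>us. kron i (hd us)) (\<lambda>us. coframe_wedge kron is (i # us)) is = 0"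
      by (intro wedge_kron_absent) auto
    then show ?case using Cons by (simp add: wedge_Cons wedge_0)
  qed simp
  then show ?thesis using True by simp
next
  case False
  have d: "sorted is" "distinct is" "sorted js" "distinct js" using assms by (auto simp: strict_sorted_iff)
  then have "set is \<noteq> set js" using False sorted_distinct_set_unique by blast
  moreover have "card (set is) = card (set js)" using d assms by (simp add: distinct_card)
  ultimately obtain i where "i \<in> set is" "i \<notin> set js"
    by (metis List.finite_set card_subset_eq subsetI)
  then show ?thesis using False coframe_wedge_kron_absent by simp
qed

section \<open>Hodge dual and exterior derivative on components\<close>

lemma shuffle_sign_lists:
  assumes "distinct xs" "distinct ys"
  shows "shuffle_sign (set xs) (set ys) = (\<Prod>x\<leftarrow>xs. \<Prod>y\<leftarrow>ys. if y < x then - 1 else 1)"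
proof -
  have inner: "(\<Prod>y\<leftarrow>ys. if y < x then - 1 else 1) = (- 1 :: real) ^ card {y \<in> set ys. y < x}" for x
  proof -
    have "(\<Prod>y\<leftarrow>ys. if y < x then - 1 else 1) = (\<Prod>y\<in>set ys. if y < x then - 1 else (1::real))"
      using assms by (simp add: prod.distinct_set_conv_list)
    also have "\<dots> = (\<Prod>y\<in>{y \<in> set ys. y < x}. - 1)"
      by (rule prod.inter_filter[symmetric]) simp
    finally show ?thesis by simp
  qed
  have "{(i, j). i \<in> set xs \<and> j \<in> set ys \<and> j < i} = (SIGMA x:set xs. {y \<in> set ys. y < x})" by auto
  then have "card {(i, j). i \<in> set xs \<and> j \<in> set ys \<and> j < i} = (\<Sum>x\<in>set xs. card {y \<in> set ys. y < x})"
    by simp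
  then have "shuffle_sign (set xs) (set ys) = (\<Prod>x\<in>set xs. (- 1) ^ card {y \<in> set ys. y < x})"
    by (simp add: shuffle_sign_def power_sum)
  then show ?thesis using assms by (simp add: inner prod.distinct_set_conv_list)
qed

definition compl7 :: "nat list \<Rightarrow> nat list" where
  "compl7 js = filter (\<lambda>i. i \<notin> set js) [1..<8]"

text \<open>On increasing \<open>js\<close> only the complementary multi-index contributes to the
  Hodge dual. The product is the sign of the shuffle placing \<open>compl7 js\<close> before
  \<open>js\<close>, in a form that simplification can evaluate.\<close>

definition hodge_comp :: "(nat list \<Rightarrow> real) \<Rightarrow> nat list \<Rightarrow> real" where
  "hodge_comp a js = (\<Prod>x\<leftarrow>compl7 js. \<Prod>y\<leftarrow>js. if y < x then - 1 else 1) * a (compl7 js)"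

text \<open>The Chevalley-Eilenberg differential of a Lie algebra with structure constants
  \<open>br\<close>. Brackets are lists of coefficient-index pairs, so vanishing brackets are empty
  sums and concrete instances can be computed.\<close>

definition bracket_deriv :: "(nat \<Rightarrow> nat \<Rightarrow> (real \<times> nat) list) \<Rightarrow> nat \<Rightarrow> (nat list \<Rightarrow> real) \<Rightarrow> nat list \<Rightarrow> real" where
  "bracket_deriv br k a js =
    (\<Sum>j\<le>k. \<Sum>i<j. (- 1) ^ (i + j) * (\<Sum>(r, m)\<leftarrow>br (js ! i) (js ! j). r * a (m # omit i (omit j js))))"

lemma set_compl7: "set (compl7 js) = {1..7} - set js"
  by (auto simp: compl7_def)

lemma sorted_compl7: "sorted_wrt (<) (compl7 js)"
  unfolding compl7_def by (rule sorted_wrt_filter) simp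

lemma sorted_list_of_set_compl: "sorted_list_of_set ({1..7} - set js) = compl7 js"
proof (rule sorted_distinct_set_unique)
  show "sorted (compl7 js)" "distinct (compl7 js)" using sorted_compl7 by (auto simp: strict_sorted_iff)
qed (simp_all add: set_compl7)

lemma adj_alternating_sum_list:
  assumes W: "subspace W" and alt: "adj_alternating W k \<alpha>" and us: "length us + 1 = k" "set us \<subseteq> W"
    and Y: "\<And>r m. (r, m) \<in> set l \<Longrightarrow> Y m \<in> W"
  shows "\<alpha> ((\<Sum>(r, m)\<leftarrow>l. r *\<^sub>R Y m) # us) = (\<Sum>(r, m)\<leftarrow>l. r * \<alpha> (Y m # us))"
proof -
  \<comment> \<open>Membership of the partial sum in \<open>W\<close> is carried through the
    induction because linearity of \<open>\<alpha>\<close> demands it at each step.\<close>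
  have "(\<Sum>(r, m)\<leftarrow>l. r *\<^sub>R Y m) \<in> W \<and> \<alpha> ((\<Sum>(r, m)\<leftarrow>l. r *\<^sub>R Y m) # us) = (\<Sum>(r, m)\<leftarrow>l. r * \<alpha> (Y m # us))"
    using Y
  proof (induction l)
    case Nil
    then show ?case
      using adj_alternating_linear[OF alt, of "[]" us 0 0 0 0] us subspace_0[OF W] by simp
  next
    case (Cons x l)
    obtain r m where x: "x = (r, m)" by fastforce
    have Ym: "Y m \<in> W" using Cons.prems x by auto
    have IH: "(\<Sum>(r, m)\<leftarrow>l. r *\<^sub>R Y m) \<in> W"
        "\<alpha> ((\<Sum>(r, m)\<leftarrow>l. r *\<^sub>R Y m) # us) = (\<Sum>(r, m)\<leftarrow>l. r * \<alpha> (Y m # us))"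
      using Cons by (meson list.set_intros(2))+
    then show ?case
      using adj_alternating_linear[OF alt, of "[]" us "Y m" "\<Sum>(r, m)\<leftarrow>l. r *\<^sub>R Y m" r 1] us x Ym
      by (simp add: subspace_add[OF W] subspace_mul[OF W])
  qed
  then show ?thesis ..
qed

text \<open>The coframe is linear and smooth on the whole ambient space, so that its wedge products
  are ready-made extensions; tangency, duality and the bracket relations are required on
  \<open>M\<close> only. That \<open>br\<close> does not depend on the point is what makes d
  algebraic.\<close>

locale parallelization7 =
  fixes M :: "'v::euclidean_space set" and e :: "'v \<Rightarrow> nat \<Rightarrow> 'v \<Rightarrow> real"
    and Y DY :: "nat \<Rightarrow> 'v \<Rightarrow> 'v" and br :: "nat \<Rightarrow> nat \<Rightarrow> (real \<times> nat) list"
  assumes linear_e: "i \<in> {1..7} \<Longrightarrow> linear (e q i)"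
    and smooth_e: "i \<in> {1..7} \<Longrightarrow> smooth_on (\<lambda>q. e q i v) UNIV"
    and subspace_tangent: "q \<in> M \<Longrightarrow> subspace (tangent_space M q)"
    and Y_tangent: "q \<in> M \<Longrightarrow> i \<in> {1..7} \<Longrightarrow> Y i q \<in> tangent_space M q"
    and tangent_expand: "q \<in> M \<Longrightarrow> v \<in> tangent_space M q \<Longrightarrow> v = (\<Sum>i=1..7. e q i v *\<^sub>R Y i q)"
    and dual: "q \<in> M \<Longrightarrow> i \<in> {1..7} \<Longrightarrow> j \<in> {1..7} \<Longrightarrow> e q i (Y j q) = kron i j"
    and Y_deriv: "i \<in> {1..7} \<Longrightarrow> (Y i has_derivative DY i) (at q)"
    and br_range: "i \<in> {1..7} \<Longrightarrow> j \<in> {1..7} \<Longrightarrow> (r, m) \<in> set (br i j) \<Longrightarrow> m \<in> {1..7}"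
    and bracket: "q \<in> M \<Longrightarrow> i \<in> {1..7} \<Longrightarrow> j \<in> {1..7} \<Longrightarrow>
      DY j (Y i q) - DY i (Y j q) = (\<Sum>(r, m)\<leftarrow>br i j. r *\<^sub>R Y m q)"
begin

abbreviation at_frame :: "'v \<Rightarrow> nat list \<Rightarrow> 'v list" where
  "at_frame q \<equiv> map (\<lambda>i. Y i q)"

text \<open>Components are prescribed on all index lists, not just increasing ones:
  \<open>bracket_deriv\<close> and \<open>wedge\<close> evaluate them on unsorted lists, for
  instance with a bracket index put in front.\<close>

definition has_components :: "nat \<Rightarrow> 'v dform \<Rightarrow> (nat list \<Rightarrow> real) \<Rightarrow> bool" where
  "has_components k \<omega> a \<longleftrightarrow>
    (\<forall>q\<in>M. adj_alternating (tangent_space M q) k (\<omega> q) \<and>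
      (\<forall>js. set js \<subseteq> {1..7} \<and> length js = k \<longrightarrow> \<omega> q (at_frame q js) = a js))"

lemma frame_tangent: "q \<in> M \<Longrightarrow> set js \<subseteq> {1..7} \<Longrightarrow> set (at_frame q js) \<subseteq> tangent_space M q"
  using Y_tangent by auto

lemma has_componentsD:
  assumes "has_components k \<omega> a" "q \<in> M"
  shows "adj_alternating (tangent_space M q) k (\<omega> q)"
    and "set js \<subseteq> {1..7} \<Longrightarrow> length js = k \<Longrightarrow> \<omega> q (at_frame q js) = a js"
  using assms unfolding has_components_def by auto

lemma form_eq_frame:
  assumes \<alpha>: "has_components k \<alpha> a" and \<beta>: "has_components k \<beta> b"
    and eq: "\<And>js. sorted_wrt (<) js \<Longrightarrow> set js \<subseteq> {1..7} \<Longrightarrow> length js = k \<Longrightarrow> a js = b js"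
  shows "form_eq M k \<alpha> \<beta>"
  unfolding form_eq_def tangent_lists_def
proof (intro ballI, elim CollectE conjE)
  fix q vs assume q: "q \<in> M" and vs: "length vs = k" "set vs \<subseteq> tangent_space M q"
  have "(\<lambda>vs. \<alpha> q vs - \<beta> q vs) vs = 0"
  proof (rule adj_alternating_eq_0_frame[where S = "{1..7}" and f = "\<lambda>i. Y i q"])
    show "adj_alternating (tangent_space M q) k (\<lambda>vs. \<alpha> q vs - \<beta> q vs)"
      using q \<alpha> \<beta> by (intro adj_alternating_diff has_componentsD)
    show "\<alpha> q (at_frame q js) - \<beta> q (at_frame q js) = 0"
      if "set js \<subseteq> {1..7}" "length js = k" "sorted_wrt (<) js" for js
      using has_componentsD(2)[OF \<alpha> q] has_componentsD(2)[OF \<beta> q] eq that by simp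
    show "\<exists>x. v = (\<Sum>i\<in>{1..7}. x i *\<^sub>R Y i q)" if "v \<in> tangent_space M q" for v
      using tangent_expand[OF q that] by (rule exI[of _ "\<lambda>i. e q i v"])
    show "(\<lambda>i. Y i q) ` {1..7} \<subseteq> tangent_space M q" using Y_tangent[OF q] by blast
  qed (use vs subspace_tangent[OF q] in auto)
  then show "\<alpha> q vs = \<beta> q vs" by simp
qed

lemma has_components_cong:
  assumes "has_components k \<alpha> a"
    and eq: "\<And>q vs. q \<in> M \<Longrightarrow> length vs = k \<Longrightarrow> set vs \<subseteq> tangent_space M q \<Longrightarrow> \<alpha> q vs = \<beta> q vs"
    and "\<And>js. set js \<subseteq> {1..7} \<Longrightarrow> length js = k \<Longrightarrow> a js = b js"
  shows "has_components k \<beta> b"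
  unfolding has_components_def
proof (intro ballI conjI allI impI)
  fix q assume q: "q \<in> M"
  show "adj_alternating (tangent_space M q) k (\<beta> q)"
    by (rule adj_alternating_cong[OF subspace_tangent[OF q] has_componentsD(1)[OF assms(1) q]]) (use q eq in auto)
  fix js :: "nat list" assume js: "set js \<subseteq> {1..7} \<and> length js = k"
  have "\<alpha> q (at_frame q js) = \<beta> q (at_frame q js)"
    using js frame_tangent[OF q] by (intro eq q) auto
  then show "\<beta> q (at_frame q js) = b js"
    using has_componentsD(2)[OF assms(1) q] js assms(3) by simp
qed

lemma has_components_zero: "has_components k (\<lambda>q vs. 0) (\<lambda>js. 0)"
  by (simp add: has_components_def adj_alternating_zero)

lemma has_components_add:
  "has_components k \<alpha> a \<Longrightarrow> has_components k \<beta> b \<Longrightarrow> has_components k (\<lambda>q vs. \<alpha> q vs + \<beta> q vs) (\<lambda>js. a js + b js)"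
  by (simp add: has_components_def adj_alternating_add)

lemma has_components_diff:
  "has_components k \<alpha> a \<Longrightarrow> has_components k \<beta> b \<Longrightarrow> has_components k (\<lambda>q vs. \<alpha> q vs - \<beta> q vs) (\<lambda>js. a js - b js)"
  by (simp add: has_components_def adj_alternating_diff)

lemma has_components_scale:
  "has_components k \<alpha> a \<Longrightarrow> has_components k (\<lambda>q vs. c * \<alpha> q vs) (\<lambda>js. c * a js)"
  by (simp add: has_components_def adj_alternating_scale)

lemma has_components_sum:
  "(\<And>i. i \<in> S \<Longrightarrow> has_components k (\<alpha> i) (a i)) \<Longrightarrow>
    has_components k (\<lambda>q vs. \<Sum>i\<in>S. \<alpha> i q vs) (\<lambda>js. \<Sum>i\<in>S. a i js)"
  by (simp add: has_components_def adj_alternating_sum)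

lemma adj_alternating_coframe:
  assumes "set is \<subseteq> {1..7}"
  shows "adj_alternating W (length is) (coframe_wedge (e q) is)"
proof (rule adj_alternating_coframe_wedge)
  fix i :: nat and u w a b assume "i \<in> set is"
  then have "linear (e q i)" using assms linear_e by blast
  then show "e q i (a *\<^sub>R u + b *\<^sub>R w) = a * e q i u + b * e q i w"
    by (simp add: linear_add linear_scale)
qed

lemma has_components_coframe_wedge:
  assumes "set is \<subseteq> {1..7}" "length is = k"
  shows "has_components k (\<lambda>q. coframe_wedge (e q) is) (coframe_wedge kron is)"
  unfolding has_components_def
proof (intro ballI conjI allI impI)
  fix q assume q: "q \<in> M"
  show "adj_alternating (tangent_space M q) k (coframe_wedge (e q) is)"
    using adj_alternating_coframe[OF assms(1)] assms(2) by blast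
  fix js :: "nat list" assume js: "set js \<subseteq> {1..7} \<and> length js = k"
  show "coframe_wedge (e q) is (at_frame q js) = coframe_wedge kron is js"
    unfolding coframe_wedge_map
  proof (rule coframe_wedge_cong)
    show "e q i (Y j q) = kron i j" if "i \<in> set is" "j \<in> set js" for i j
      using that js assms by (intro dual[OF q]) auto
  qed (use js assms in simp)
qed

text \<open>A global extension with prescribed components, serving as witness of smoothness.\<close>

definition constant_form :: "nat \<Rightarrow> (nat list \<Rightarrow> real) \<Rightarrow> 'v dform" where
  "constant_form k a q vs =
    (\<Sum>I | I \<subseteq> {1..7} \<and> card I = k. a (sorted_list_of_set I) * coframe_wedge (e q) (sorted_list_of_set I) vs)"

lemma smooth_constant_form: "smooth_form M k (constant_form k a)"
  unfolding smooth_form_def smooth_extension_def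
proof (intro ballI exI conjI allI impI)
  fix p assume "p \<in> M"
  show "open (UNIV :: 'v set)" "p \<in> UNIV" by auto
  show "alternating_form UNIV k (constant_form k a q)" if "q \<in> UNIV" for q
    unfolding alternating_form_iff_adj[OF subspace_UNIV] constant_form_def
  proof (intro adj_alternating_sum adj_alternating_scale)
    fix I :: "nat set" assume I: "I \<in> {I. I \<subseteq> {1..7} \<and> card I = k}"
    then have "finite I" using finite_subset by blast
    then show "adj_alternating UNIV k (coframe_wedge (e q) (sorted_list_of_set I))"
      using I adj_alternating_coframe[of "sorted_list_of_set I" UNIV q] by simp
  qed
  show "smooth_on (\<lambda>q. constant_form k a q us) UNIV" for us
    unfolding constant_form_def
  proof (intro smooth_on_sum smooth_on_mult smooth_on_const smooth_on_coframe_wedge)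
    fix I :: "nat set" and i v assume "I \<in> {I. I \<subseteq> {1..7} \<and> card I = k}" "i \<in> set (sorted_list_of_set I)"
    then show "smooth_on (\<lambda>q. e q i v) UNIV"
      using smooth_e finite_subset[of I "{1..7}"] by auto
  qed
qed auto

lemma sum_kron:
  assumes "sorted_wrt (<) js" "set js \<subseteq> {1..7}" "length js = k"
  shows "(\<Sum>I | I \<subseteq> {1..7} \<and> card I = k. f I * coframe_wedge kron (sorted_list_of_set I) js) = f (set js)"
proof -
  have js: "sorted js" "distinct js" using assms by (auto simp: strict_sorted_iff)
  have fin: "finite {I. I \<subseteq> {1..7::nat} \<and> card I = k}" by simp
  have "(\<Sum>I | I \<subseteq> {1..7} \<and> card I = k. f I * coframe_wedge kron (sorted_list_of_set I) js) =
      (\<Sum>I | I \<subseteq> {1..7} \<and> card I = k. if I = set js then f I else 0)"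
  proof (rule sum.cong)
    fix I :: "nat set" assume I: "I \<in> {I. I \<subseteq> {1..7} \<and> card I = k}"
    then have fI: "finite I" using finite_subset by blast
    then have "coframe_wedge kron (sorted_list_of_set I) js = of_bool (sorted_list_of_set I = js)"
      using assms I by (intro coframe_wedge_kron) (auto simp: strict_sorted_iff)
    moreover have "sorted_list_of_set I = js \<longleftrightarrow> I = set js"
      using fI js sorted_list_of_set.idem_if_sorted_distinct by fastforce
    ultimately show "f I * coframe_wedge kron (sorted_list_of_set I) js = (if I = set js then f I else 0)" by simp
  qed simp
  also have "\<dots> = f (set js)"
    using fin assms js by (simp add: sum.delta distinct_card)
  finally show ?thesis .
qed

text \<open>The components stay an explicit sum because \<open>a\<close> is arbitrary and need not
  be alternating; on increasing lists the sum reduces to \<open>a\<close>.\<close>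

lemma has_components_constant_form:
  "has_components k (constant_form k a)
    (\<lambda>js. \<Sum>I | I \<subseteq> {1..7} \<and> card I = k. a (sorted_list_of_set I) * coframe_wedge kron (sorted_list_of_set I) js)"
proof -
  have "has_components k (\<lambda>q. coframe_wedge (e q) (sorted_list_of_set I)) (coframe_wedge kron (sorted_list_of_set I))"
    if "I \<in> {I. I \<subseteq> {1..7} \<and> card I = k}" for I
    using that finite_subset[of I "{1..7}"] by (intro has_components_coframe_wedge) auto
  then show ?thesis
    unfolding constant_form_def by (intro has_components_sum has_components_scale)
qed

lemma smooth_form_components:
  assumes "has_components k \<omega> a"
  shows "smooth_form M k \<omega>"
proof -
  have "form_eq M k (constant_form k a) \<omega>"
  proof (rule form_eq_frame[OF has_components_constant_form assms])
    fix js assume js: "sorted_wrt (<) js" "set js \<subseteq> {1..7::nat}" "length js = k"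
    then have "sorted_list_of_set (set js) = js"
      by (simp add: strict_sorted_iff sorted_list_of_set.idem_if_sorted_distinct)
    then show "(\<Sum>I | I \<subseteq> {1..7} \<and> card I = k. a (sorted_list_of_set I) * coframe_wedge kron (sorted_list_of_set I) js) = a js"
      using sum_kron[OF js, of "\<lambda>I. a (sorted_list_of_set I)"] by simp
  qed
  then show ?thesis using smooth_form_cong smooth_constant_form by blast
qed

lemma has_components_wedge:
  assumes "has_components k \<alpha> a" "has_components l \<beta> b"
  shows "has_components (k + l) (wedge_form k \<alpha> \<beta>) (wedge k a b)"
  unfolding has_components_def wedge_form_def
proof (intro ballI conjI allI impI)
  fix q assume q: "q \<in> M"
  show "adj_alternating (tangent_space M q) (k + l) (wedge k (\<alpha> q) (\<beta> q))"
    using assms q by (intro adj_alternating_wedge has_componentsD)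
  fix js :: "nat list" assume js: "set js \<subseteq> {1..7} \<and> length js = k + l"
  show "wedge k (\<alpha> q) (\<beta> q) (at_frame q js) = wedge k a b js"
    unfolding wedge_map
    by (rule wedge_cong) (use js has_componentsD(2)[OF assms(1) q] has_componentsD(2)[OF assms(2) q] in auto)
qed

text \<open>Constant components are preserved by d, so this can be chained with wedge products and
  Hodge duals.\<close>

lemma has_components_ext_deriv:
  assumes "has_components k \<omega> a"
  shows "has_components (Suc k) (ext_deriv M k \<omega>) (bracket_deriv br k a)"
  unfolding has_components_def
proof (intro ballI conjI allI impI)
  fix q assume q: "q \<in> M"
  have "adj_alternating UNIV (Suc k) (ext_deriv M k \<omega> q)"
    using smooth_form_components[OF assms] q by (rule adj_alternating_ext_deriv)
  then show "adj_alternating (tangent_space M q) (Suc k) (ext_deriv M k \<omega> q)"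
    unfolding adj_alternating_def by auto
  fix js :: "nat list" assume js: "set js \<subseteq> {1..7} \<and> length js = Suc k"
  have brT: "(\<Sum>(r, m)\<leftarrow>br i j. r *\<^sub>R Y m q) \<in> tangent_space M q" if "i \<in> {1..7}" "j \<in> {1..7}" for i j
  proof -
    have "x \<in> tangent_space M q" if "x \<in> set (map (\<lambda>(r, m). r *\<^sub>R Y m q) (br i j))" for x
      using that br_range[OF \<open>i \<in> {1..7}\<close> \<open>j \<in> {1..7}\<close>] Y_tangent[OF q] subspace_mul[OF subspace_tangent[OF q]]
      by auto
    moreover have "sum_list l \<in> tangent_space M q" if "\<And>x. x \<in> set l \<Longrightarrow> x \<in> tangent_space M q" for l
      using that by (induction l) (auto intro: subspace_0 subspace_add subspace_tangent[OF q])
    ultimately show ?thesis by blast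
  qed
  have "ext_deriv M k \<omega> q (at_frame q js) =
    (\<Sum>j\<le>k. \<Sum>i<j. (- 1) ^ (i + j) *
      \<omega> q ((DY (js ! j) (Y (js ! i) q) - DY (js ! i) (Y (js ! j) q)) # at_frame q (omit i (omit j js))))"
  proof (rule ext_deriv_frame[OF smooth_form_components[OF assms] q, where a = a])
    show "\<omega> p (map (\<lambda>i. Y i p) is) = a is" if "p \<in> M" "length is = k" "set is \<subseteq> set js" for p "is"
      using has_componentsD(2)[OF assms that(1)] that js by auto
    show "DY j (Y i q) - DY i (Y j q) \<in> tangent_space M q" if "i \<in> set js" "j \<in> set js" for i j
    proof -
      have "i \<in> {1..7}" "j \<in> {1..7}" using that js by blast+
      then show ?thesis using brT bracket[OF q, of i j] by simp
    qed
  qed (use js Y_tangent Y_deriv in auto)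
  also have "\<dots> = bracket_deriv br k a js"
    unfolding bracket_deriv_def
  proof (intro sum.cong refl arg_cong2[where f = "(*)"])
    fix j i assume ij: "j \<in> {..k}" "i \<in> {..<j}"
    have om: "set (omit i (omit j js)) \<subseteq> {1..7}"
      using js set_omit[of "omit j js" i] set_omit[of js j] by (meson order_trans)
    have lom: "length (omit i (omit j js)) + 1 = k" using js ij by (simp add: length_omit)
    have r: "js ! i \<in> {1..7}" "js ! j \<in> {1..7}"
      using js ij nth_mem[of i js] nth_mem[of j js] by (auto simp del: nth_mem)
    have "\<omega> q ((\<Sum>(r, m)\<leftarrow>br (js ! i) (js ! j). r *\<^sub>R Y m q) # at_frame q (omit i (omit j js))) =
        (\<Sum>(r, m)\<leftarrow>br (js ! i) (js ! j). r * \<omega> q (Y m q # at_frame q (omit i (omit j js))))"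
    proof (rule adj_alternating_sum_list[OF subspace_tangent[OF q] has_componentsD(1)[OF assms q]])
      show "Y m q \<in> tangent_space M q" if "(r', m) \<in> set (br (js ! i) (js ! j))" for r' m
        using br_range[OF r that] by (rule Y_tangent[OF q])
    qed (use lom frame_tangent[OF q om] in simp_all)
    also have "\<dots> = (\<Sum>(r, m)\<leftarrow>br (js ! i) (js ! j). r * a (m # omit i (omit j js)))"
    proof (intro arg_cong[of _ _ sum_list] map_cong refl, clarify)
      fix r' m assume "(r', m) \<in> set (br (js ! i) (js ! j))"
      then have "m \<in> {1..7}" by (rule br_range[OF r])
      then show "r' * \<omega> q (Y m q # at_frame q (omit i (omit j js))) = r' * a (m # omit i (omit j js))"
        using has_componentsD(2)[OF assms q, of "m # omit i (omit j js)"] om lom by simp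
    qed
    finally show "\<omega> q ((DY (js ! j) (Y (js ! i) q) - DY (js ! i) (Y (js ! j) q)) # at_frame q (omit i (omit j js))) =
        (\<Sum>(r, m)\<leftarrow>br (js ! i) (js ! j). r * a (m # omit i (omit j js)))"
      using bracket[OF q r] by simp
  qed
  finally show "ext_deriv M k \<omega> q (at_frame q js) = bracket_deriv br k a js" .
qed

section \<open>The Hodge operator in a parallelization\<close>

lemma coframe7_e: "q \<in> M \<Longrightarrow> coframe7 (tangent_space M q) (e q)"
  unfolding coframe7_def
proof (intro conjI ballI allI)
  fix i :: nat and u w a b assume "i \<in> {1..7}"
  then show "e q i (a *\<^sub>R u + b *\<^sub>R w) = a * e q i u + b * e q i w"
    using linear_e[of i q] by (simp add: linear_add linear_scale)
next
  fix x :: "nat \<Rightarrow> real"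
  assume q: "q \<in> M"
  show "\<exists>!v. v \<in> tangent_space M q \<and> (\<forall>i\<in>{1..7}. e q i v = x i)"
  proof (intro ex1I conjI ballI)
    show "(\<Sum>j=1..7. x j *\<^sub>R Y j q) \<in> tangent_space M q"
      by (intro subspace_sum subspace_mul subspace_tangent Y_tangent q) auto
    fix i assume i: "i \<in> {1..7::nat}"
    have "e q i (\<Sum>j=1..7. x j *\<^sub>R Y j q) = (\<Sum>j=1..7. x j * e q i (Y j q))"
      using linear_e[OF i, of q] by (simp add: linear_sum linear_scale)
    also have "\<dots> = (\<Sum>j=1..7. if i = j then x j else 0)"
      by (intro sum.cong) (use dual[OF q i] in auto)
    also have "\<dots> = x i" using i by (simp add: sum.delta)
    finally show "e q i (\<Sum>j=1..7. x j *\<^sub>R Y j q) = x i" .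
  next
    fix v assume v: "v \<in> tangent_space M q \<and> (\<forall>i\<in>{1..7}. e q i v = x i)"
    then have "v = (\<Sum>j=1..7. e q j v *\<^sub>R Y j q)" using tangent_expand[OF q] by blast
    also have "\<dots> = (\<Sum>j=1..7. x j *\<^sub>R Y j q)" using v by (intro sum.cong) auto
    finally show "v = (\<Sum>j=1..7. x j *\<^sub>R Y j q)" .
  qed
qed

lemma dual_frame_eq:
  assumes "q \<in> M" "j \<in> {1..7}"
  shows "dual_frame (tangent_space M q) (e q) j = Y j q"
  unfolding dual_frame_def
proof (rule the1_equality)
  show "\<exists>!v. v \<in> tangent_space M q \<and> (\<forall>i\<in>{1..7}. e q i v = of_bool (i = j))"
    using coframe7_e[OF assms(1), unfolded coframe7_def, THEN conjunct2, THEN spec[of _ "\<lambda>i. kron i j"]] .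
qed (use assms Y_tangent dual in auto)

lemma hodge_expand:
  assumes "has_components k \<omega> a" "q \<in> M"
  shows "hodge_form M e k \<omega> q ws =
    (\<Sum>I | I \<subseteq> {1..7} \<and> card I = k. a (sorted_list_of_set I) * (shuffle_sign I ({1..7} - I) *
      coframe_wedge (e q) (sorted_list_of_set ({1..7} - I)) ws))"
  unfolding hodge_form_def hodge_def
proof (intro sum.cong refl arg_cong2[where f = "(*)"])
  fix I :: "nat set" assume I: "I \<in> {I. I \<subseteq> {1..7} \<and> card I = k}"
  then have fI: "finite I" using finite_subset by blast
  have eq: "map (dual_frame (tangent_space M q) (e q)) (sorted_list_of_set I) = at_frame q (sorted_list_of_set I)"
    using I fI dual_frame_eq[OF assms(2)] by (intro map_cong) auto
  show "\<omega> q (map (dual_frame (tangent_space M q) (e q)) (sorted_list_of_set I)) = a (sorted_list_of_set I)"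
    unfolding eq using has_componentsD(2)[OF assms, of "sorted_list_of_set I"] I fI by simp
qed

lemma hodge_sorted:
  assumes "sorted_wrt (<) js" "set js \<subseteq> {1..7}" "length js + k = 7"
  shows "(\<Sum>I | I \<subseteq> {1..7} \<and> card I = k. a (sorted_list_of_set I) * (shuffle_sign I ({1..7} - I) *
      coframe_wedge kron (sorted_list_of_set ({1..7} - I)) js)) = hodge_comp a js"
proof -
  \<comment> \<open>Reindexing by complements brings the sum into the shape from which
    \<open>sum_kron\<close> extracts a single term.\<close>
  have "(\<Sum>I | I \<subseteq> {1..7} \<and> card I = k. a (sorted_list_of_set I) * (shuffle_sign I ({1..7} - I) *
      coframe_wedge kron (sorted_list_of_set ({1..7} - I)) js)) =
    (\<Sum>J | J \<subseteq> {1..7} \<and> card J = length js. (a (sorted_list_of_set ({1..7} - J)) * shuffle_sign ({1..7} - J) J) *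
      coframe_wedge kron (sorted_list_of_set J) js)"
    by (rule sum.reindex_bij_witness[of _ "\<lambda>J. {1..7} - J" "\<lambda>I. {1..7} - I"])
      (use assms in \<open>auto simp: card_Diff_subset finite_subset[of _ "{1..7}"] double_diff\<close>)
  also have "\<dots> = a (sorted_list_of_set ({1..7} - set js)) * shuffle_sign ({1..7} - set js) (set js)"
    by (rule sum_kron) (use assms in auto)
  also have "\<dots> = hodge_comp a js"
  proof -
    have "shuffle_sign (set (compl7 js)) (set js) = (\<Prod>x\<leftarrow>compl7 js. \<Prod>y\<leftarrow>js. if y < x then - 1 else 1)"
      by (rule shuffle_sign_lists) (use assms sorted_compl7[of js] in \<open>auto simp: strict_sorted_iff\<close>)
    then show ?thesis by (simp only: hodge_comp_def sorted_list_of_set_compl set_compl7 mult.commute)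
  qed
  finally show ?thesis .
qed

text \<open>\<open>hodge_comp\<close> ignores the order of \<open>js\<close> and is therefore right
  only on increasing lists. It cannot itself be the component function, hence the existential
  \<open>b\<close>.\<close>

lemma has_components_hodge:
  assumes "has_components k \<omega> a" "k + l = 7"
  obtains b where "has_components l (hodge_form M e k \<omega>) b"
    "\<And>js. sorted_wrt (<) js \<Longrightarrow> set js \<subseteq> {1..7} \<Longrightarrow> length js = l \<Longrightarrow> b js = hodge_comp a js"
proof
  let ?b = "\<lambda>js. \<Sum>I | I \<subseteq> {1..7} \<and> card I = k. a (sorted_list_of_set I) * (shuffle_sign I ({1..7} - I) *
      coframe_wedge kron (sorted_list_of_set ({1..7} - I)) js)"
  have "has_components l (\<lambda>q. coframe_wedge (e q) (sorted_list_of_set ({1..7} - I)))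
      (coframe_wedge kron (sorted_list_of_set ({1..7} - I)))"
    if "I \<in> {I. I \<subseteq> {1..7} \<and> card I = k}" for I
    using that assms(2) finite_subset[of I "{1..7}"]
    by (intro has_components_coframe_wedge) (auto simp: card_Diff_subset)
  then have "has_components l (\<lambda>q ws. \<Sum>I | I \<subseteq> {1..7} \<and> card I = k. a (sorted_list_of_set I) *
      (shuffle_sign I ({1..7} - I) * coframe_wedge (e q) (sorted_list_of_set ({1..7} - I)) ws)) ?b"
    by (intro has_components_sum has_components_scale)
  then show "has_components l (hodge_form M e k \<omega>) ?b"
    by (rule has_components_cong) (simp_all add: hodge_expand[OF assms(1)])
  show "?b js = hodge_comp a js" if "sorted_wrt (<) js" "set js \<subseteq> {1..7}" "length js = l" for js
    using that assms(2) by (intro hodge_sorted) auto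
qed

end

section \<open>The structure equations\<close>

lemma sorted_in_subseqs:
  assumes "sorted_wrt (<) xs" "sorted_wrt (<) js" "set js \<subseteq> set xs"
  shows "js \<in> set (subseqs (xs :: 'a::linorder list))"
  using assms
proof (induction xs arbitrary: js)
  case (Cons x xs)
  show ?case
  proof (cases js)
    case (Cons y ys)
    show ?thesis
    proof (cases "y = x")
      case True
      then have "ys \<in> set (subseqs xs)"
        using Cons Cons.prems by (intro Cons.IH) auto
      then show ?thesis using True Cons by (simp add: Let_def)
    next
      case False
      then have "js \<in> set (subseqs xs)"
        using Cons Cons.prems by (intro Cons.IH) (auto dest: order.asym)
      then show ?thesis by (simp add: Let_def)
    qed
  qed (use Cons.IH[of "[]"] Cons.prems in \<open>simp add: Let_def\<close>)
qed simp

text \<open>Turns a statement about all increasing lists of length \<open>k\<close> into one over an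
  explicit list with at most 35 entries.\<close>

lemma increasing_lists:
  assumes "sorted_wrt (<) js" "set js \<subseteq> {1..7::nat}" "length js = k"
  shows "js \<in> set (filter (\<lambda>l. length l = k) (subseqs [1,2,3,4,5,6,7]))"
proof -
  have "set js \<subseteq> set [1,2,3,4,5,6,7]" using assms by fastforce
  then have "js \<in> set (subseqs [1,2,3,4,5,6,7])"
    using assms by (intro sorted_in_subseqs) simp_all
  then show ?thesis using assms(3) by (simp only: set_filter mem_Collect_eq)
qed

text \<open>
  \<open>su2_brackets c s i j\<close> lists the pairs \<open>(r, m)\<close> with \<open>[Y i, Y j] = \<Sum> r Y m\<close> for the rotated frame.
\<close>

definition su2_brackets_upper :: "real \<Rightarrow> real \<Rightarrow> nat \<Rightarrow> nat \<Rightarrow> (real \<times> nat) list" where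
  "su2_brackets_upper c s i j =
    (if i = 1 \<and> j = 2 then [(2 * c, 3)]
     else if i = 1 \<and> j = 3 then [(- 2 * c, 2)]
     else if i = 1 \<and> j = 4 then [(2 * s, 5)]
     else if i = 1 \<and> j = 5 then [(- 2 * s, 4)]
     else if i = 2 \<and> j = 3 then [(2 * c, 1), (- 2 * s, 6)]
     else if i = 2 \<and> j = 6 then [(2 * s, 3)]
     else if i = 3 \<and> j = 6 then [(- 2 * s, 2)]
     else if i = 4 \<and> j = 5 then [(2 * s, 1), (2 * c, 6)]
     else if i = 4 \<and> j = 6 then [(- 2 * c, 5)]
     else if i = 5 \<and> j = 6 then [(2 * c, 4)]
     else [])"

definition su2_brackets :: "real \<Rightarrow> real \<Rightarrow> nat \<Rightarrow> nat \<Rightarrow> (real \<times> nat) list" where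
  "su2_brackets c s i j =
    (if j < i then map (\<lambda>(r, m). (- r, m)) (su2_brackets_upper c s j i) else su2_brackets_upper c s i j)"

text \<open>Cofactor expansion along the first index, with conditionals that are decided on
  numerals.\<close>

lemma coframe_wedge_kron_eval:
  "coframe_wedge kron [i] [u] = (if i = u then 1 else 0)"
  "coframe_wedge kron [i, j] [u, v] =
    (if i = u then coframe_wedge kron [j] [v] else 0) - (if i = v then coframe_wedge kron [j] [u] else 0)"
  "coframe_wedge kron [i, j, k] [u, v, w] =
    (if i = u then coframe_wedge kron [j, k] [v, w] else 0) - (if i = v then coframe_wedge kron [j, k] [u, w] else 0)
    + (if i = w then coframe_wedge kron [j, k] [u, v] else 0)"
  "coframe_wedge kron [i, j, k, l] [u, v, w, x] =
    (if i = u then coframe_wedge kron [j, k, l] [v, w, x] else 0) - (if i = v then coframe_wedge kron [j, k, l] [u, w, x] else 0)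
    + (if i = w then coframe_wedge kron [j, k, l] [u, v, x] else 0) - (if i = x then coframe_wedge kron [j, k, l] [u, v, w] else 0)"
  by (simp_all add: wedge_Cons wedge_0 wedge_Nil)

text \<open>Degrees 1, 3 and 4 are those of the Lee form, of the 3-form and its torsion, and of the
  dual 4-form.\<close>

lemma bracket_deriv_eval:
  fixes br a
  defines "B \<equiv> \<lambda>x y us. \<Sum>(r, m)\<leftarrow>br x y. r * a (m # us)"
  shows "bracket_deriv br 1 a [x, y] = - B x y []"
  "bracket_deriv br 3 a [x, y, z, w] =
    - B x y [z, w] + B x z [y, w] - B x w [y, z] - B y z [x, w] + B y w [x, z] - B z w [x, y]"
  "bracket_deriv br 4 a [x, y, z, w, v] =
    - B x y [z, w, v] + B x z [y, w, v] - B x w [y, z, v] + B x v [y, z, w] - B y z [x, w, v]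
    + B y w [x, z, v] - B y v [x, z, w] - B z w [x, y, v] + B z v [x, y, w] - B w v [x, y, z]"
  by (simp_all add: bracket_deriv_def B_def omit_Cons eval_nat_numeral lessThan_Suc)

lemma wedge_1_eval:
  "wedge 1 \<alpha> \<beta> [x, y, z, w] = \<alpha> [x] * \<beta> [y, z, w] - \<alpha> [y] * \<beta> [x, z, w] + \<alpha> [z] * \<beta> [x, y, w] - \<alpha> [w] * \<beta> [x, y, z]"
  "wedge 1 \<alpha> \<beta> [x, y, z, w, v] = \<alpha> [x] * \<beta> [y, z, w, v] - \<alpha> [y] * \<beta> [x, z, w, v] + \<alpha> [z] * \<beta> [x, y, w, v]
    - \<alpha> [w] * \<beta> [x, y, z, v] + \<alpha> [v] * \<beta> [x, y, z, w]"
  by (simp_all add: wedge_Cons wedge_0 wedge_Nil)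

section \<open>Components of the geometric data\<close>

definition phi_comp :: "nat list \<Rightarrow> real" where
  "phi_comp = standard_G2_form kron"

definition psi_comp :: "nat list \<Rightarrow> real" where
  "psi_comp js = coframe_wedge kron [4,5,6,7] js + coframe_wedge kron [2,3,6,7] js + coframe_wedge kron [2,3,4,5] js
    + coframe_wedge kron [1,3,5,7] js - coframe_wedge kron [1,3,4,6] js - coframe_wedge kron [1,2,5,6] js - coframe_wedge kron [1,2,4,7] js"

text \<open>The contraction of the torsion with the dual 4-form: e^456 in e^4567 contributes -2c and
  e^236 in e^2367 contributes 2s.\<close>

definition theta_comp :: "real \<Rightarrow> real \<Rightarrow> nat list \<Rightarrow> real" where
  "theta_comp c s js = 2 * (s - c) * coframe_wedge kron [7] js"

text \<open>For c^2 + s^2 = 1 the coframe satisfies E^1 = c e^1 - s e^6 and F^1 = s e^1 + c e^6, so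
  E^123 = c e^123 - s e^236 and F^123 = s e^145 + c e^456.\<close>

definition torsion_comp :: "real \<Rightarrow> real \<Rightarrow> nat list \<Rightarrow> real" where
  "torsion_comp c s js = 2 * (- c * coframe_wedge kron [1,2,3] js - s * coframe_wedge kron [1,4,5] js
    - c * coframe_wedge kron [4,5,6] js + s * coframe_wedge kron [2,3,6] js)"

lemmas eval_simps = phi_comp_def psi_comp_def theta_comp_def torsion_comp_def standard_G2_form_def
  coframe_wedge_kron_eval bracket_deriv_eval wedge_1_eval hodge_comp_def compl7_def upt_rec

text \<open>No bracket has a component along the seventh field, the generator of the circle
  factor.\<close>

lemma bracket_deriv_theta_comp:
  assumes "sorted_wrt (<) js" "set js \<subseteq> {1..7}" "length js = 2"
  shows "bracket_deriv (su2_brackets c s) 1 (theta_comp c s) js = 0"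
proof -
  have "\<forall>js\<in>set (filter (\<lambda>l. length l = 2) (subseqs [1,2,3,4,5,6,7])). bracket_deriv (su2_brackets c s) 1 (theta_comp c s) js = 0"
    by (simp add: eval_simps su2_brackets_def su2_brackets_upper_def del: One_nat_def coframe_wedge.simps)
  then show ?thesis using increasing_lists[OF assms] by blast
qed

text \<open>Geometrically, both summands of the torsion are pulled back from top-degree forms of
  three-dimensional factors.\<close>

lemma bracket_deriv_torsion_comp:
  assumes "sorted_wrt (<) js" "set js \<subseteq> {1..7}" "length js = 4"
  shows "bracket_deriv (su2_brackets c s) 3 (torsion_comp c s) js = 0"
proof -
  have "\<forall>js\<in>set (filter (\<lambda>l. length l = 4) (subseqs [1,2,3,4,5,6,7])). bracket_deriv (su2_brackets c s) 3 (torsion_comp c s) js = 0"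
    by (simp add: eval_simps su2_brackets_def su2_brackets_upper_def del: One_nat_def coframe_wedge.simps)
  then show ?thesis using increasing_lists[OF assms] by blast
qed

lemma hodge_phi_comp:
  assumes "sorted_wrt (<) js" "set js \<subseteq> {1..7}" "length js = 4"
  shows "hodge_comp phi_comp js = psi_comp js"
proof -
  have "\<forall>js\<in>set (filter (\<lambda>l. length l = 4) (subseqs [1,2,3,4,5,6,7])). hodge_comp phi_comp js = psi_comp js"
    by (simp add: eval_simps su2_brackets_def su2_brackets_upper_def del: One_nat_def coframe_wedge.simps)
  then show ?thesis using increasing_lists[OF assms] by blast
qed

text \<open>The equation that determines the Lee form, as wedging 1-forms with the dual 4-form is
  injective.\<close>

lemma bracket_deriv_psi_comp:
  assumes "sorted_wrt (<) js" "set js \<subseteq> {1..7}" "length js = 5"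
  shows "bracket_deriv (su2_brackets c s) 4 psi_comp js = wedge 1 (theta_comp c s) psi_comp js"
proof -
  have "\<forall>js\<in>set (filter (\<lambda>l. length l = 5) (subseqs [1,2,3,4,5,6,7])). bracket_deriv (su2_brackets c s) 4 psi_comp js = wedge 1 (theta_comp c s) psi_comp js"
    by (simp add: eval_simps su2_brackets_def su2_brackets_upper_def del: One_nat_def coframe_wedge.simps)
  then show ?thesis using increasing_lists[OF assms] by blast
qed


lemma wedge_dphi_phi_comp:
  "wedge 4 (bracket_deriv (su2_brackets c s) 3 phi_comp) phi_comp [1,2,3,4,5,6,7] = - 12 * (c + s)"
  \<comment> \<open>The first pass expands the 35 shuffles with the component functions still
    folded; the second evaluates them on the resulting numeral lists.\<close>
  by (simp add: wedge_Cons wedge_0 wedge_Nil del: One_nat_def, simp add: eval_simps su2_brackets_def su2_brackets_upper_def del: One_nat_def coframe_wedge.simps)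

lemma torsion_comp_eq:
  assumes "sorted_wrt (<) js" "set js \<subseteq> {1..7}" "length js = 3"
  shows "- 2 * (c + s) * phi_comp js - hodge_comp (bracket_deriv (su2_brackets c s) 3 phi_comp) js
    + hodge_comp (wedge 1 (theta_comp c s) phi_comp) js = torsion_comp c s js"
proof -
  have "\<forall>js\<in>set (filter (\<lambda>l. length l = 3) (subseqs [1,2,3,4,5,6,7])).
    - 2 * (c + s) * phi_comp js - hodge_comp (bracket_deriv (su2_brackets c s) 3 phi_comp) js
    + hodge_comp (wedge 1 (theta_comp c s) phi_comp) js = torsion_comp c s js"
    by (simp add: eval_simps su2_brackets_def su2_brackets_upper_def algebra_simps del: One_nat_def coframe_wedge.simps)
  then show ?thesis using increasing_lists[OF assms] by blast
qed

section \<open>The structure attached to a rotated frame\<close>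

locale su2_su2_u1_frame = parallelization7 M e Y DY "su2_brackets c s"
  for M :: "'v::euclidean_space set" and e Y DY c s
begin

definition \<phi> :: "'v dform" where "\<phi> q = standard_G2_form (e q)"

definition \<theta> :: "'v dform" where "\<theta> q vs = 2 * (s - c) * coframe_wedge (e q) [7] vs"

text \<open>Exchanges computed components, known on increasing lists only, for a closed formula
  valid on all lists: the reference form \<open>\<beta>\<close> guarantees the latter.\<close>

lemma has_components_eq_sorted:
  assumes "has_components k \<alpha> a" "has_components k \<beta> b"
    and "\<And>js. sorted_wrt (<) js \<Longrightarrow> set js \<subseteq> {1..7} \<Longrightarrow> length js = k \<Longrightarrow> a js = b js"
  shows "has_components k \<alpha> b"
proof (rule has_components_cong[OF assms(2)])
  have "form_eq M k \<alpha> \<beta>"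
    by (rule form_eq_frame[OF assms(1,2)]) (rule assms(3))
  then show "\<beta> q vs = \<alpha> q vs" if "q \<in> M" "length vs = k" "set vs \<subseteq> tangent_space M q" for q vs
    using that by (simp add: form_eq_def tangent_lists_def)
qed simp

lemma components_phi: "has_components 3 \<phi> phi_comp"
  unfolding \<phi>_def[abs_def] phi_comp_def standard_G2_form_def[abs_def]
  by (intro has_components_add has_components_diff has_components_coframe_wedge) auto

lemma components_theta: "has_components 1 \<theta> (theta_comp c s)"
  unfolding \<theta>_def[abs_def] theta_comp_def[abs_def]
  by (intro has_components_scale has_components_coframe_wedge) auto

lemma components_psi: "has_components 4 (hodge_form M e 3 \<phi>) psi_comp"
proof -
  obtain b where b: "has_components 4 (hodge_form M e 3 \<phi>) b"
    "\<And>js. sorted_wrt (<) js \<Longrightarrow> set js \<subseteq> {1..7} \<Longrightarrow> length js = 4 \<Longrightarrow> b js = hodge_comp phi_comp js"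
    using has_components_hodge[OF components_phi, of 4] by auto
  have "has_components 4 (\<lambda>q vs. coframe_wedge (e q) [4,5,6,7] vs + coframe_wedge (e q) [2,3,6,7] vs
    + coframe_wedge (e q) [2,3,4,5] vs + coframe_wedge (e q) [1,3,5,7] vs - coframe_wedge (e q) [1,3,4,6] vs
    - coframe_wedge (e q) [1,2,5,6] vs - coframe_wedge (e q) [1,2,4,7] vs) psi_comp"
    unfolding psi_comp_def[abs_def]
    by (intro has_components_add has_components_diff has_components_coframe_wedge) auto
  from has_components_eq_sorted[OF b(1) this] b(2) hodge_phi_comp show ?thesis by simp
qed

lemma components_dphi: "has_components 4 (ext_deriv M 3 \<phi>) (bracket_deriv (su2_brackets c s) 3 phi_comp)"
  using has_components_ext_deriv[OF components_phi] by simp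

lemma components_dphi_phi:
  "has_components 7 (wedge_form 4 (ext_deriv M 3 \<phi>) \<phi>) (wedge 4 (bracket_deriv (su2_brackets c s) 3 phi_comp) phi_comp)"
  using has_components_wedge[OF components_dphi components_phi] by simp

lemma components_torsion: "has_components 3 (torsion_form M \<phi> e \<theta>) (torsion_comp c s)"
proof -
  let ?d = "bracket_deriv (su2_brackets c s) 3 phi_comp"
  obtain b where b: "has_components 3 (hodge_form M e 4 (ext_deriv M 3 \<phi>)) b"
    "\<And>js. sorted_wrt (<) js \<Longrightarrow> set js \<subseteq> {1..7} \<Longrightarrow> length js = 3 \<Longrightarrow> b js = hodge_comp ?d js"
    using has_components_hodge[OF components_dphi, of 3] by auto
  have "has_components 4 (wedge_form 1 \<theta> \<phi>) (wedge 1 (theta_comp c s) phi_comp)"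
    using has_components_wedge[OF components_theta components_phi] by simp
  from has_components_hodge[OF this, of 3] obtain b' where b': "has_components 3 (hodge_form M e 4 (wedge_form 1 \<theta> \<phi>)) b'"
    "\<And>js. sorted_wrt (<) js \<Longrightarrow> set js \<subseteq> {1..7} \<Longrightarrow> length js = 3 \<Longrightarrow>
      b' js = hodge_comp (wedge 1 (theta_comp c s) phi_comp) js"
    by auto
  obtain t where t: "has_components 0 (hodge_form M e 7 (wedge_form 4 (ext_deriv M 3 \<phi>) \<phi>)) t"
    "\<And>js. sorted_wrt (<) js \<Longrightarrow> set js \<subseteq> {1..7} \<Longrightarrow> length js = 0 \<Longrightarrow> t js = hodge_comp (wedge 4 ?d phi_comp) js"
    using has_components_hodge[OF components_dphi_phi, of 0] by auto
  \<comment> \<open>A 0-form is its value at \<open>[]\<close>; the complement of \<open>[]\<close>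
    is the full list, so the dual of a 7-form is its single coefficient.\<close>
  have top: "hodge_form M e 7 (wedge_form 4 (ext_deriv M 3 \<phi>) \<phi>) q [] = - 12 * (c + s)" if "q \<in> M" for q
  proof -
    have "hodge_form M e 7 (wedge_form 4 (ext_deriv M 3 \<phi>) \<phi>) q [] = t []"
      using has_componentsD(2)[OF t(1) that, of "[]"] by simp
    also have "\<dots> = wedge 4 ?d phi_comp [1,2,3,4,5,6,7]"
      using t(2)[of "[]"] by (simp add: hodge_comp_def compl7_def upt_rec del: One_nat_def)
    finally show ?thesis using wedge_dphi_phi_comp by simp
  qed
  have "has_components 3 (\<lambda>q vs. - 2 * (c + s) * \<phi> q vs - hodge_form M e 4 (ext_deriv M 3 \<phi>) q vs
      + hodge_form M e 4 (wedge_form 1 \<theta> \<phi>) q vs) (\<lambda>js. - 2 * (c + s) * phi_comp js - b js + b' js)"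
    by (intro has_components_add has_components_diff has_components_scale components_phi b b')
  then have T: "has_components 3 (torsion_form M \<phi> e \<theta>) (\<lambda>js. - 2 * (c + s) * phi_comp js - b js + b' js)"
    by (rule has_components_cong) (simp_all add: torsion_form_def top)
  have "has_components 3 (\<lambda>q vs. 2 * (- c * coframe_wedge (e q) [1,2,3] vs - s * coframe_wedge (e q) [1,4,5] vs
      - c * coframe_wedge (e q) [4,5,6] vs + s * coframe_wedge (e q) [2,3,6] vs)) (torsion_comp c s)"
    unfolding torsion_comp_def[abs_def]
    by (intro has_components_add has_components_diff has_components_scale has_components_coframe_wedge) auto
  from has_components_eq_sorted[OF T this] b(2) b'(2) torsion_comp_eq show ?thesis by simp
qed

lemma closed_formI:
  assumes "has_components k \<omega> a"
    and "\<And>js. sorted_wrt (<) js \<Longrightarrow> set js \<subseteq> {1..7} \<Longrightarrow> length js = Suc k \<Longrightarrow> bracket_deriv (su2_brackets c s) k a js = 0"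
  shows "closed_form M k \<omega>"
  unfolding closed_form_def
  using form_eq_frame[OF has_components_ext_deriv[OF assms(1)] has_components_zero] assms(2)
    smooth_form_components[OF assms(1)] by simp

lemma closed_torsion: "closed_form M 3 (torsion_form M \<phi> e \<theta>)"
  using components_torsion by (rule closed_formI, intro bracket_deriv_torsion_comp) simp_all

lemma closed_theta: "closed_form M 1 \<theta>"
  using components_theta by (rule closed_formI, intro bracket_deriv_theta_comp) simp_all

lemma G2_phi: "G2_structure M \<phi> e"
  unfolding G2_structure_def
  using smooth_form_components[OF components_phi] coframe7_e by (simp add: form_eq_def \<phi>_def)

lemma strong_G2T_phi: "strong_G2T_structure M \<phi> e \<theta>"
proof -
  have "has_components 5 (wedge_form 1 \<theta> (hodge_form M e 3 \<phi>)) (wedge 1 (theta_comp c s) psi_comp)"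
    using has_components_wedge[OF components_theta components_psi] by simp
  moreover have "has_components 5 (ext_deriv M 4 (hodge_form M e 3 \<phi>)) (bracket_deriv (su2_brackets c s) 4 psi_comp)"
    using has_components_ext_deriv[OF components_psi] by simp
  ultimately have "form_eq M 5 (ext_deriv M 4 (hodge_form M e 3 \<phi>)) (wedge_form 1 \<theta> (hodge_form M e 3 \<phi>))"
    using form_eq_frame bracket_deriv_psi_comp by blast
  then show ?thesis
    unfolding strong_G2T_structure_def G2T_structure_def
    using G2_phi closed_torsion smooth_form_components[OF components_theta] by simp
qed

lemma dphi_wedge_phi:
  assumes "s = - c"
  shows "form_eq M 7 (wedge_form 4 (ext_deriv M 3 \<phi>) \<phi>) (\<lambda>p vs. 0)"
proof (rule form_eq_frame[OF components_dphi_phi has_components_zero])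
  fix js :: "nat list" assume js: "sorted_wrt (<) js" "set js \<subseteq> {1..7}" "length js = 7"
  then have "js = [1,2,3,4,5,6,7]" using increasing_lists[OF js] by simp
  then show "wedge 4 (bracket_deriv (su2_brackets c s) 3 phi_comp) phi_comp js = 0"
    using wedge_dphi_phi_comp assms by simp
qed

text \<open>An equality of functions rather than \<open>form_eq\<close>, so that the zero form can
  be substituted inside \<open>torsion_form\<close>.\<close>

lemma theta_zero:
  assumes "s = c" shows "\<theta> = (\<lambda>p vs. 0)"
proof (intro ext)
  show "\<theta> p vs = 0" for p vs unfolding \<theta>_def using assms by simp
qed

lemma coclosed_phi:
  assumes "s = c"
  shows "coclosed_G2_structure M \<phi> e"
  unfolding coclosed_G2_structure_def
proof
  have "theta_comp c s = (\<lambda>_. 0)" using assms by (simp add: theta_comp_def fun_eq_iff)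
  then have "wedge 1 (theta_comp c s) psi_comp js = 0" for js by (simp only: wedge_zero_left)
  then show "closed_form M 4 (hodge_form M e 3 \<phi>)"
    by (intro closed_formI[OF components_psi], subst bracket_deriv_psi_comp) simp_all
qed (rule G2_phi)

end



section \<open>The group as a parallelized submanifold\<close>

text \<open>The quaternion a + bi + cj + dk as a complex matrix; \<open>SU2\<close> consists of the
  unit quaternions.\<close>

definition quat :: "real \<Rightarrow> real \<Rightarrow> real \<Rightarrow> real \<Rightarrow> complex^2^2" where
  "quat a b c d = vector [vector [Complex a b, Complex c d], vector [Complex (- c) d, Complex a (- b)]]"

lemma quat_nth [simp]:
  "quat a b c d $ 1 $ 1 = Complex a b" "quat a b c d $ 1 $ 2 = Complex c d"
  "quat a b c d $ 2 $ 1 = Complex (- c) d" "quat a b c d $ 2 $ 2 = Complex a (- b)"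
  by (simp_all add: quat_def)

lemma mat2_eq_iff: "A = B \<longleftrightarrow> A$1$1 = B$1$1 \<and> A$1$2 = B$1$2 \<and> A$2$1 = B$2$1 \<and> A$2$2 = (B::'a^2^2)$2$2"
  by (auto simp: vec_eq_iff forall_2)

lemma mat2_mult_nth:
  "(A ** B) $ i $ j = A $ i $ 1 * B $ 1 $ j + A $ i $ 2 * (B :: complex^2^2) $ 2 $ j"
  by (simp add: matrix_matrix_mult_def sum_2)

lemma quat_mult: "quat a b c d ** quat a' b' c' d' =
  quat (a * a' - b * b' - c * c' - d * d') (a * b' + b * a' + c * d' - d * c')
    (a * c' - b * d' + c * a' + d * b') (a * d' + b * c' - c * b' + d * a')"
  by (simp add: mat2_eq_iff mat2_mult_nth complex_eq_iff algebra_simps)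

lemma quat_linear:
  "quat a b c d + quat a' b' c' d' = quat (a + a') (b + b') (c + c') (d + d')"
  "quat a b c d - quat a' b' c' d' = quat (a - a') (b - b') (c - c') (d - d')"
  "r *\<^sub>R quat a b c d = quat (r * a) (r * b) (r * c) (r * d)"
  by (simp_all add: mat2_eq_iff complex_eq_iff)

lemma quat_consts: "mat 1 = quat 1 0 0 0" "0 = quat 0 0 0 0"
  by (simp_all add: mat2_eq_iff complex_eq_iff mat_def)

lemma quat_eq_iff: "quat a b c d = quat a' b' c' d' \<longleftrightarrow> a = a' \<and> b = b' \<and> c = c' \<and> d = d'"
  by (auto simp: mat2_eq_iff complex_eq_iff)

lemma conj_transpose_quat: "conj_transpose (quat a b c d) = quat a (- b) (- c) (- d)"
  by (simp add: mat2_eq_iff conj_transpose_def complex_eq_iff)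

lemma SU2_iff: "A \<in> SU2 \<longleftrightarrow> (\<exists>a b c d. A = quat a b c d \<and> a\<^sup>2 + b\<^sup>2 + c\<^sup>2 + d\<^sup>2 = 1)"
proof
  assume "A \<in> SU2"
  then have A: "A ** conj_transpose A = mat 1" "det A = 1" by (auto simp: SU2_def)
  define x y z w where "x = A$1$1" and "y = A$1$2" and "z = A$2$1" and "w = A$2$2"
  have e: "x * cnj x + y * cnj y = 1" "z * cnj x + w * cnj y = 0" "x * w - y * z = 1"
    using A by (simp_all add: mat2_eq_iff mat2_mult_nth conj_transpose_def mat_def det_2 x_def y_def z_def w_def)
  \<comment> \<open>Unitarity and the determinant are linear equations for the second row;
    eliminating expresses it through the conjugated first row.\<close>
  have "w = w * (x * cnj x + y * cnj y) - y * (z * cnj x + w * cnj y)" using e by simp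
  also have "\<dots> = (x * w - y * z) * cnj x" by (simp add: algebra_simps)
  finally have w: "w = cnj x" using e by simp
  have "z = z * (x * cnj x + y * cnj y) - x * (z * cnj x + w * cnj y)" using e by simp
  also have "\<dots> = - (x * w - y * z) * cnj y" by (simp add: algebra_simps)
  finally have z: "z = - cnj y" using e by simp
  have "(Re x)\<^sup>2 + (Im x)\<^sup>2 + (Re y)\<^sup>2 + (Im y)\<^sup>2 = 1"
    using arg_cong[OF e(1), of Re] by (simp add: power2_eq_square)
  moreover have "A = quat (Re x) (Im x) (Re y) (Im y)"
    using w z by (simp add: mat2_eq_iff complex_eq_iff x_def y_def z_def w_def)
  ultimately show "\<exists>a b c d. A = quat a b c d \<and> a\<^sup>2 + b\<^sup>2 + c\<^sup>2 + d\<^sup>2 = 1" by blast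
next
  assume "\<exists>a b c d. A = quat a b c d \<and> a\<^sup>2 + b\<^sup>2 + c\<^sup>2 + d\<^sup>2 = 1"
  then obtain a b c d where A: "A = quat a b c d" and n: "a\<^sup>2 + b\<^sup>2 + c\<^sup>2 + d\<^sup>2 = 1" by blast
  have "A ** conj_transpose A = mat 1"
    using n by (simp add: A conj_transpose_quat quat_mult quat_consts quat_eq_iff power2_eq_square algebra_simps)
  moreover have "det A = 1"
    using n by (simp add: A det_2 complex_eq_iff power2_eq_square algebra_simps)
  ultimately show "A \<in> SU2" by (simp add: SU2_def)
qed

lemma conj_transpose_SU2: "A \<in> SU2 \<Longrightarrow> conj_transpose A \<in> SU2"
  unfolding SU2_iff by (elim exE conjE, intro exI conjI, simp only: conj_transpose_quat) simp

lemma conj_transpose_mult_SU2: "A \<in> SU2 \<Longrightarrow> conj_transpose A ** A = mat 1"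
  by (simp add: SU2_def matrix_left_right_inverse)

lemma mult_SU2: "A \<in> SU2 \<Longrightarrow> B \<in> SU2 \<Longrightarrow> A ** B \<in> SU2"
proof -
  assume "A \<in> SU2" "B \<in> SU2"
  then obtain a b c d a' b' c' d' where AB: "A = quat a b c d" "B = quat a' b' c' d'"
    and n: "a\<^sup>2 + b\<^sup>2 + c\<^sup>2 + d\<^sup>2 = 1" "a'\<^sup>2 + b'\<^sup>2 + c'\<^sup>2 + d'\<^sup>2 = 1"
    unfolding SU2_iff by blast
  \<comment> \<open>Euler's four-square identity, that is, multiplicativity of the quaternion
    norm.\<close>
  have "(a * a' - b * b' - c * c' - d * d')\<^sup>2 + (a * b' + b * a' + c * d' - d * c')\<^sup>2 +
    (a * c' - b * d' + c * a' + d * b')\<^sup>2 + (a * d' + b * c' - c * b' + d * a')\<^sup>2 =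
    (a\<^sup>2 + b\<^sup>2 + c\<^sup>2 + d\<^sup>2) * (a'\<^sup>2 + b'\<^sup>2 + c'\<^sup>2 + d'\<^sup>2)" by algebra
  then show "A ** B \<in> SU2" using n unfolding AB quat_mult SU2_iff by auto
qed

text \<open>Inversion on the group, continued to the ambient space as a real-linear map. This makes
  the left-invariant coframe smooth everywhere, also at singular matrices.\<close>

definition group_inverse :: "ambient \<Rightarrow> ambient" where
  "group_inverse = (\<lambda>(A, B, z). (conj_transpose A, conj_transpose B, cnj z))"

abbreviation group_unit :: ambient where
  "group_unit \<equiv> (mat 1, mat 1, 1)"

lemma group_mult_assoc: "group_mult (group_mult x y) z = group_mult x (group_mult y z)"
  by (simp add: group_mult_def matrix_mul_assoc split: prod.split)

lemma group_mult_unit: "group_mult group_unit x = x" "group_mult x group_unit = x"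
  by (simp_all add: group_mult_def matrix_mul_lid matrix_mul_rid split: prod.split)

lemma group_mult_inverse:
  assumes "p \<in> SU2_SU2_U1"
  shows "group_mult p (group_inverse p) = group_unit" "group_mult (group_inverse p) p = group_unit"
proof -
  obtain A B z where p: "p = (A, B, z)" "A \<in> SU2" "B \<in> SU2" "cmod z = 1"
    using assms by (auto simp: SU2_SU2_U1_def U1_def)
  have "z * cnj z = 1" using p(4) by (simp flip: complex_norm_square)
  then show "group_mult p (group_inverse p) = group_unit" "group_mult (group_inverse p) p = group_unit"
    using p by (auto simp: group_mult_def group_inverse_def conj_transpose_mult_SU2 SU2_def mult.commute)
qed

lemma group_mult_closed: "p \<in> SU2_SU2_U1 \<Longrightarrow> q \<in> SU2_SU2_U1 \<Longrightarrow> group_mult p q \<in> SU2_SU2_U1"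
  by (auto simp: SU2_SU2_U1_def group_mult_def mult_SU2 U1_def norm_mult)

lemma group_inverse_closed: "p \<in> SU2_SU2_U1 \<Longrightarrow> group_inverse p \<in> SU2_SU2_U1"
  by (auto simp: SU2_SU2_U1_def group_inverse_def conj_transpose_SU2 U1_def)

lemma group_inverse_mult:
  "group_inverse (group_mult p q) = group_mult (group_inverse q) (group_inverse p)"
  by (simp add: group_inverse_def group_mult_def case_prod_unfold mat2_eq_iff mat2_mult_nth conj_transpose_def mult.commute)

lemma linear_group_mult_left: "linear (\<lambda>x. group_mult x y)"
  by (simp add: linear_iff group_mult_def case_prod_unfold prod_eq_iff mat2_eq_iff mat2_mult_nth algebra_simps)

lemma linear_group_mult_right: "linear (group_mult x)"
  by (simp add: linear_iff group_mult_def case_prod_unfold prod_eq_iff mat2_eq_iff mat2_mult_nth algebra_simps)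

lemma linear_group_inverse: "linear group_inverse"
  by (simp add: linear_iff group_inverse_def case_prod_unfold prod_eq_iff mat2_eq_iff conj_transpose_def)

section \<open>The Lie algebra and the tangent spaces\<close>

definition lie_algebra :: "ambient set" where
  "lie_algebra = {(quat 0 x y z, quat 0 u v w, Complex 0 t) | x y z u v w t. True}"

lemma subspace_lie_algebra: "subspace lie_algebra"
  unfolding subspace_def
proof (intro conjI ballI allI)
  show "0 \<in> lie_algebra"
    unfolding lie_algebra_def zero_prod_def quat_consts(2) zero_complex.code by blast
next
  fix \<xi> \<eta> assume "\<xi> \<in> lie_algebra" "\<eta> \<in> lie_algebra"
  then obtain x y z u v w t x' y' z' u' v' w' t' where
    "\<xi> = (quat 0 x y z, quat 0 u v w, Complex 0 t)" "\<eta> = (quat 0 x' y' z', quat 0 u' v' w', Complex 0 t')"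
    unfolding lie_algebra_def by blast
  then have "\<xi> + \<eta> = (quat 0 (x + x') (y + y') (z + z'), quat 0 (u + u') (v + v') (w + w'), Complex 0 (t + t'))"
    by (simp add: quat_linear complex_eq_iff)
  then show "\<xi> + \<eta> \<in> lie_algebra" unfolding lie_algebra_def by blast
next
  fix \<xi> and r :: real assume "\<xi> \<in> lie_algebra"
  then obtain x y z u v w t where "\<xi> = (quat 0 x y z, quat 0 u v w, Complex 0 t)"
    unfolding lie_algebra_def by blast
  then have "r *\<^sub>R \<xi> = (quat 0 (r * x) (r * y) (r * z), quat 0 (r * u) (r * v) (r * w), Complex 0 (r * t))"
    by (simp add: quat_linear complex_eq_iff)
  then show "r *\<^sub>R \<xi> \<in> lie_algebra" unfolding lie_algebra_def by blast
qed

text \<open>Fermat's criterion at a maximum. It covers functionals constant on the group as well as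
  one-sided bounds, so the quadratic defining equations need not be differentiated.\<close>

lemma linear_vanishes_on_velocity:
  fixes L :: "'v::euclidean_space \<Rightarrow> real"
  assumes L: "linear L" and \<delta>: "(\<delta> has_vector_derivative w) (at 0)" and max: "\<And>t. L (\<delta> t) \<le> L (\<delta> 0)"
  shows "L w = 0"
proof -
  have "((\<lambda>t. L (\<delta> t)) has_vector_derivative L w) (at 0)"
    using L \<delta> by (simp add: bounded_linear.has_vector_derivative linear_conv_bounded_linear)
  then have "DERIV (\<lambda>t. L (\<delta> t)) 0 :> L w"
    by (simp add: has_real_derivative_iff_has_vector_derivative)
  then show ?thesis by (rule DERIV_local_max[of _ _ _ 1]) (use max in auto)
qed

lemma mat2_one_nth:
  fixes I :: "complex^2^2"
  assumes "I = mat 1"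
  shows "I $ 1 $ 1 = 1" "I $ 1 $ 2 = 0" "I $ 2 $ 1 = 0" "I $ 2 $ 2 = 1"
  using assms by (simp_all add: mat_def)

lemma SU2_components:
  assumes "A \<in> SU2"
  shows "Re (A$1$1) \<le> 1" "A$2$2 = cnj (A$1$1)" "A$2$1 = - cnj (A$1$2)"
proof -
  obtain a b c d where A: "A = quat a b c d" and n: "a\<^sup>2 + b\<^sup>2 + c\<^sup>2 + d\<^sup>2 = 1"
    using assms SU2_iff by blast
  have "a\<^sup>2 \<le> 1\<^sup>2" using n zero_le_power2[of b] zero_le_power2[of c] zero_le_power2[of d] by (simp, linarith)
  then have "a \<le> 1" by (rule power2_le_imp_le) simp
  then show "Re (A$1$1) \<le> 1" "A$2$2 = cnj (A$1$1)" "A$2$1 = - cnj (A$1$2)"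
    using A by (simp_all add: complex_eq_iff)
qed

lemma velocity_in_lie_algebra:
  assumes \<delta>: "\<And>t. \<delta> t \<in> SU2_SU2_U1" "\<delta> 0 = group_unit" and w: "(\<delta> has_vector_derivative w) (at 0)"
  shows "w \<in> lie_algebra"
proof -
  have vanish: "L w = 0" if "linear L" "\<And>q. q \<in> SU2_SU2_U1 \<Longrightarrow> L q \<le> L group_unit" for L :: "ambient \<Rightarrow> real"
    using linear_vanishes_on_velocity[OF that(1) w] that(2) \<delta> by simp
  have SU2_part: "\<pi> w = quat 0 (Im (\<pi> w$1$1)) (Re (\<pi> w$1$2)) (Im (\<pi> w$1$2))"
    if \<pi>: "linear \<pi>" "\<And>q. q \<in> SU2_SU2_U1 \<Longrightarrow> \<pi> q \<in> SU2" "\<pi> group_unit = mat 1" for \<pi> :: "ambient \<Rightarrow> complex^2^2"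
  proof -
    note lin = linear_iff linear_add[OF \<pi>(1)] linear_scale[OF \<pi>(1)] algebra_simps
    \<comment> \<open>The real part of the first entry is at most 1 on SU(2) and equals 1 at the
      unit, where it is maximal.\<close>
    have "Re (\<pi> w$1$1) = 0"
      by (rule vanish) (simp_all add: lin \<pi>(2) SU2_components mat2_one_nth[OF \<pi>(3)])
    \<comment> \<open>These functionals vanish identically on SU(2), so the unit is trivially a
      maximum.\<close>
    moreover have "Re (\<pi> w$2$2 - cnj (\<pi> w$1$1)) = 0" "Im (\<pi> w$2$2 - cnj (\<pi> w$1$1)) = 0"
      "Re (\<pi> w$2$1 + cnj (\<pi> w$1$2)) = 0" "Im (\<pi> w$2$1 + cnj (\<pi> w$1$2)) = 0"
      by (rule vanish; simp add: lin \<pi>(2) SU2_components mat2_one_nth[OF \<pi>(3)])+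
    ultimately show ?thesis by (simp add: mat2_eq_iff complex_eq_iff)
  qed
  have "Re (snd (snd w)) = 0"
  proof (rule vanish)
    show "Re (snd (snd q)) \<le> Re (snd (snd group_unit))" if "q \<in> SU2_SU2_U1" for q
      using that complex_Re_le_cmod[of "snd (snd q)"] by (auto simp: SU2_SU2_U1_def U1_def)
  qed (simp add: linear_iff)
  moreover have "fst w = quat 0 (Im (fst w$1$1)) (Re (fst w$1$2)) (Im (fst w$1$2))"
    by (rule SU2_part) (auto simp: SU2_SU2_U1_def linear_iff)
  moreover have "fst (snd w) = quat 0 (Im (fst (snd w)$1$1)) (Re (fst (snd w)$1$2)) (Im (fst (snd w)$1$2))"
    by (rule SU2_part) (auto simp: SU2_SU2_U1_def linear_iff)
  ultimately have "w = (quat 0 (Im (fst w$1$1)) (Re (fst w$1$2)) (Im (fst w$1$2)),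
      quat 0 (Im (fst (snd w)$1$1)) (Re (fst (snd w)$1$2)) (Im (fst (snd w)$1$2)), Complex 0 (Im (snd (snd w))))"
    by (simp add: prod_eq_iff complex_eq_iff)
  then show ?thesis unfolding lie_algebra_def by blast
qed

text \<open>The normalizing factor depends on t^2 and so has derivative zero at 0. Normalized lines
  realize each velocity by a curve defined for all times, in place of the exponential map.\<close>

lemma normalized_line_derivative:
  fixes X :: "'v::real_normed_vector"
  shows "((\<lambda>t. (1 / sqrt (1 + t\<^sup>2 * r)) *\<^sub>R (I + t *\<^sub>R X)) has_vector_derivative X) (at 0)"
proof -
  have "((\<lambda>t. 1 / sqrt (1 + t\<^sup>2 * r)) has_real_derivative 0) (at 0)"
    by (auto intro!: derivative_eq_intros)
  moreover have "((\<lambda>t. I + t *\<^sub>R X) has_vector_derivative X) (at 0)"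
    by (auto intro!: derivative_eq_intros)
  ultimately have "((\<lambda>t. (1 / sqrt (1 + t\<^sup>2 * r)) *\<^sub>R (I + t *\<^sub>R X)) has_vector_derivative
      (1 / sqrt (1 + 0\<^sup>2 * r)) *\<^sub>R X + 0 *\<^sub>R (I + 0 *\<^sub>R X)) (at 0)"
    by (rule has_vector_derivative_scaleR)
  then show ?thesis by simp
qed

lemma normalized_line_SU2:
  "(1 / sqrt (1 + t\<^sup>2 * (x\<^sup>2 + y\<^sup>2 + z\<^sup>2))) *\<^sub>R (mat 1 + t *\<^sub>R quat 0 x y z) \<in> SU2"
proof -
  define r where "r = sqrt (1 + t\<^sup>2 * (x\<^sup>2 + y\<^sup>2 + z\<^sup>2))"
  have r: "r\<^sup>2 = 1 + t\<^sup>2 * (x\<^sup>2 + y\<^sup>2 + z\<^sup>2)" "r \<noteq> 0"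
    unfolding r_def by (simp_all add: add_pos_nonneg less_imp_neq[symmetric])
  have "(1 / r)\<^sup>2 + (t * x / r)\<^sup>2 + (t * y / r)\<^sup>2 + (t * z / r)\<^sup>2 = (1 + t\<^sup>2 * (x\<^sup>2 + y\<^sup>2 + z\<^sup>2)) / r\<^sup>2"
    by (simp add: power_divide power_mult_distrib add_divide_distrib distrib_left)
  also have "\<dots> = 1" using r by (metis divide_self power_eq_0_iff)
  finally have "(1 / r)\<^sup>2 + (t * x / r)\<^sup>2 + (t * y / r)\<^sup>2 + (t * z / r)\<^sup>2 = 1" .
  moreover have "(1 / r) *\<^sub>R (mat 1 + t *\<^sub>R quat 0 x y z) = quat (1 / r) (t * x / r) (t * y / r) (t * z / r)"
    by (simp add: quat_consts(1) quat_linear)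
  ultimately show ?thesis unfolding SU2_iff r_def[symmetric] by blast
qed

lemma normalized_line_U1:
  "(1 / sqrt (1 + t\<^sup>2 * x\<^sup>2)) *\<^sub>R (1 + t *\<^sub>R Complex 0 x) \<in> U1"
proof -
  have "cmod (1 + t *\<^sub>R Complex 0 x) = sqrt (1 + t\<^sup>2 * x\<^sup>2)"
    by (simp add: cmod_def power_mult_distrib)
  moreover have "1 + t\<^sup>2 * x\<^sup>2 > 0" by (simp add: add_pos_nonneg)
  ultimately show ?thesis by (simp add: U1_def)
qed

text \<open>Left translation by \<open>p\<close> and by its inverse reduces both inclusions to
  curves through the unit.\<close>

lemma tangent_space_group:
  assumes p: "p \<in> SU2_SU2_U1"
  shows "tangent_space SU2_SU2_U1 p = group_mult p ` lie_algebra"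
proof (intro equalityI subsetI)
  fix v assume "v \<in> tangent_space SU2_SU2_U1 p"
  then obtain \<gamma> where \<gamma>: "\<And>t. \<gamma> t \<in> SU2_SU2_U1" "\<gamma> 0 = p" "(\<gamma> has_vector_derivative v) (at 0)"
    unfolding tangent_space_def by blast
  have "group_mult (group_inverse p) v \<in> lie_algebra"
  proof (rule velocity_in_lie_algebra)
    show "group_mult (group_inverse p) (\<gamma> t) \<in> SU2_SU2_U1" for t
      using p \<gamma> by (simp add: group_mult_closed group_inverse_closed)
    show "group_mult (group_inverse p) (\<gamma> 0) = group_unit" using p \<gamma> by (simp add: group_mult_inverse)
    show "((\<lambda>t. group_mult (group_inverse p) (\<gamma> t)) has_vector_derivative group_mult (group_inverse p) v) (at 0)"
      using \<gamma>(3) linear_group_mult_right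
      by (simp add: bounded_linear.has_vector_derivative linear_conv_bounded_linear)
  qed
  moreover have "v = group_mult p (group_mult (group_inverse p) v)"
    using p by (simp add: group_mult_assoc[symmetric] group_mult_inverse group_mult_unit)
  ultimately show "v \<in> group_mult p ` lie_algebra" by blast
next
  fix v assume "v \<in> group_mult p ` lie_algebra"
  then obtain x y z u w s t where v: "v = group_mult p (quat 0 x y z, quat 0 u w s, Complex 0 t)"
    unfolding lie_algebra_def by blast
  define \<delta> where "\<delta> \<tau> = ((1 / sqrt (1 + \<tau>\<^sup>2 * (x\<^sup>2 + y\<^sup>2 + z\<^sup>2))) *\<^sub>R (mat 1 + \<tau> *\<^sub>R quat 0 x y z),
      (1 / sqrt (1 + \<tau>\<^sup>2 * (u\<^sup>2 + w\<^sup>2 + s\<^sup>2))) *\<^sub>R (mat 1 + \<tau> *\<^sub>R quat 0 u w s),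
      (1 / sqrt (1 + \<tau>\<^sup>2 * t\<^sup>2)) *\<^sub>R (1 + \<tau> *\<^sub>R Complex 0 t))" for \<tau>
  have "\<delta> \<tau> \<in> SU2_SU2_U1" for \<tau>
    unfolding \<delta>_def SU2_SU2_U1_def using normalized_line_SU2 normalized_line_U1 by blast
  moreover have "\<delta> 0 = group_unit" by (simp add: \<delta>_def)
  moreover have "(\<delta> has_vector_derivative (quat 0 x y z, quat 0 u w s, Complex 0 t)) (at 0)"
    unfolding \<delta>_def[abs_def] by (intro has_vector_derivative_Pair normalized_line_derivative)
  then have "((\<lambda>\<tau>. group_mult p (\<delta> \<tau>)) has_vector_derivative v) (at 0)"
    unfolding v using linear_group_mult_right
    by (simp add: bounded_linear.has_vector_derivative linear_conv_bounded_linear)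
  ultimately show "v \<in> tangent_space SU2_SU2_U1 p"
    unfolding tangent_space_def using p
    by (auto intro!: exI[of _ "\<lambda>\<tau>. group_mult p (\<delta> \<tau>)"] simp: group_mult_closed group_mult_unit)
qed

section \<open>The rotated frame and its brackets\<close>

definition lie_frame :: "real \<Rightarrow> real \<Rightarrow> nat \<Rightarrow> ambient" where
  "lie_frame c s i =
    (if i = 1 then (quat 0 c 0 0, quat 0 s 0 0, 0)
     else if i = 2 then (quat 0 0 1 0, 0, 0)
     else if i = 3 then (quat 0 0 0 1, 0, 0)
     else if i = 4 then (0, quat 0 0 1 0, 0)
     else if i = 5 then (0, quat 0 0 0 1, 0)
     else if i = 6 then (quat 0 (- s) 0 0, quat 0 c 0 0, 0)
     else (0, 0, Complex 0 1))"

definition lie_coframe :: "real \<Rightarrow> real \<Rightarrow> nat \<Rightarrow> ambient \<Rightarrow> real" where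
  "lie_coframe c s i = (\<lambda>(A, B, z).
    if i = 1 then c * Im (A$1$1) + s * Im (B$1$1)
    else if i = 2 then Re (A$1$2)
    else if i = 3 then Im (A$1$2)
    else if i = 4 then Re (B$1$2)
    else if i = 5 then Im (B$1$2)
    else if i = 6 then c * Im (B$1$1) - s * Im (A$1$1)
    else Im z)"

lemma one_to_seven: "{1..7} = {1, 2, 3, 4, 5, 6, 7::nat}"
  by auto

lemma linear_lie_coframe: "linear (lie_coframe c s i)"
  by (simp add: linear_iff lie_coframe_def case_prod_unfold algebra_simps)

lemma lie_frame_in: "lie_frame c s i \<in> lie_algebra"
  unfolding lie_frame_def lie_algebra_def quat_consts(2) zero_complex.code by (auto split: if_splits)

lemma lie_coframe_frame:
  assumes "c\<^sup>2 + s\<^sup>2 = 1" "i \<in> {1..7}" "j \<in> {1..7}"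
  shows "lie_coframe c s i (lie_frame c s j) = kron i j"
  using assms unfolding one_to_seven
  by (auto simp: lie_coframe_def lie_frame_def power2_eq_square algebra_simps)

lemma lie_algebra_expand:
  assumes "c\<^sup>2 + s\<^sup>2 = 1" "\<xi> \<in> lie_algebra"
  shows "\<xi> = (\<Sum>i=1..7. lie_coframe c s i \<xi> *\<^sub>R lie_frame c s i)"
proof -
  obtain x y z u v w t where \<xi>: "\<xi> = (quat 0 x y z, quat 0 u v w, Complex 0 t)"
    using assms(2) unfolding lie_algebra_def by blast
  \<comment> \<open>The inverse rotation, recovering the coordinates along E_1 and F_1.\<close>
  have "x = (c * x + s * u) * c - (c * u - s * x) * s" "u = (c * x + s * u) * s + (c * u - s * x) * c"
    using assms(1) by algebra+
  then show ?thesis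
    unfolding one_to_seven
    by (simp add: \<xi> lie_coframe_def lie_frame_def quat_linear quat_consts(2) zero_prod_def quat_eq_iff complex_eq_iff algebra_simps)
qed

text \<open>Zeros are written as quaternions so that \<open>quat_mult\<close> applies to all
  products uniformly.\<close>

lemma lie_frame_eval:
  "lie_frame c s 1 = (quat 0 c 0 0, quat 0 s 0 0, Complex 0 0)"
  "lie_frame c s 2 = (quat 0 0 1 0, quat 0 0 0 0, Complex 0 0)"
  "lie_frame c s 3 = (quat 0 0 0 1, quat 0 0 0 0, Complex 0 0)"
  "lie_frame c s 4 = (quat 0 0 0 0, quat 0 0 1 0, Complex 0 0)"
  "lie_frame c s 5 = (quat 0 0 0 0, quat 0 0 0 1, Complex 0 0)"
  "lie_frame c s 6 = (quat 0 (- s) 0 0, quat 0 c 0 0, Complex 0 0)"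
  "lie_frame c s 7 = (quat 0 0 0 0, quat 0 0 0 0, Complex 0 1)"
  by (simp_all add: lie_frame_def quat_consts(2) complex_eq_iff)

lemma lie_bracket_less:
  assumes "c\<^sup>2 + s\<^sup>2 = 1" "i \<in> {1..7}" "j \<in> {1..7}" "i \<le> j"
  shows "group_mult (lie_frame c s i) (lie_frame c s j) - group_mult (lie_frame c s j) (lie_frame c s i) =
    (\<Sum>(r, m)\<leftarrow>su2_brackets_upper c s i j. r *\<^sub>R lie_frame c s m)"
proof -
  \<comment> \<open>The normalization in the shape left by simplification; it is what identifies 2
    E_1 and 2 F_1 with combinations of the rotated fields 1 and 6.\<close>
  have cs: "c * (c * 2) + s * (s * 2) = 2" using assms(1) by algebra
  show ?thesis
    using assms(2-4) unfolding one_to_seven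
    by (elim insertE emptyE)
      (simp_all del: One_nat_def add: lie_frame_eval su2_brackets_upper_def group_mult_def quat_mult quat_linear
        quat_consts(2) zero_prod_def quat_eq_iff complex_eq_iff algebra_simps cs)
qed

lemma lie_bracket:
  assumes "c\<^sup>2 + s\<^sup>2 = 1" "i \<in> {1..7}" "j \<in> {1..7}"
  shows "group_mult (lie_frame c s i) (lie_frame c s j) - group_mult (lie_frame c s j) (lie_frame c s i) =
    (\<Sum>(r, m)\<leftarrow>su2_brackets c s i j. r *\<^sub>R lie_frame c s m)"
proof -
  have neg: "(\<Sum>(r, m)\<leftarrow>map (\<lambda>(r, m). (- r, m)) l. r *\<^sub>R lie_frame c s m) = - (\<Sum>(r, m)\<leftarrow>l. r *\<^sub>R lie_frame c s m)" for l
    by (induction l) auto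
  show ?thesis
  proof (cases "j < i")
    case True
    then have *: "su2_brackets c s i j = map (\<lambda>(r, m). (- r, m)) (su2_brackets_upper c s j i)"
      by (simp add: su2_brackets_def)
    show ?thesis
      unfolding * neg lie_bracket_less[OF assms(1,3,2) less_imp_le[OF True], symmetric] by simp
  qed (use assms in \<open>simp add: su2_brackets_def lie_bracket_less\<close>)
qed

section \<open>Left-invariant frames and forms\<close>

definition left_frame :: "real \<Rightarrow> real \<Rightarrow> nat \<Rightarrow> ambient \<Rightarrow> ambient" where
  "left_frame c s i q = group_mult q (lie_frame c s i)"

definition left_coframe :: "real \<Rightarrow> real \<Rightarrow> ambient \<Rightarrow> nat \<Rightarrow> ambient \<Rightarrow> real" where
  "left_coframe c s q i v = lie_coframe c s i (group_mult (group_inverse q) v)"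

lemma left_coframe_translate:
  assumes "p \<in> SU2_SU2_U1"
  shows "left_coframe c s p i (group_mult p \<xi>) = lie_coframe c s i \<xi>"
  using assms
  by (simp add: left_coframe_def group_mult_assoc[symmetric] group_mult_inverse group_mult_unit)

text \<open>A left-invariant field is linear in the base point, hence its own derivative:
  \<open>left_frame c s\<close> fills both the slot of the fields and that of their derivatives. The
  bracket of fields becomes the matrix commutator, translated by \<open>q\<close>.\<close>

lemma su2_su2_u1_frame:
  assumes cs: "c\<^sup>2 + s\<^sup>2 = 1"
  shows "su2_su2_u1_frame SU2_SU2_U1 (left_coframe c s) (left_frame c s) (left_frame c s) c s"
proof (intro su2_su2_u1_frame.intro parallelization7.intro)
  show "linear (left_coframe c s q i)" for q i
    unfolding left_coframe_def[abs_def]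
    using linear_compose[OF linear_group_mult_right linear_lie_coframe] by (simp add: comp_def)
  show "smooth_on (\<lambda>q. left_coframe c s q i v) UNIV" for i v
  proof (rule smooth_on_bounded_linear)
    have "linear (\<lambda>q. lie_coframe c s i (group_mult (group_inverse q) v))"
      using linear_compose[OF linear_compose[OF linear_group_inverse linear_group_mult_left] linear_lie_coframe]
      by (simp add: comp_def)
    then show "bounded_linear (\<lambda>q. left_coframe c s q i v)"
      by (simp add: left_coframe_def linear_conv_bounded_linear)
  qed
  show "(left_frame c s i has_derivative left_frame c s i) (at q)" for i q
    unfolding left_frame_def[abs_def]
    using linear_group_mult_left by (intro bounded_linear_imp_has_derivative) (simp add: linear_conv_bounded_linear)
  show "m \<in> {1..7}" if "(r, m) \<in> set (su2_brackets c s i j)" for i j r m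
    using that by (auto simp: su2_brackets_def su2_brackets_upper_def split: if_splits)
next
  fix q :: ambient assume q: "q \<in> SU2_SU2_U1"
  show "subspace (tangent_space SU2_SU2_U1 q)"
    unfolding tangent_space_group[OF q] using linear_group_mult_right subspace_lie_algebra
    by (rule linear_subspace_image)
  show "left_frame c s i q \<in> tangent_space SU2_SU2_U1 q" for i
    unfolding tangent_space_group[OF q] left_frame_def using lie_frame_in by blast
  show "v = (\<Sum>i=1..7. left_coframe c s q i v *\<^sub>R left_frame c s i q)"
    if tangent: "v \<in> tangent_space SU2_SU2_U1 q" for v
  proof -
    obtain \<xi> where v: "v = group_mult q \<xi>" and \<xi>: "\<xi> \<in> lie_algebra"
      using tangent unfolding tangent_space_group[OF q] by blast
    have "v = group_mult q (\<Sum>i=1..7. lie_coframe c s i \<xi> *\<^sub>R lie_frame c s i)"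
      unfolding lie_algebra_expand[OF cs \<xi>, symmetric] by (rule v)
    also have "\<dots> = (\<Sum>i=1..7. left_coframe c s q i v *\<^sub>R left_frame c s i q)"
      unfolding v left_coframe_translate[OF q] left_frame_def
      by (simp add: linear_sum[OF linear_group_mult_right] linear_scale[OF linear_group_mult_right])
    finally show ?thesis .
  qed
  show "left_coframe c s q i (left_frame c s j q) = kron i j" if "i \<in> {1..7}" "j \<in> {1..7}" for i j
    unfolding left_frame_def left_coframe_translate[OF q] using cs that by (rule lie_coframe_frame)
  show "left_frame c s j (left_frame c s i q) - left_frame c s i (left_frame c s j q) =
      (\<Sum>(r, m)\<leftarrow>su2_brackets c s i j. r *\<^sub>R left_frame c s m q)" if "i \<in> {1..7}" "j \<in> {1..7}" for i j
  proof -
    note lin = linear_diff[OF linear_group_mult_right] linear_add[OF linear_group_mult_right]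
      linear_scale[OF linear_group_mult_right] linear_0[OF linear_group_mult_right]
    have sum: "group_mult q (\<Sum>(r, m)\<leftarrow>l. r *\<^sub>R lie_frame c s m) = (\<Sum>(r, m)\<leftarrow>l. r *\<^sub>R left_frame c s m q)" for l
      by (induction l) (auto simp: left_frame_def lin)
    have "left_frame c s j (left_frame c s i q) - left_frame c s i (left_frame c s j q) =
        group_mult q (group_mult (lie_frame c s i) (lie_frame c s j) - group_mult (lie_frame c s j) (lie_frame c s i))"
      by (simp add: left_frame_def group_mult_assoc lin)
    then show ?thesis unfolding lie_bracket[OF cs that] sum .
  qed
qed

lemma left_coframe_invariant:
  assumes "g \<in> SU2_SU2_U1"
  shows "left_coframe c s (group_mult g p) i (group_mult g v) = left_coframe c s p i v"
proof -
  have "group_mult (group_inverse (group_mult g p)) (group_mult g v) =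
      group_mult (group_inverse p) (group_mult (group_mult (group_inverse g) g) v)"
    by (simp add: group_inverse_mult group_mult_assoc)
  then show ?thesis using assms by (simp add: left_coframe_def group_mult_inverse group_mult_unit)
qed

lemma left_invariant_G2_form:
  "left_invariant SU2_SU2_U1 group_mult 3 (\<lambda>p. standard_G2_form (left_coframe c s p))"
  unfolding left_invariant_def form_eq_def
proof (intro ballI)
  fix g p vs assume g: "g \<in> SU2_SU2_U1"
  have "(group_mult g has_derivative group_mult g) (at p)"
    using linear_group_mult_right by (intro bounded_linear_imp_has_derivative) (simp add: linear_conv_bounded_linear)
  then have "frechet_derivative (group_mult g) (at p) = group_mult g"
    by (rule frechet_derivative_at[symmetric])
  then show "standard_G2_form (left_coframe c s (group_mult g p)) (map (frechet_derivative (group_mult g) (at p)) vs) =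
      standard_G2_form (left_coframe c s p) vs"
    by (simp only: standard_G2_form_def coframe_wedge_map left_coframe_invariant[OF g])
qed

theorem proposition6p2:
  shows "(\<exists>\<phi> e \<theta>.
            left_invariant SU2_SU2_U1 group_mult 3 \<phi> \<and>
            strong_G2T_structure SU2_SU2_U1 \<phi> e \<theta> \<and>
            form_eq SU2_SU2_U1 7 (wedge_form 4 (ext_deriv SU2_SU2_U1 3 \<phi>) \<phi>) (\<lambda>p vs. 0) \<and>
            closed_form SU2_SU2_U1 1 \<theta>) \<and>
         (\<exists>\<phi> e.
            left_invariant SU2_SU2_U1 group_mult 3 \<phi> \<and>
            coclosed_G2_structure SU2_SU2_U1 \<phi> e \<and>
            closed_form SU2_SU2_U1 3 (torsion_form SU2_SU2_U1 \<phi> e (\<lambda>p vs. 0)))"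
proof
  \<comment> \<open>With \<open>s = - c\<close> or \<open>s = c\<close>, the normalization c^2 + s^2
    = 1 leaves c^2 = 1/2, so one \<open>c\<close> serves both structures.\<close>
  define c :: real where "c = sqrt (1 / 2)"
  have c: "c\<^sup>2 = 1 / 2" by (simp add: c_def)
  interpret twisted: su2_su2_u1_frame SU2_SU2_U1 "left_coframe c (- c)" "left_frame c (- c)" "left_frame c (- c)" c "- c"
    by (rule su2_su2_u1_frame) (simp add: c)
  have "left_invariant SU2_SU2_U1 group_mult 3 twisted.\<phi>"
    using left_invariant_G2_form by (simp add: twisted.\<phi>_def[abs_def])
  with twisted.strong_G2T_phi twisted.dphi_wedge_phi[OF refl] twisted.closed_theta
  show "\<exists>\<phi> e \<theta>.
            left_invariant SU2_SU2_U1 group_mult 3 \<phi> \<and>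
            strong_G2T_structure SU2_SU2_U1 \<phi> e \<theta> \<and>
            form_eq SU2_SU2_U1 7 (wedge_form 4 (ext_deriv SU2_SU2_U1 3 \<phi>) \<phi>) (\<lambda>p vs. 0) \<and>
            closed_form SU2_SU2_U1 1 \<theta>" by blast
  interpret coclosed: su2_su2_u1_frame SU2_SU2_U1 "left_coframe c c" "left_frame c c" "left_frame c c" c c
    by (rule su2_su2_u1_frame) (simp add: c)
  have "left_invariant SU2_SU2_U1 group_mult 3 coclosed.\<phi>"
    using left_invariant_G2_form by (simp add: coclosed.\<phi>_def[abs_def])
  with coclosed.coclosed_phi[OF refl] coclosed.closed_torsion[unfolded coclosed.theta_zero[OF refl]]
  show "\<exists>\<phi> e.
            left_invariant SU2_SU2_U1 group_mult 3 \<phi> \<and>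
            coclosed_G2_structure SU2_SU2_U1 \<phi> e \<and>
            closed_form SU2_SU2_U1 3 (torsion_form SU2_SU2_U1 \<phi> e (\<lambda>p vs. 0))" by blast
qed

end
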